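(* Let $F$ be a connected compact simple Lie group, and for $n\ge 1$ let $CPS(n)$ and $REM(n)$ be, respectively, the number of critical points of the scalar curvature function on invariant metrics of fixed volume for the Ledger–Obata space $F^{n+1}/\operatorname{diag}(F)$, and the number of those critical points (up to homothety) that are routine Einstein metrics (precise definitions in the context). Then for every $n\geq 1$ $$CPS(n)\ \geq\ REM(n)\ \geq\ \bigl(1+\sqrt{2}\bigr)^{n-1}.$$
   Context: Let $F$ be a connected compact simple Lie group (with simple, non-abelian Lie algebra $\mathfrak f$), let $\operatorname{diag}(F)$ denote the diagonal subgroup of a power of $F$, and let $\langle\cdot,\cdot\rangle=-B(\cdot,\cdot)$ be minus the Killing form, both on $\mathfrak f$ and on $\mathfrak g=n\mathfrak f=\mathfrak f\oplus\cdots\oplus\mathfrak f$ ($n$ summands), the Lie algebra of $G=F^n$. Let $H=\operatorname{diag}(F)\subset G$, $\mathfrak h=\{(X,\dots,X)\mid X\in\mathfrak f\}$. Identification of metrics. The group $F^{n+1}$ acts transitively on $G=F^n$ by $(a_1,\dots,a_n,a_{n+1})\circ(x_1,\dots,x_n)=(a_1x_1a_{n+1}^{-1},\dots,a_nx_na_{n+1}^{-1})$ with isotropy group $\operatorname{diag}(F)$ at the unit; this identifies $F^{n+1}/\operatorname{diag}(F)$ with $F^n$, and $F^{n+1}$-invariant Riemannian metrics on the Ledger–Obata space $F^{n+1}/\operatorname{diag}(F)$ with left-invariant $\operatorname{Ad}(H)$-invariant metrics on $G$, i.e. with $\operatorname{ad}(\mathfrak h)$-invariant inner products on $\mathfrak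 g$. Metric generated by a matrix. A non-degenerate real $(n\times n)$-matrix $A=(\alpha_{ij})$ generates (determines) the $\operatorname{ad}(\mathfrak h)$-invariant inner product on $\mathfrak g$, and the corresponding left-invariant Riemannian metric on $G=F^n$, for which the vectors $f_{ij}=(\alpha_{i1}X_j,\alpha_{i2}X_j,\dots,\alpha_{in}X_j)$, $1\le i\le n$, $1\le j\le \dim\mathfrak f$, form an orthonormal basis, where $\{X_j\}$ is any $\langle\cdot,\cdot\rangle$-orthonormal basis of $\mathfrak f$. Scalar curvature function. Let $M$ be the set of $\operatorname{ad}(\mathfrak h)$-invariant inner products on $\mathfrak g$ of volume $1$ with respect to $\langle\cdot,\cdot\rangle$ (i.e. whose determinant relative to $\langle\cdot,\cdot\rangle$ is $1$), and let $S:M\to\mathbb R$ assign to an inner product the (constant) scalar curvature of the corresponding left-invariant metric on $G$. The critical points of $S$ are exactly the Einstein metrics in $M$. $CPS(n)$ is the number of critical points of $S$ on $M$ (inner products are counted as such, isometric ones not being identified). Routine metrics. For $k\ge1$ let $A_k^{st}=\sqrt{\frac{4(k+1)}{k+3}}\,(a_{ij})$ be the lower triangular $(k\times k)$-matrix with $a_{ij}=\frac{1}{\sqrt{(k-i+1)(k-i+2)}}$ for $j<i$, $a_{ii}=\sqrt{\frac{k-i+2}{k-i+1}}$, and $a_{ij}=0$ for $j>i$; it generates on $F^k$ an Einstein metric with Einstein constant $1$, isometric to a multiple of the standard metric on $F^{k+1}/\operatorname{diag}(F)$ (the one induced by minus the Killing form of the Lie algebra of $F^{k+1}$). An invariant Einstein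 metric on $F^{n+1}/\operatorname{diag}(F)$ (equivalently on $F^n$) is called routine if it is isometric or homothetic (i.e. isometric up to a positive constant multiple) to a metric generated by a block-diagonal matrix $\operatorname{diag}(A_{k_1}^{st},A_{k_2}^{st},\dots,A_{k_l}^{st})$ for some positive integers $k_1,\dots,k_l$ with $k_1+\cdots+k_l=n$. $REM(n)$ is the number of critical points of the scalar curvature function, counted up to homothety (multiplication of the metric by a positive constant), that are routine Einstein metrics. *)

theory Defs
  imports "HOL-Analysis.Analysis" "HOL-Library.Extended_Nat" "HOL-Library.Extended_Real"
begin

definition ecard :: "'a set \<Rightarrow> enat" where
  "ecard X = (if finite X then enat (card X) else \<infinity>)"


section \<open>Smooth manifolds and Lie groups\<close>

text \<open>Both notions of smoothness below are only used on open sets.\<close>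

primrec Ck_on :: "nat \<Rightarrow> ('a::real_normed_vector \<Rightarrow> 'b::real_normed_vector) \<Rightarrow> 'a set \<Rightarrow> bool" where
  "Ck_on 0 f S \<longleftrightarrow> continuous_on S f"
| "Ck_on (Suc k) f S \<longleftrightarrow>
     (\<forall>x\<in>S. f differentiable (at x)) \<and> (\<forall>v. Ck_on k (\<lambda>x. frechet_derivative f (at x) v) S)"

definition smooth_on :: "'a set \<Rightarrow> ('a::real_normed_vector \<Rightarrow> 'b::real_normed_vector) \<Rightarrow> bool" where
  "smooth_on S f \<longleftrightarrow> (\<forall>k. Ck_on k f S)"

type_synonym ('m, 'e) chart = "'m set \<times> ('m \<Rightarrow> 'e)"

definition is_chart :: "('m::topological_space, 'e::real_normed_vector) chart \<Rightarrow> bool" where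
  "is_chart = (\<lambda>(U, c). open U \<and> open (c ` U) \<and> homeomorphism U (c ` U) c (inv_into U c))"

definition smooth_atlas :: "('m::topological_space, 'e::real_normed_vector) chart set \<Rightarrow> bool" where
  "smooth_atlas \<A> \<longleftrightarrow>
     (\<forall>k\<in>\<A>. is_chart k) \<and> (\<Union>(U, c)\<in>\<A>. U) = UNIV \<and>
     (\<forall>(U, c)\<in>\<A>. \<forall>(V, d)\<in>\<A>. smooth_on (c ` (U \<inter> V)) (d \<circ> inv_into U c))"

definition smooth_map ::
  "('m::topological_space, 'e::real_normed_vector) chart set \<Rightarrow>
   ('p::topological_space, 'g::real_normed_vector) chart set \<Rightarrow> ('m \<Rightarrow> 'p) \<Rightarrow> bool" where
  "smooth_map \<A> \<B> f \<longleftrightarrow> continuous_on UNIV f \<and>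
     (\<forall>(U, c)\<in>\<A>. \<forall>(V, d)\<in>\<B>. smooth_on (c ` (U \<inter> f -` V)) (d \<circ> f \<circ> inv_into U c))"

definition diffeo ::
  "('m::topological_space, 'e::real_normed_vector) chart set \<Rightarrow> ('m \<Rightarrow> 'm) \<Rightarrow> bool" where
  "diffeo \<A> f \<longleftrightarrow> bij f \<and> smooth_map \<A> \<A> f \<and> smooth_map \<A> \<A> (inv f)"

definition prod_atlas ::
  "('m, 'e) chart set \<Rightarrow> ('p, 'g) chart set \<Rightarrow> ('m \<times> 'p, 'e \<times> 'g) chart set" where
  "prod_atlas \<A> \<B> = {(U \<times> V, map_prod c d) | U c V d. (U, c) \<in> \<A> \<and> (V, d) \<in> \<B>}"

definition power_chart :: "('n \<Rightarrow> ('m, 'e) chart) \<Rightarrow> ('m ^ 'n, 'e ^ 'n) chart" where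
  "power_chart k = ({x. \<forall>i. x $ i \<in> fst (k i)}, \<lambda>x. \<chi> i. snd (k i) (x $ i))"

definition power_atlas :: "('m, 'e) chart set \<Rightarrow> ('m ^ 'n, 'e ^ 'n) chart set" where
  "power_atlas \<A> = {power_chart k | k. \<forall>i. k i \<in> \<A>}"

text \<open>
  Groups are types of class \<^class>\<open>group_add\<close>; they are written additively but need not be
  commutative. The factors must therefore be kept in order: \<open>- \<phi> p + \<phi> (p + x)\<close> stands for
  \<open>\<phi>(p)\<^sup>-\<^sup>1 \<phi>(p x)\<close>. The power group \<open>F\<^sup>n\<close> is the vector type with componentwise operations.
\<close>

definition lie_group ::
  "('f::{group_add, t2_space, second_countable_topology}, 'e::euclidean_space) chart set \<Rightarrow> bool" where
  "lie_group \<A> \<longleftrightarrow> smooth_atlas \<A> \<and>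
     smooth_map (prod_atlas \<A> \<A>) \<A> (\<lambda>(x, y). x + y) \<and> smooth_map \<A> \<A> uminus"

text \<open>
  A chart \<open>(U, c)\<close> with \<open>0 \<in> U\<close> identifies the tangent space at the neutral element with the
  model space. In this chart, \<open>left_field (U, c) v\<close> is the left-invariant vector field with
  value \<open>v\<close> at the neutral element (as a function of the coordinates of the base point), and
  \<open>lie_bracket\<close> is the commutator of two such vector fields at the neutral element.
\<close>

definition left_field ::
  "('f::group_add, 'e::real_normed_vector) chart \<Rightarrow> 'e \<Rightarrow> 'e \<Rightarrow> 'e" where
  "left_field = (\<lambda>(U, c) v p.
     frechet_derivative (\<lambda>q. c (inv_into U c p + inv_into U c q)) (at (c 0)) v)"

definition lie_bracket ::
  "('f::group_add, 'e::real_normed_vector) chart \<Rightarrow> 'e \<Rightarrow> 'e \<Rightarrow> 'e" where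
  "lie_bracket k v w =
     frechet_derivative (left_field k w) (at (snd k 0)) v -
     frechet_derivative (left_field k v) (at (snd k 0)) w"

text \<open>
  The differential of \<open>\<phi>\<close> at \<open>p\<close>, where the tangent spaces at \<open>p\<close> and at \<open>\<phi> p\<close> are identified
  with the one at the neutral element by left translations.
\<close>

definition left_differential ::
  "('g::group_add, 'e::real_normed_vector) chart \<Rightarrow> ('g \<Rightarrow> 'g) \<Rightarrow> 'g \<Rightarrow> 'e \<Rightarrow> 'e" where
  "left_differential = (\<lambda>(U, c) \<phi> p.
     frechet_derivative (\<lambda>q. c (- \<phi> p + \<phi> (p + inv_into U c q))) (at (c 0)))"


section \<open>Lie algebras\<close>

type_synonym 'a bracket = "'a \<Rightarrow> 'a \<Rightarrow> 'a"
type_synonym 'a form = "'a \<Rightarrow> 'a \<Rightarrow> real"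

definition simple_bracket :: "'a::real_vector bracket \<Rightarrow> bool" where
  "simple_bracket br \<longleftrightarrow> (\<exists>x y. br x y \<noteq> 0) \<and>
     (\<forall>I. subspace I \<and> (\<forall>x. \<forall>y\<in>I. br x y \<in> I) \<longrightarrow> I = {0} \<or> I = UNIV)"

definition lin_trace :: "('a::euclidean_space \<Rightarrow> 'a) \<Rightarrow> real" where
  "lin_trace L = (\<Sum>e\<in>Basis. L e \<bullet> e)"

definition minus_killing :: "'a::euclidean_space bracket \<Rightarrow> 'a form" where
  "minus_killing br x y = - lin_trace (\<lambda>z. br x (br y z))"

definition power_bracket :: "'a bracket \<Rightarrow> ('a ^ 'n) bracket" where
  "power_bracket br x y = (\<chi> i. br (x $ i) (y $ i))"

definition inner_product :: "'a::real_vector form \<Rightarrow> bool" where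
  "inner_product b \<longleftrightarrow> bilinear b \<and> (\<forall>x y. b x y = b y x) \<and> (\<forall>x. x \<noteq> 0 \<longrightarrow> b x x > 0)"


section \<open>Curvature of left-invariant metrics\<close>

text \<open>
  A left-invariant metric is given by an inner product on the Lie algebra. Its Levi-Civita
  connection on left-invariant vector fields is given by the Koszul formula, in which the
  derivatives of the (constant) inner products of left-invariant fields vanish.
\<close>

definition sharp :: "'a form \<Rightarrow> ('a \<Rightarrow> real) \<Rightarrow> 'a" where
  "sharp b f = (THE w. \<forall>z. b w z = f z)"

definition levi_civita :: "'a::real_vector bracket \<Rightarrow> 'a form \<Rightarrow> 'a bracket" where
  "levi_civita br b x y = sharp b (\<lambda>z. (b (br x y) z - b (br y z) x + b (br z x) y) / 2)"

definition riemann ::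
  "'a::real_vector bracket \<Rightarrow> 'a form \<Rightarrow> 'a \<Rightarrow> 'a \<Rightarrow> 'a \<Rightarrow> 'a" where
  "riemann br b x y z =
     (let D = levi_civita br b in D x (D y z) - D y (D x z) - D (br x y) z)"

definition ricci :: "'a::euclidean_space bracket \<Rightarrow> 'a form \<Rightarrow> 'a form" where
  "ricci br b y z = lin_trace (\<lambda>x. riemann br b x y z)"

definition scalar_curvature :: "'a::euclidean_space bracket \<Rightarrow> 'a form \<Rightarrow> real" where
  "scalar_curvature br b = lin_trace (\<lambda>x. sharp b (ricci br b x))"

definition einstein :: "'a::euclidean_space bracket \<Rightarrow> 'a form \<Rightarrow> bool" where
  "einstein br b \<longleftrightarrow> (\<exists>r. \<forall>x y. ricci br b x y = r * b x y)"


section \<open>Invariant metrics on Ledger--Obata spaces\<close>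

text \<open>
  Below, \<open>br\<close> is the bracket of \<open>\<ff>\<close>, carried by the type \<open>real ^ 'd\<close>, and \<open>\<gg> = n \<ff>\<close> is carried
  by \<open>real ^ 'd ^ 'n\<close> with \<open>n = CARD('n)\<close>. The invariant metrics on \<open>F\<^sup>n\<^sup>+\<^sup>1 / diag(F)\<close> are the
  inner products on \<open>\<gg>\<close> that are invariant under the diagonal subalgebra.
\<close>

definition diag :: "'a \<Rightarrow> 'a ^ 'n" where
  "diag x = (\<chi> i. x)"

definition invariant_metric :: "(real ^ 'd) bracket \<Rightarrow> (real ^ 'd ^ 'n) form \<Rightarrow> bool" where
  "invariant_metric br b \<longleftrightarrow> inner_product b \<and>
     (\<forall>x u v. b (power_bracket br (diag x) u) v + b u (power_bracket br (diag x) v) = 0)"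

definition gram :: "(real ^ 'd ^ 'n) form \<Rightarrow> real ^ ('n \<times> 'd) ^ ('n \<times> 'd)" where
  "gram b = (\<chi> p q. b (axis (fst p) (axis (snd p) 1)) (axis (fst q) (axis (snd q) 1)))"

definition relative_det :: "(real ^ 'd ^ 'n) form \<Rightarrow> (real ^ 'd ^ 'n) form \<Rightarrow> real" where
  "relative_det q b = det (gram b) / det (gram q)"

definition unit_volume_metrics :: "(real ^ 'd) bracket \<Rightarrow> (real ^ 'd ^ 'n) form set" where
  "unit_volume_metrics br =
     {b. invariant_metric br b \<and> relative_det (minus_killing (power_bracket br)) b = 1}"

definition critical_metrics :: "(real ^ 'd) bracket \<Rightarrow> (real ^ 'd ^ 'n) form set" where
  "critical_metrics br = {b \<in> unit_volume_metrics br.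
     \<forall>\<gamma>. \<gamma> 0 = b \<and> (\<forall>t. \<gamma> t \<in> unit_volume_metrics br) \<and>
          (\<forall>u v t. (\<lambda>s. \<gamma> s u v) differentiable (at t)) \<longrightarrow>
          ((\<lambda>t. scalar_curvature (power_bracket br) (\<gamma> t)) has_real_derivative 0) (at (0::real))}"

text \<open>
  The metric generated by \<open>A\<close>. The orthonormal basis \<open>X\<close> is taken with respect to minus the
  Killing form; the generated metric does not depend on its choice.
\<close>

definition generates ::
  "(real ^ 'd) bracket \<Rightarrow> real ^ 'n ^ 'n \<Rightarrow> (real ^ 'd ^ 'n) form \<Rightarrow> bool" where
  "generates br A b \<longleftrightarrow> inner_product b \<and>
     (\<exists>X :: 'd \<Rightarrow> real ^ 'd.
        (\<forall>j j'. minus_killing br (X j) (X j') = (if j = j' then 1 else 0)) \<and>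
        (\<forall>i j i' j'. b (\<chi> m. A $ i $ m *\<^sub>R X j) (\<chi> m. A $ i' $ m *\<^sub>R X j') =
           (if i = i' \<and> j = j' then 1 else 0)))"

definition isometric ::
  "('f::{group_add, topological_space}, real ^ 'd) chart set \<Rightarrow> ('f, real ^ 'd) chart \<Rightarrow>
   (real ^ 'd ^ 'n) form \<Rightarrow> (real ^ 'd ^ 'n) form \<Rightarrow> bool" where
  "isometric \<A> k b b' \<longleftrightarrow> (\<exists>\<phi> :: 'f ^ 'n \<Rightarrow> 'f ^ 'n. diffeo (power_atlas \<A>) \<phi> \<and>
     (\<forall>p u v. let D = left_differential (power_chart (\<lambda>_. k)) \<phi> p in b' (D u) (D v) = b u v))"

text \<open>Indices of \<open>standard_entry\<close> start at 1, those of \<open>block_entry\<close> at 0.\<close>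

definition standard_entry :: "nat \<Rightarrow> nat \<Rightarrow> nat \<Rightarrow> real" where
  "standard_entry k i j = sqrt (4 * (real k + 1) / (real k + 3)) *
     (if j < i then 1 / sqrt ((real k - real i + 1) * (real k - real i + 2))
      else if j = i then sqrt ((real k - real i + 2) / (real k - real i + 1))
      else 0)"

fun block_entry :: "nat list \<Rightarrow> nat \<Rightarrow> nat \<Rightarrow> real" where
  "block_entry [] i j = 0"
| "block_entry (k # ks) i j =
     (if i < k \<and> j < k then standard_entry k (Suc i) (Suc j)
      else if i < k \<or> j < k then 0
      else block_entry ks (i - k) (j - k))"

definition block_matrix :: "nat list \<Rightarrow> real ^ ('n::{finite, linorder}) ^ ('n::{finite, linorder})"
  where
  "block_matrix ks = (\<chi> i j. block_entry ks (card {l. l < i}) (card {l. l < j}))"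

definition routine ::
  "('f::{group_add, topological_space}, real ^ 'd) chart set \<Rightarrow> ('f, real ^ 'd) chart \<Rightarrow>
   (real ^ 'd ^ ('n::{finite, linorder})) form \<Rightarrow> bool" where
  "routine \<A> k b \<longleftrightarrow>
     invariant_metric (lie_bracket k) b \<and> einstein (power_bracket (lie_bracket k)) b \<and>
     (\<exists>ks b' r. (\<forall>m\<in>set ks. m \<ge> 1) \<and> sum_list ks = CARD('n) \<and>
        generates (lie_bracket k) (block_matrix ks) b' \<and>
        r > 0 \<and> isometric \<A> k b (\<lambda>u v. r * b' u v))"

definition homothety :: "('a form \<times> 'a form) set" where
  "homothety = {(b, b'). \<exists>r>0. b' = (\<lambda>u v. r * b u v)}"

text \<open>The argument of type \<open>'n itself\<close> only carries the number \<open>n = CARD('n)\<close>.\<close>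

definition CPS :: "(real ^ 'd) bracket \<Rightarrow> 'n::finite itself \<Rightarrow> enat" where
  "CPS br _ = ecard (critical_metrics br :: (real ^ 'd ^ 'n) form set)"

definition REM ::
  "('f::{group_add, topological_space}, real ^ 'd) chart set \<Rightarrow> ('f, real ^ 'd) chart \<Rightarrow>
   'n::{finite, linorder} itself \<Rightarrow> enat" where
  "REM \<A> k _ =
     ecard ({b :: (real ^ 'd ^ ('n::{finite, linorder})) form.
             b \<in> critical_metrics (lie_bracket k) \<and> routine \<A> k b} // homothety)"

end

theory Submission
  imports Defs
begin

text \<open>
  For blocks of size 1 the block-diagonal matrix is twice the identity and generates a multiple of the
  bi-invariant product metric of the Killing forms. Given a forest on the \<open>n\<close> indices, where \<open>p\<close> denotes
  the parent of \<open>i\<close>, the map that replaces the component \<open>x\<^sub>i\<close> by \<open>x\<^sub>i x\<^sub>p\<^sup>-\<^sup>1\<close> (and keeps it at the roots) is a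
  diffeomorphism of \<open>F\<^sup>n\<close>; by the Ad-invariance of the Killing form it pulls the product metric back to
  the left-invariant metric \<open>\<Sum>\<^sub>i \<langle>x\<^sub>i - x\<^sub>p, y\<^sub>i - y\<^sub>p\<rangle>\<close>, which has volume 1. The indicator vectors of the
  subtrees give an orthonormal frame in which its Ricci tensor is a quarter of the metric, hence the metric
  is critical. It determines the forest, and there are at least \<open>3\<^sup>n\<^sup>-\<^sup>1\<close> forests.

  The Killing form is negative definite because the derivative of \<open>Ad\<close> at the neutral element is the
  bracket and the compact group \<open>Ad(F)\<close> preserves an inner product.
\<close>

section \<open>Functions of class \<open>C\<^sup>k\<close>\<close>

text \<open>Isometric inner products are not identified in the count, so a single isometry class can
  be counted once for every forest. The forests stem from the picture F^(n+1)/diag(F): joining the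
  roots to the extra index turns a forest into a spanning tree on n+1 indices, and the new
  coordinates run along its edges. All labelled forests would give Cayley's number (n+1)^(n-1); a
  family described by one of three labels at each index except the least suffices, because 1 + sqrt
  2 <= 3.

  The isometry onto the product metric serves \<open>routine\<close> only. It is in general no
  homomorphism, while curvature is defined by algebra at the neutral element, so the Ricci tensor is
  not carried along it but computed from structure constants; the quarter is the Einstein constant
  of minus the Killing form. Criticality is the first variation formula: the differential of the
  scalar curvature is minus the pairing with the Ricci tensor, and a curve of constant volume has a
  velocity of trace zero.\<close>

lemma frechet_derivative_eq:
  "(f has_derivative f') (at x) \<Longrightarrow> frechet_derivative f (at x) = f'"
  using frechet_derivative_at by metis

text \<open>\<open>frechet_derivative\<close> is total, so a derivative formula is available on S
  only. Openness makes functions that agree on S have the same derivatives there, which lets the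
  closure lemmas below replace a derivative by its formula.\<close>

lemma Ck_on_cong:
  assumes "open S" "\<And>x. x \<in> S \<Longrightarrow> f x = g x"
  shows "Ck_on k f S \<longleftrightarrow> Ck_on k g S"
  using assms(2)
proof (induction k arbitrary: f g)
  case 0
  then show ?case by (auto intro: continuous_on_eq)
next
  case (Suc k)
  have d: "f differentiable (at x) \<longleftrightarrow> g differentiable (at x)" if "x \<in> S" for x
  proof -
    have "(f has_derivative D) (at x) \<Longrightarrow> (g has_derivative D) (at x)"
         "(g has_derivative D) (at x) \<Longrightarrow> (f has_derivative D) (at x)" for D
      by (erule has_derivative_transform_within_open[OF _ assms(1) that], simp add: Suc.prems)+
    then show ?thesis unfolding differentiable_def by blast
  qed
  have e: "frechet_derivative f (at x) = frechet_derivative g (at x)"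
    if "x \<in> S" "f differentiable (at x)" for x
    using frechet_derivative_transform_within_open[OF that(2) assms(1) that(1)] Suc.prems by blast
  show ?case
  proof (cases "\<forall>x\<in>S. f differentiable (at x)")
    case True
    then have "Ck_on k (\<lambda>x. frechet_derivative f (at x) v) S \<longleftrightarrow>
        Ck_on k (\<lambda>x. frechet_derivative g (at x) v) S" for v
      by (intro Suc.IH) (simp add: e)
    then show ?thesis using d by simp
  next
    case False
    then show ?thesis using d by auto
  qed
qed

lemma Ck_on_subset: "Ck_on k f S \<Longrightarrow> T \<subseteq> S \<Longrightarrow> Ck_on k f T"
proof (induction k arbitrary: f)
  case 0
  then show ?case using continuous_on_subset by simp
next
  case (Suc k)
  then show ?case by (simp add: subset_iff)
qed

text \<open>Derivatives are taken at points, not within the set, so the class C^k is local. In a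
  composition through charts an intermediate chart is available only near each point.\<close>

lemma Ck_on_local:
  assumes "\<And>x. x \<in> S \<Longrightarrow> \<exists>T. open T \<and> x \<in> T \<and> Ck_on k f T"
  shows "Ck_on k f S"
  using assms
proof (induction k arbitrary: f)
  case 0
  have "isCont f x" if "x \<in> S" for x
    using 0[OF that] by (auto simp: continuous_on_eq_continuous_at)
  then show ?case by (simp add: continuous_at_imp_continuous_on)
next
  case (Suc k)
  then have "f differentiable (at x)" if "x \<in> S" for x using that by fastforce
  moreover have "Ck_on k (\<lambda>x. frechet_derivative f (at x) v) S" for v
    by (rule Suc.IH) (use Suc.prems in fastforce)
  ultimately show ?case by simp
qed

lemma Ck_on_imp_continuous_on: "Ck_on k f S \<Longrightarrow> continuous_on S f"
  by (cases k) (simp_all add: continuous_at_imp_continuous_on differentiable_imp_continuous_within)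

text \<open>In the product and chain rules a derivative of class C^k meets an undifferentiated
  factor, which must be lowered from k + 1 to k.\<close>

lemma Ck_on_Suc_imp: "Ck_on (Suc k) f S \<Longrightarrow> Ck_on k f S"
proof (induction k arbitrary: f)
  case 0
  then show ?case using Ck_on_imp_continuous_on[of "Suc 0" f S] by simp
next
  case (Suc k)
  then have "\<forall>x\<in>S. f differentiable (at x)" "\<And>v. Ck_on (Suc k) (\<lambda>x. frechet_derivative f (at x) v) S"
    unfolding Ck_on.simps(2)[of "Suc k"] by blast+
  then show ?case using Suc.IH by (simp only: Ck_on.simps(2)[of k]) blast
qed

lemma Ck_on_const: "Ck_on k (\<lambda>x. a) S"
  by (induction k arbitrary: a) auto

lemma Ck_on_bounded_linear:
  assumes "bounded_linear L"
  shows "Ck_on k L S"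
proof (cases k)
  case 0
  then show ?thesis using assms by (simp add: linear_continuous_on)
next
  case (Suc m)
  have d: "(L has_derivative L) (at x)" for x
    using assms by (rule bounded_linear_imp_has_derivative)
  then have "L differentiable (at x)" for x by (auto simp: differentiable_def)
  then show ?thesis using Suc frechet_derivative_eq[OF d] by (simp add: Ck_on_const)
qed

lemma Ck_on_bounded_linear_comp:
  assumes "bounded_linear L" "open S" "Ck_on k f S"
  shows "Ck_on k (\<lambda>x. L (f x)) S"
  using assms(3)
proof (induction k arbitrary: f)
  case 0
  then show ?case by (simp add: bounded_linear.continuous_on[OF assms(1)])
next
  case (Suc k)
  have d: "((\<lambda>x. L (f x)) has_derivative (\<lambda>v. L (frechet_derivative f (at x) v))) (at x)"
    if "x \<in> S" for x
    using Suc.prems that assms(1)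
    by (intro bounded_linear.has_derivative[OF assms(1)]) (auto simp: frechet_derivative_works[symmetric])
  have "Ck_on k (\<lambda>x. frechet_derivative (\<lambda>x. L (f x)) (at x) v) S" for v
  proof (subst Ck_on_cong[OF assms(2)])
    show "frechet_derivative (\<lambda>x. L (f x)) (at x) v = L (frechet_derivative f (at x) v)"
      if "x \<in> S" for x using frechet_derivative_eq[OF d[OF that]] by simp
    show "Ck_on k (\<lambda>x. L (frechet_derivative f (at x) v)) S" using Suc by auto
  qed
  then show ?case using d by (auto simp: differentiable_def)
qed

lemma Ck_on_add:
  assumes "open S" "Ck_on k f S" "Ck_on k g S"
  shows "Ck_on k (\<lambda>x. f x + g x) S"
  using assms(2,3)
proof (induction k arbitrary: f g)
  case 0
  then show ?case by (simp add: continuous_on_add)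
next
  case (Suc k)
  have d: "((\<lambda>x. f x + g x) has_derivative
      (\<lambda>v. frechet_derivative f (at x) v + frechet_derivative g (at x) v)) (at x)"
    if "x \<in> S" for x
    using Suc.prems that
    by (intro has_derivative_add) (auto simp: frechet_derivative_works[symmetric])
  have "Ck_on k (\<lambda>x. frechet_derivative (\<lambda>x. f x + g x) (at x) v) S" for v
  proof (subst Ck_on_cong[OF assms(1)])
    show "frechet_derivative (\<lambda>x. f x + g x) (at x) v =
        frechet_derivative f (at x) v + frechet_derivative g (at x) v"
      if "x \<in> S" for x using frechet_derivative_eq[OF d[OF that]] by simp
    show "Ck_on k (\<lambda>x. frechet_derivative f (at x) v + frechet_derivative g (at x) v) S"
      using Suc by auto
  qed
  then show ?case using d by (auto simp: differentiable_def)
qed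

lemma Ck_on_sum:
  assumes "open S" "\<And>i. i \<in> I \<Longrightarrow> Ck_on k (f i) S"
  shows "Ck_on k (\<lambda>x. \<Sum>i\<in>I. f i x) S"
  using assms(2)
  by (induction I rule: infinite_finite_induct)
    (auto simp: Ck_on_const intro!: Ck_on_add assms(1))

lemma Ck_on_scaleR:
  fixes f :: "'a::real_normed_vector \<Rightarrow> real" and g :: "'a \<Rightarrow> 'b::real_normed_vector"
  assumes "open S" "Ck_on k f S" "Ck_on k g S"
  shows "Ck_on k (\<lambda>x. f x *\<^sub>R g x) S"
  using assms(2,3)
proof (induction k arbitrary: f g)
  case 0
  then show ?case by (simp add: continuous_on_scaleR)
next
  case (Suc k)
  have d: "((\<lambda>x. f x *\<^sub>R g x) has_derivative
      (\<lambda>v. f x *\<^sub>R frechet_derivative g (at x) v + frechet_derivative f (at x) v *\<^sub>R g x)) (at x)"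
    if "x \<in> S" for x
    using Suc.prems that
    by (intro has_derivative_scaleR) (auto simp: frechet_derivative_works[symmetric])
  have "Ck_on k (\<lambda>x. frechet_derivative (\<lambda>x. f x *\<^sub>R g x) (at x) v) S" for v
  proof (subst Ck_on_cong[OF assms(1)])
    show "frechet_derivative (\<lambda>x. f x *\<^sub>R g x) (at x) v =
        f x *\<^sub>R frechet_derivative g (at x) v + frechet_derivative f (at x) v *\<^sub>R g x"
      if "x \<in> S" for x using frechet_derivative_eq[OF d[OF that]] by simp
    show "Ck_on k (\<lambda>x. f x *\<^sub>R frechet_derivative g (at x) v +
        frechet_derivative f (at x) v *\<^sub>R g x) S"
      using Suc.prems Suc.prems[THEN Ck_on_Suc_imp]
      by (intro Ck_on_add Suc.IH assms(1)) (simp_all del: One_nat_def)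
  qed
  then show ?case using d by (auto simp: differentiable_def)
qed

lemma Ck_on_componentwise:
  fixes f :: "'a::real_normed_vector \<Rightarrow> 'b::euclidean_space"
  assumes "open S" "\<And>e. e \<in> Basis \<Longrightarrow> Ck_on k (\<lambda>x. f x \<bullet> e) S"
  shows "Ck_on k f S"
proof -
  have "Ck_on k (\<lambda>x. \<Sum>e\<in>Basis. (f x \<bullet> e) *\<^sub>R e) S"
    by (intro Ck_on_sum Ck_on_scaleR assms Ck_on_const)
  then show ?thesis by (simp add: euclidean_representation)
qed

text \<open>\<open>Ck_on\<close> speaks of derivatives in fixed directions, whereas the chain rule
  differentiates g in a direction that moves with x. Expanding this direction in the basis of the
  intermediate space gives a sum of products to which the induction applies.\<close>

lemma Ck_on_compose:
  fixes f :: "'a::real_normed_vector \<Rightarrow> 'b::euclidean_space" and g :: "'b \<Rightarrow> 'c::real_normed_vector"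
  assumes "open S" "open T" "f ` S \<subseteq> T" "Ck_on k f S" "Ck_on k g T"
  shows "Ck_on k (\<lambda>x. g (f x)) S"
  using assms(4,5)
proof (induction k arbitrary: g)
  case 0
  then show ?case using continuous_on_compose2[OF _ _ assms(3)] by simp
next
  case (Suc k)
  have g': "(g has_derivative frechet_derivative g (at (f x))) (at (f x))" if "x \<in> S" for x
    using Suc.prems(2) assms(3) that by (auto simp: frechet_derivative_works[symmetric])
  have f': "(f has_derivative frechet_derivative f (at x)) (at x)" if "x \<in> S" for x
    using Suc.prems(1) that by (auto simp: frechet_derivative_works[symmetric])
  have d: "((\<lambda>x. g (f x)) has_derivative
      (\<lambda>v. frechet_derivative g (at (f x)) (frechet_derivative f (at x) v))) (at x)"
    if "x \<in> S" for x
    using diff_chain_at[OF f'[OF that] g'[OF that]] by (simp add: o_def)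
  have "Ck_on k (\<lambda>x. frechet_derivative (\<lambda>x. g (f x)) (at x) v) S" for v
  proof (subst Ck_on_cong[OF assms(1)])
    show "frechet_derivative (\<lambda>x. g (f x)) (at x) v =
        (\<Sum>e\<in>Basis. (frechet_derivative f (at x) v \<bullet> e) *\<^sub>R frechet_derivative g (at (f x)) e)"
      if "x \<in> S" for x
    proof -
      have lin: "linear (frechet_derivative g (at (f x)))"
        using g'[OF that] has_derivative_linear by blast
      have "frechet_derivative (\<lambda>x. g (f x)) (at x) v = frechet_derivative g (at (f x))
          (\<Sum>e\<in>Basis. (frechet_derivative f (at x) v \<bullet> e) *\<^sub>R e)"
        using frechet_derivative_eq[OF d[OF that]] by (simp add: euclidean_representation)
      then show ?thesis by (simp add: linear_sum[OF lin] linear_scale[OF lin])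
    qed
    have fk: "Ck_on k (\<lambda>x. frechet_derivative f (at x) v) S" using Suc.prems(1) by simp
    show "Ck_on k (\<lambda>x. \<Sum>e\<in>Basis. (frechet_derivative f (at x) v \<bullet> e) *\<^sub>R
        frechet_derivative g (at (f x)) e) S"
    proof (intro Ck_on_sum Ck_on_scaleR assms(1))
      show "Ck_on k (\<lambda>x. frechet_derivative f (at x) v \<bullet> e) S" for e
        by (rule Ck_on_bounded_linear_comp[OF bounded_linear_inner_left assms(1) fk])
      show "Ck_on k (\<lambda>x. frechet_derivative g (at (f x)) e) S" for e
        using Suc.prems(2) Suc.prems(1)[THEN Ck_on_Suc_imp] by (intro Suc.IH) simp_all
    qed
  qed
  then show ?case using d by (auto simp: differentiable_def)
qed

lemma smooth_on_cong:
  "open S \<Longrightarrow> (\<And>x. x \<in> S \<Longrightarrow> f x = g x) \<Longrightarrow> smooth_on S f \<longleftrightarrow> smooth_on S g"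
  unfolding smooth_on_def using Ck_on_cong[of S f g] by simp

lemma smooth_on_subset: "smooth_on S f \<Longrightarrow> T \<subseteq> S \<Longrightarrow> smooth_on T f"
  unfolding smooth_on_def using Ck_on_subset[of _ f S T] by simp

lemma smooth_on_local:
  "(\<And>x. x \<in> S \<Longrightarrow> \<exists>T. open T \<and> x \<in> T \<and> smooth_on T f) \<Longrightarrow> smooth_on S f"
  unfolding smooth_on_def by (intro allI Ck_on_local) blast

lemma smooth_on_compose:
  fixes f :: "'a::real_normed_vector \<Rightarrow> 'b::euclidean_space"
  shows "open S \<Longrightarrow> open T \<Longrightarrow> f ` S \<subseteq> T \<Longrightarrow> smooth_on S f \<Longrightarrow> smooth_on T g \<Longrightarrow>
    smooth_on S (\<lambda>x. g (f x))"
  unfolding smooth_on_def using Ck_on_compose[of S T f _ g] by simp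

lemma smooth_on_bounded_linear: "bounded_linear L \<Longrightarrow> smooth_on S L"
  unfolding smooth_on_def by (simp add: Ck_on_bounded_linear)

lemma smooth_on_Pair:
  fixes f :: "'a::real_normed_vector \<Rightarrow> 'b::euclidean_space"
    and g :: "'a \<Rightarrow> 'c::euclidean_space"
  assumes "open S" "smooth_on S f" "smooth_on S g"
  shows "smooth_on S (\<lambda>x. (f x, g x))"
  unfolding smooth_on_def
proof (rule allI, rule Ck_on_componentwise[OF assms(1)])
  fix k and e :: "'b \<times> 'c"
  have "Ck_on k f S" "Ck_on k g S" using assms unfolding smooth_on_def by simp_all
  then have "Ck_on k (\<lambda>x. f x \<bullet> fst e + g x \<bullet> snd e) S"
    by (intro Ck_on_add assms(1)
        Ck_on_bounded_linear_comp[OF bounded_linear_inner_left assms(1)]) simp_all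
  then show "Ck_on k (\<lambda>x. (f x, g x) \<bullet> e) S" by (simp add: inner_prod_def)
qed

lemma smooth_on_vec_lambda:
  fixes f :: "'n::finite \<Rightarrow> 'a::real_normed_vector \<Rightarrow> 'b::euclidean_space"
  assumes "open S" "\<And>i. smooth_on S (f i)"
  shows "smooth_on S (\<lambda>x. \<chi> i. f i x)"
  unfolding smooth_on_def
proof (rule allI, rule Ck_on_componentwise[OF assms(1)])
  fix k and e :: "'b ^ 'n"
  have "Ck_on k (\<lambda>x. \<Sum>i\<in>UNIV. f i x \<bullet> e $ i) S"
    by (intro Ck_on_sum assms(1) Ck_on_bounded_linear_comp[OF bounded_linear_inner_left assms(1)])
      (use assms(2) in \<open>simp add: smooth_on_def\<close>)
  then show "Ck_on k (\<lambda>x. (\<chi> i. f i x) \<bullet> e) S" by (simp add: inner_vec_def)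
qed

lemma smooth_on_imp_has_derivative:
  assumes "smooth_on S f" "x \<in> S"
  shows "(f has_derivative frechet_derivative f (at x)) (at x)"
proof -
  have "Ck_on (Suc 0) f S" using assms(1) unfolding smooth_on_def by simp
  then show ?thesis using assms(2) by (simp add: frechet_derivative_works[symmetric])
qed

lemma smooth_on_frechet_derivative:
  assumes "smooth_on S f"
  shows "smooth_on S (\<lambda>x. frechet_derivative f (at x) v)"
  unfolding smooth_on_def
proof
  fix k
  have "Ck_on (Suc k) f S" using assms unfolding smooth_on_def by simp
  then show "Ck_on k (\<lambda>x. frechet_derivative f (at x) v) S" by simp
qed

lemma smooth_on_imp_continuous_on: "smooth_on S f \<Longrightarrow> continuous_on S f"
  unfolding smooth_on_def using Ck_on_imp_continuous_on[of 0 f S] by simp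

section \<open>Smooth maps between manifolds\<close>

lemma is_chart_openD:
  assumes "is_chart (U, c)"
  shows "open U" "open (c ` U)" "continuous_on U c" "continuous_on (c ` U) (inv_into U c)" "inj_on c U"
  using assms unfolding is_chart_def homeomorphism_def
  by (auto intro: inj_on_inverseI)

lemma chart_inv_into:
  assumes "is_chart (U, c)" "x \<in> U"
  shows "inv_into U c (c x) = x"
  using is_chart_openD(5)[OF assms(1)] assms(2) by simp

text \<open>\<open>is_chart\<close> is phrased with \<open>inv_into\<close>; for product and power
  charts an explicit inverse is at hand instead.\<close>

lemma is_chartI:
  assumes "open U" "open (c ` U)" "homeomorphism U (c ` U) c g"
  shows "is_chart (U, c)"
proof -
  have inj: "inj_on c U" using assms(3) by (metis homeomorphism_apply1 inj_on_inverseI)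
  have "inv_into U c y = g y" if "y \<in> c ` U" for y
    using that assms(3) inj by (auto simp: homeomorphism_apply1)
  then have "homeomorphism U (c ` U) c (inv_into U c)"
    using homeomorphism_cong[OF assms(3)] by auto
  then show ?thesis using assms unfolding is_chart_def by simp
qed

lemma chart_open_image:
  assumes "is_chart (U, c)" "open W"
  shows "open (c ` (U \<inter> W))"
proof -
  have "c ` (U \<inter> W) = c ` U \<inter> inv_into U c -` W"
    by (auto simp: chart_inv_into[OF assms(1)])
  then show ?thesis
    using continuous_open_preimage[OF is_chart_openD(4,2)[OF assms(1)] assms(2)] by simp
qed

text \<open>An atlas without the condition on transition maps. Composition of smooth maps asks for
  no more, so product and power atlases never have to be shown to be smooth.\<close>

definition charted :: "('m::topological_space, 'e::real_normed_vector) chart set \<Rightarrow> bool" where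
  "charted \<A> \<longleftrightarrow> (\<forall>k\<in>\<A>. is_chart k) \<and> (\<Union>(U, c)\<in>\<A>. U) = UNIV"

lemma smooth_atlas_charted: "smooth_atlas \<A> \<Longrightarrow> charted \<A>"
  unfolding smooth_atlas_def charted_def by blast

lemma smooth_atlas_transition:
  assumes "smooth_atlas \<A>" "(U, c) \<in> \<A>" "(V, d) \<in> \<A>"
  shows "smooth_on (c ` (U \<inter> V)) (\<lambda>y. d (inv_into U c y))"
proof -
  have "\<forall>(U, c)\<in>\<A>. \<forall>(V, d)\<in>\<A>. smooth_on (c ` (U \<inter> V)) (d \<circ> inv_into U c)"
    using assms(1) unfolding smooth_atlas_def by simp
  from bspec[OF this assms(2)] assms(3) show ?thesis by (auto simp: o_def)
qed

lemma charted_chart: "charted \<A> \<Longrightarrow> k \<in> \<A> \<Longrightarrow> is_chart k"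
  unfolding charted_def by blast

lemma charted_cover:
  assumes "charted \<A>"
  obtains U c where "(U, c) \<in> \<A>" "x \<in> U"
proof -
  have "x \<in> (\<Union>(U, c)\<in>\<A>. U)" using assms unfolding charted_def by simp
  then show ?thesis using that by auto
qed

lemma smooth_mapD:
  assumes "smooth_map \<A> \<B> f" "(U, c) \<in> \<A>" "(V, d) \<in> \<B>"
  shows "smooth_on (c ` (U \<inter> f -` V)) (\<lambda>y. d (f (inv_into U c y)))"
proof -
  have "\<forall>(U, c)\<in>\<A>. \<forall>(V, d)\<in>\<B>. smooth_on (c ` (U \<inter> f -` V)) (d \<circ> f \<circ> inv_into U c)"
    using assms(1) unfolding smooth_map_def by simp
  from bspec[OF this assms(2)] assms(3) show ?thesis by (auto simp: o_def)
qed

lemma smooth_mapI: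
  assumes "continuous_on UNIV f"
    "\<And>U c V d. (U, c) \<in> \<A> \<Longrightarrow> (V, d) \<in> \<B> \<Longrightarrow>
      smooth_on (c ` (U \<inter> f -` V)) (\<lambda>y. d (f (inv_into U c y)))"
  shows "smooth_map \<A> \<B> f"
  using assms unfolding smooth_map_def by (auto simp: o_def)

lemma smooth_map_continuous: "smooth_map \<A> \<B> f \<Longrightarrow> continuous_on UNIV f"
  unfolding smooth_map_def by blast

lemma smooth_map_open_vimage: "smooth_map \<A> \<B> f \<Longrightarrow> open V \<Longrightarrow> open (f -` V)"
  using smooth_map_continuous open_vimage by blast

text \<open>Near each point a chart around \<open>f x\<close> is inserted between the two maps; over
  the set \<open>R\<close> both coordinate expressions are defined and compose.\<close>

lemma smooth_map_compose:
  fixes \<A> :: "('m::topological_space, 'e::real_normed_vector) chart set"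
    and \<B> :: "('p::topological_space, 'g::euclidean_space) chart set"
    and \<C> :: "('q::topological_space, 'h::real_normed_vector) chart set"
  assumes "charted \<A>" "charted \<B>" "charted \<C>" "smooth_map \<A> \<B> f" "smooth_map \<B> \<C> g"
  shows "smooth_map \<A> \<C> (\<lambda>x. g (f x))"
proof (rule smooth_mapI)
  show "continuous_on UNIV (\<lambda>x. g (f x))"
    using assms(4,5)[THEN smooth_map_continuous] continuous_on_compose2[of UNIV g UNIV f] by simp
  fix U c W e
  assume U: "(U, c) \<in> \<A>" and W: "(W, e) \<in> \<C>"
  have oW: "open W" using is_chart_openD(1) charted_chart[OF assms(3) W] by blast
  show "smooth_on (c ` (U \<inter> (\<lambda>x. g (f x)) -` W)) (\<lambda>y. e (g (f (inv_into U c y))))"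
  proof (rule smooth_on_local)
    fix y assume "y \<in> c ` (U \<inter> (\<lambda>x. g (f x)) -` W)"
    then obtain x where x: "x \<in> U" "g (f x) \<in> W" "y = c x" by auto
    obtain V d where V: "(V, d) \<in> \<B>" "f x \<in> V" using charted_cover[OF assms(2)] .
    note cU = charted_chart[OF assms(1) U] and cV = charted_chart[OF assms(2) V(1)]
    have oV: "open V" using is_chart_openD(1) cV by blast
    define R where "R = f -` V \<inter> (\<lambda>x. g (f x)) -` W"
    have gW: "open (g -` W)" by (rule smooth_map_open_vimage[OF assms(5) oW])
    have "open R"
      using smooth_map_open_vimage[OF assms(4) oV] smooth_map_open_vimage[OF assms(4) gW]
      unfolding R_def vimage_def by auto
    then have oT: "open (c ` (U \<inter> R))" by (rule chart_open_image[OF cU])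
    have oT': "open (d ` (V \<inter> g -` W))" by (rule chart_open_image[OF cV gW])
    have "smooth_on (c ` (U \<inter> R)) (\<lambda>y. e (g (inv_into V d (d (f (inv_into U c y))))))"
    proof (rule smooth_on_compose[OF oT oT', where f = "\<lambda>y. d (f (inv_into U c y))"])
      show "(\<lambda>y. d (f (inv_into U c y))) ` c ` (U \<inter> R) \<subseteq> d ` (V \<inter> g -` W)"
        by (auto simp: R_def chart_inv_into[OF cU])
      show "smooth_on (c ` (U \<inter> R)) (\<lambda>y. d (f (inv_into U c y)))"
        by (rule smooth_on_subset[OF smooth_mapD[OF assms(4) U V(1)]]) (auto simp: R_def)
      show "smooth_on (d ` (V \<inter> g -` W)) (\<lambda>z. e (g (inv_into V d z)))"
        by (rule smooth_mapD[OF assms(5) V(1) W])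
    qed
    then have "smooth_on (c ` (U \<inter> R)) (\<lambda>y. e (g (f (inv_into U c y))))"
      by (subst smooth_on_cong[OF oT])
        (auto simp: R_def chart_inv_into[OF cU] chart_inv_into[OF cV])
    moreover have "y \<in> c ` (U \<inter> R)" using x V by (auto simp: R_def)
    ultimately show "\<exists>T. open T \<and> y \<in> T \<and> smooth_on T (\<lambda>y. e (g (f (inv_into U c y))))"
      using oT by blast
  qed
qed

lemma inv_into_map_prod:
  assumes "is_chart (U, c)" "is_chart (V, d)" "x \<in> U" "y \<in> V"
  shows "inv_into (U \<times> V) (map_prod c d) (c x, d y) = (x, y)"
proof -
  have "inj_on (map_prod c d) (U \<times> V)"
    by (rule map_prod_inj_on[OF is_chart_openD(5)[OF assms(1)] is_chart_openD(5)[OF assms(2)]])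
  then show ?thesis using assms(3,4) inv_into_f_f[of "map_prod c d" "U \<times> V" "(x, y)"] by simp
qed

lemma charted_prod_atlas:
  assumes "charted \<A>" "charted \<B>"
  shows "charted (prod_atlas \<A> \<B>)"
  unfolding charted_def
proof
  show "\<forall>k\<in>prod_atlas \<A> \<B>. is_chart k"
  proof
    fix k assume "k \<in> prod_atlas \<A> \<B>"
    then obtain U c V d where k: "k = (U \<times> V, map_prod c d)" "(U, c) \<in> \<A>" "(V, d) \<in> \<B>"
      unfolding prod_atlas_def by auto
    note cU = is_chart_openD[OF charted_chart[OF assms(1) k(2)]]
      and cV = is_chart_openD[OF charted_chart[OF assms(2) k(3)]]
    have im: "map_prod c d ` (U \<times> V) = c ` U \<times> d ` V" by (rule map_prod_surj_on) auto
    have "homeomorphism (U \<times> V) (map_prod c d ` (U \<times> V)) (map_prod c d)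
        (map_prod (inv_into U c) (inv_into V d))"
    proof (rule homeomorphismI)
      show "continuous_on (U \<times> V) (map_prod c d)"
        unfolding map_prod_def split_beta
        by (intro continuous_on_Pair continuous_on_compose2[OF cU(3)]
            continuous_on_compose2[OF cV(3)] continuous_intros) auto
      show "continuous_on (map_prod c d ` (U \<times> V)) (map_prod (inv_into U c) (inv_into V d))"
        unfolding im unfolding map_prod_def split_beta
        by (intro continuous_on_Pair continuous_on_compose2[OF cU(4)]
            continuous_on_compose2[OF cV(4)] continuous_intros) auto
    qed (use cU cV in auto)
    then show "is_chart k"
      unfolding k(1) using cU cV im by (intro is_chartI) (auto intro: open_Times)
  qed
  have "\<exists>k\<in>prod_atlas \<A> \<B>. z \<in> fst k" for z
  proof -
    obtain U c where U: "(U, c) \<in> \<A>" "fst z \<in> U" using charted_cover[OF assms(1)] .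
    obtain V d where V: "(V, d) \<in> \<B>" "snd z \<in> V" using charted_cover[OF assms(2)] .
    have "(U \<times> V, map_prod c d) \<in> prod_atlas \<A> \<B>" unfolding prod_atlas_def using U V by blast
    then show ?thesis using U V by (intro bexI) (auto simp: mem_Times_iff)
  qed
  then show "(\<Union>(U, c)\<in>prod_atlas \<A> \<B>. U) = UNIV" by (force simp: split_beta)
qed

lemma inv_into_power_chart:
  assumes "\<And>i. is_chart (k i)" "\<And>i. x $ i \<in> fst (k i)"
  shows "inv_into (fst (power_chart k)) (snd (power_chart k)) (\<chi> i. snd (k i) (x $ i)) = x"
proof -
  have "inj_on (snd (power_chart k)) (fst (power_chart k))"
  proof (rule inj_onI)
    fix x y assume xy: "x \<in> fst (power_chart k)" "y \<in> fst (power_chart k)"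
      "snd (power_chart k) x = snd (power_chart k) y"
    have "x $ i = y $ i" for i
    proof -
      have "inj_on (snd (k i)) (fst (k i))" using is_chart_openD(5) assms(1) by (metis prod.collapse)
      then show ?thesis using xy by (simp add: power_chart_def vec_eq_iff inj_on_def)
    qed
    then show "x = y" by (simp add: vec_eq_iff)
  qed
  then show ?thesis
    using assms(2) inv_into_f_f[of "snd (power_chart k)" "fst (power_chart k)" x]
    by (simp add: power_chart_def)
qed

lemma is_chart_power_chart:
  assumes "\<And>i. is_chart (k i)"
  shows "is_chart (power_chart k)"
proof -
  note c = is_chart_openD[of "fst (k i)" "snd (k i)" for i, unfolded prod.collapse, OF assms]
  let ?U = "{x. \<forall>i. x $ i \<in> fst (k i)}" and ?c = "\<lambda>x. \<chi> i. snd (k i) (x $ i)"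
    and ?g = "\<lambda>y. \<chi> i. inv_into (fst (k i)) (snd (k i)) (y $ i)"
  have inv: "?g (?c x) = x" if "x \<in> ?U" for x
    using that c(5) by (simp add: vec_eq_iff)
  have im: "?c ` ?U = {y. \<forall>i. y $ i \<in> snd (k i) ` fst (k i)}" (is "_ = ?V")
  proof
    show "?V \<subseteq> ?c ` ?U"
    proof
      fix y assume "y \<in> ?V"
      then have "y = ?c (?g y)" "?g y \<in> ?U"
        by (simp_all add: vec_eq_iff f_inv_into_f inv_into_into)
      then show "y \<in> ?c ` ?U" by blast
    qed
  qed auto
  have "homeomorphism ?U (?c ` ?U) ?c ?g"
  proof (rule homeomorphismI)
    show "continuous_on ?U ?c"
      by (intro continuous_on_vec_lambda continuous_on_compose2[OF c(3)] continuous_intros) auto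
    show "continuous_on (?c ` ?U) ?g"
      unfolding im
      by (intro continuous_on_vec_lambda continuous_on_compose2[OF c(4)] continuous_intros) auto
    show "?g ` ?c ` ?U \<subseteq> ?U" using inv by auto
    show "?g (?c x) = x" if "x \<in> ?U" for x using inv that .
    show "?c (?g y) = y" if y: "y \<in> ?c ` ?U" for y
    proof -
      from y obtain x where x: "y = ?c x" "x \<in> ?U" by (rule imageE)
      show ?thesis unfolding x(1) inv[OF x(2)] ..
    qed
  qed auto
  moreover have "open ?U" using c(1) by (intro open_vector_box) auto
  moreover have "open (?c ` ?U)" unfolding im using c(2) by (intro open_vector_box) auto
  ultimately show ?thesis unfolding power_chart_def by (intro is_chartI)
qed

lemma charted_power_atlas:
  fixes \<A> :: "('a::topological_space, 'b::real_normed_vector) chart set"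
  assumes "charted \<A>"
  shows "charted (power_atlas \<A> :: ('a ^ 'c::finite, 'b ^ 'c) chart set)"
  unfolding charted_def
proof
  show "\<forall>k\<in>power_atlas \<A> :: ('a ^ 'c, 'b ^ 'c) chart set. is_chart k"
  proof
    fix k :: "('a ^ 'c, 'b ^ 'c) chart" assume "k \<in> power_atlas \<A>"
    then obtain k' where k': "k = power_chart k'" "\<forall>i. k' i \<in> \<A>"
      unfolding power_atlas_def by auto
    show "is_chart k"
      unfolding k'(1) using k'(2) charted_chart[OF assms] by (intro is_chart_power_chart) simp
  qed
  have "\<exists>k\<in>power_atlas \<A>. z \<in> fst k" for z :: "'a ^ 'c"
  proof -
    have "\<exists>k. k \<in> \<A> \<and> z $ i \<in> fst k" for i
    proof -
      obtain U c where "(U, c) \<in> \<A>" "z $ i \<in> U" using charted_cover[OF assms] .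
      then show ?thesis by (intro exI[of _ "(U, c)"]) simp
    qed
    then have "\<exists>k. \<forall>i. k i \<in> \<A> \<and> z $ i \<in> fst (k i)" by (intro choice allI)
    then obtain k where k: "\<forall>i. k i \<in> \<A> \<and> z $ i \<in> fst (k i)" ..
    show ?thesis
    proof
      show "power_chart k \<in> power_atlas \<A>" unfolding power_atlas_def using k by blast
      show "z \<in> fst (power_chart k)" using k by (simp add: power_chart_def)
    qed
  qed
  then show "(\<Union>(U, c)\<in>power_atlas \<A> :: ('a ^ 'c, 'b ^ 'c) chart set. U) = UNIV"
    by (force simp: split_beta)
qed

text \<open>In coordinates a projection is a linear projection followed by a transition map of the
  atlas, hence the assumption \<open>smooth_atlas\<close> on the target. The same holds for
  \<open>smooth_map_snd\<close> and \<open>smooth_map_vec_nth\<close>.\<close>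

lemma smooth_map_fst:
  fixes \<A> :: "('m::topological_space, 'e::euclidean_space) chart set"
    and \<B> :: "('p::topological_space, 'g::euclidean_space) chart set"
  assumes "smooth_atlas \<A>" "charted \<B>"
  shows "smooth_map (prod_atlas \<A> \<B>) \<A> fst"
proof (rule smooth_mapI)
  fix W k U' c'
  assume "(W, k) \<in> prod_atlas \<A> \<B>" and U': "(U', c') \<in> \<A>"
  then obtain U c V d where k: "W = U \<times> V" "k = map_prod c d" "(U, c) \<in> \<A>" "(V, d) \<in> \<B>"
    unfolding prod_atlas_def by auto
  have A: "charted \<A>" by (rule smooth_atlas_charted[OF assms(1)])
  note cU = charted_chart[OF A k(3)] and cV = charted_chart[OF assms(2) k(4)]
    and cU' = charted_chart[OF A U']
  have im: "map_prod c d ` (U \<times> V \<inter> fst -` U') = c ` (U \<inter> U') \<times> d ` V" by force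
  have o1: "open (c ` (U \<inter> U'))" by (rule chart_open_image[OF cU is_chart_openD(1)[OF cU']])
  have oo: "open (c ` (U \<inter> U') \<times> d ` V)" by (rule open_Times[OF o1 is_chart_openD(2)[OF cV]])
  have "smooth_on (c ` (U \<inter> U')) (\<lambda>y. c' (inv_into U c y))"
    by (rule smooth_atlas_transition[OF assms(1) k(3) U'])
  then have "smooth_on (c ` (U \<inter> U') \<times> d ` V) (\<lambda>z. c' (inv_into U c (fst z)))"
    by (intro smooth_on_compose[OF oo o1 _ smooth_on_bounded_linear[OF bounded_linear_fst]]) auto
  then show "smooth_on (k ` (W \<inter> fst -` U')) (\<lambda>y. c' (fst (inv_into W k y)))"
    unfolding k im
    by (subst smooth_on_cong[OF oo])
      (auto simp: inv_into_map_prod[OF cU cV] chart_inv_into[OF cU])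
qed (intro continuous_intros)

lemma smooth_map_snd:
  fixes \<A> :: "('m::topological_space, 'e::euclidean_space) chart set"
    and \<B> :: "('p::topological_space, 'g::euclidean_space) chart set"
  assumes "charted \<A>" "smooth_atlas \<B>"
  shows "smooth_map (prod_atlas \<A> \<B>) \<B> snd"
proof (rule smooth_mapI)
  fix W k V' d'
  assume "(W, k) \<in> prod_atlas \<A> \<B>" and V': "(V', d') \<in> \<B>"
  then obtain U c V d where k: "W = U \<times> V" "k = map_prod c d" "(U, c) \<in> \<A>" "(V, d) \<in> \<B>"
    unfolding prod_atlas_def by auto
  have B: "charted \<B>" by (rule smooth_atlas_charted[OF assms(2)])
  note cU = charted_chart[OF assms(1) k(3)] and cV = charted_chart[OF B k(4)]
    and cV' = charted_chart[OF B V']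
  have im: "map_prod c d ` (U \<times> V \<inter> snd -` V') = c ` U \<times> d ` (V \<inter> V')" by force
  have o1: "open (d ` (V \<inter> V'))" by (rule chart_open_image[OF cV is_chart_openD(1)[OF cV']])
  have oo: "open (c ` U \<times> d ` (V \<inter> V'))" by (rule open_Times[OF is_chart_openD(2)[OF cU] o1])
  have "smooth_on (d ` (V \<inter> V')) (\<lambda>y. d' (inv_into V d y))"
    by (rule smooth_atlas_transition[OF assms(2) k(4) V'])
  then have "smooth_on (c ` U \<times> d ` (V \<inter> V')) (\<lambda>z. d' (inv_into V d (snd z)))"
    by (intro smooth_on_compose[OF oo o1 _ smooth_on_bounded_linear[OF bounded_linear_snd]]) auto
  then show "smooth_on (k ` (W \<inter> snd -` V')) (\<lambda>y. d' (snd (inv_into W k y)))"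
    unfolding k im
    by (subst smooth_on_cong[OF oo])
      (auto simp: inv_into_map_prod[OF cU cV] chart_inv_into[OF cV])
qed (intro continuous_intros)

lemma smooth_map_vec_nth:
  fixes \<A> :: "('m::topological_space, 'e::euclidean_space) chart set"
  assumes "smooth_atlas \<A>"
  shows "smooth_map (power_atlas \<A>) \<A> (\<lambda>x :: 'm ^ 'n. x $ i)"
proof (rule smooth_mapI)
  fix W :: "('m ^ 'n) set" and h U c
  assume "(W, h) \<in> power_atlas \<A>" and U: "(U, c) \<in> \<A>"
  then obtain k where k: "(W, h) = power_chart k" "\<And>i. k i \<in> \<A>"
    unfolding power_atlas_def by auto
  have A: "charted \<A>" by (rule smooth_atlas_charted[OF assms(1)])
  have ck: "is_chart (k j)" for j using charted_chart[OF A k(2)] .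
  have cW: "is_chart (W, h)" unfolding k(1) using ck by (rule is_chart_power_chart)
  define V d where "V = fst (k i)" and "d = snd (k i)"
  have V: "(V, d) \<in> \<A>" using k(2)[of i] by (simp add: V_def d_def)
  note cV = charted_chart[OF A V] and cU = charted_chart[OF A U]
  have W: "x \<in> W \<Longrightarrow> x $ i \<in> V" "x \<in> W \<Longrightarrow> h x $ i = d (x $ i)" for x
    using k(1) by (auto simp: power_chart_def V_def d_def)
  have o1: "open (d ` (V \<inter> U))" by (rule chart_open_image[OF cV is_chart_openD(1)[OF cU]])
  have oU: "open ((\<lambda>x :: 'm ^ 'n. x $ i) -` U)"
    using is_chart_openD(1)[OF cU] by (rule open_vimage_vec_nth)
  have oo: "open (h ` (W \<inter> (\<lambda>x. x $ i) -` U))"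
    by (rule chart_open_image[OF cW oU])
  have "smooth_on (d ` (V \<inter> U)) (\<lambda>y. c (inv_into V d y))"
    by (rule smooth_atlas_transition[OF assms V U])
  then have "smooth_on (h ` (W \<inter> (\<lambda>x. x $ i) -` U)) (\<lambda>z. c (inv_into V d (z $ i)))"
    by (intro smooth_on_compose[OF oo o1 _ smooth_on_bounded_linear[OF bounded_linear_vec_nth]])
      (auto simp: W)
  then show "smooth_on (h ` (W \<inter> (\<lambda>x. x $ i) -` U)) (\<lambda>y. c (inv_into W h y $ i))"
    by (subst smooth_on_cong[OF oo])
      (auto simp: chart_inv_into[OF cW] chart_inv_into[OF cV] W)
qed (intro continuous_intros)

lemma smooth_map_Pair:
  fixes \<A> :: "('m::topological_space, 'e::real_normed_vector) chart set"
    and \<B> :: "('p::topological_space, 'g::euclidean_space) chart set"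
    and \<C> :: "('q::topological_space, 'h::euclidean_space) chart set"
  assumes "charted \<A>" "charted \<B>" "charted \<C>" "smooth_map \<A> \<B> f" "smooth_map \<A> \<C> g"
  shows "smooth_map \<A> (prod_atlas \<B> \<C>) (\<lambda>x. (f x, g x))"
proof (rule smooth_mapI)
  show "continuous_on UNIV (\<lambda>x. (f x, g x))"
    using assms(4,5)[THEN smooth_map_continuous] by (rule continuous_on_Pair)
  fix U c R k
  assume U: "(U, c) \<in> \<A>" and "(R, k) \<in> prod_atlas \<B> \<C>"
  then obtain V d W e where k: "R = V \<times> W" "k = map_prod d e" "(V, d) \<in> \<B>" "(W, e) \<in> \<C>"
    unfolding prod_atlas_def by auto
  note cU = charted_chart[OF assms(1) U] and cV = charted_chart[OF assms(2) k(3)]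
    and cW = charted_chart[OF assms(3) k(4)]
  have eq: "(\<lambda>x. (f x, g x)) -` R = f -` V \<inter> g -` W" unfolding k by auto
  have oo: "open (c ` (U \<inter> (\<lambda>x. (f x, g x)) -` R))"
    unfolding eq using smooth_map_open_vimage[OF assms(4) is_chart_openD(1)[OF cV]]
      smooth_map_open_vimage[OF assms(5) is_chart_openD(1)[OF cW]]
    by (intro chart_open_image[OF cU]) auto
  have "smooth_on (c ` (U \<inter> (\<lambda>x. (f x, g x)) -` R)) (\<lambda>y. (d (f (inv_into U c y)), e (g (inv_into U c y))))"
    by (rule smooth_on_Pair[OF oo])
      (rule smooth_on_subset[OF smooth_mapD[OF assms(4) U k(3)]],
        use eq in blast, rule smooth_on_subset[OF smooth_mapD[OF assms(5) U k(4)]], use eq in blast)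
  then show "smooth_on (c ` (U \<inter> (\<lambda>x. (f x, g x)) -` R)) (\<lambda>y. k (f (inv_into U c y), g (inv_into U c y)))"
    by (simp add: k)
qed

lemma smooth_map_vec_lambda:
  fixes \<A> :: "('m::topological_space, 'e::real_normed_vector) chart set"
    and \<B> :: "('p::topological_space, 'g::euclidean_space) chart set"
    and f :: "'n::finite \<Rightarrow> 'm \<Rightarrow> 'p"
  assumes "charted \<A>" "charted \<B>" "\<And>i. smooth_map \<A> \<B> (f i)"
  shows "smooth_map \<A> (power_atlas \<B>) (\<lambda>x. \<chi> i. f i x)"
proof (rule smooth_mapI)
  show "continuous_on UNIV (\<lambda>x. \<chi> i. f i x)"
    using assms(3)[THEN smooth_map_continuous] by (rule continuous_on_vec_lambda)
  fix U c and R :: "('p ^ 'n) set" and h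
  assume U: "(U, c) \<in> \<A>" and "(R, h) \<in> power_atlas \<B>"
  then obtain k where k: "(R, h) = power_chart k" "\<And>i. k i \<in> \<B>"
    unfolding power_atlas_def by auto
  have ck: "is_chart (fst (k j), snd (k j))" for j using charted_chart[OF assms(2) k(2)] by simp
  have kB: "(fst (k j), snd (k j)) \<in> \<B>" for j using k(2) by simp
  note cU = charted_chart[OF assms(1) U]
  have eq: "(\<lambda>x. \<chi> i. f i x) -` R = (\<Inter>i. f i -` fst (k i))"
    using k(1) by (auto simp: power_chart_def)
  have oo: "open (c ` (U \<inter> (\<lambda>x. \<chi> i. f i x) -` R))"
    unfolding eq using smooth_map_open_vimage[OF assms(3) is_chart_openD(1)[OF ck]]
    by (intro chart_open_image[OF cU] open_INT) auto
  have "smooth_on (c ` (U \<inter> (\<lambda>x. \<chi> i. f i x) -` R)) (\<lambda>y. snd (k i) (f i (inv_into U c y)))" for i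
    by (rule smooth_on_subset[OF smooth_mapD[OF assms(3) U kB]]) (use eq in blast)
  then have "smooth_on (c ` (U \<inter> (\<lambda>x. \<chi> i. f i x) -` R)) (\<lambda>y. \<chi> i. snd (k i) (f i (inv_into U c y)))"
    by (rule smooth_on_vec_lambda[OF oo])
  then show "smooth_on (c ` (U \<inter> (\<lambda>x. \<chi> i. f i x) -` R)) (\<lambda>y. h (\<chi> i. f i (inv_into U c y)))"
    using k(1) by (simp add: power_chart_def)
qed

section \<open>The symmetry of second derivatives\<close>

lemma frechet_has_real_derivative_line:
  fixes f :: "'a::real_normed_vector \<Rightarrow> real"
  assumes "smooth_on S f" "a + t *\<^sub>R u \<in> S"
  shows "((\<lambda>t. f (a + t *\<^sub>R u)) has_real_derivative frechet_derivative f (at (a + t *\<^sub>R u)) u) (at t)"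
proof -
  have g: "((\<lambda>t. a + t *\<^sub>R u) has_derivative (\<lambda>h. h *\<^sub>R u)) (at t)"
    by (auto intro!: derivative_eq_intros)
  have f: "(f has_derivative frechet_derivative f (at (a + t *\<^sub>R u))) (at (a + t *\<^sub>R u))"
    by (rule smooth_on_imp_has_derivative[OF assms])
  have "((\<lambda>t. f (a + t *\<^sub>R u)) has_derivative
      (\<lambda>h. frechet_derivative f (at (a + t *\<^sub>R u)) (h *\<^sub>R u))) (at t)"
    using diff_chain_at[OF g f] by (simp add: o_def)
  moreover have "frechet_derivative f (at (a + t *\<^sub>R u)) (h *\<^sub>R u)
      = frechet_derivative f (at (a + t *\<^sub>R u)) u * h" for h
    using linear_scale[OF has_derivative_linear[OF f]] by (simp add: mult.commute)
  ultimately show ?thesis by (simp add: has_field_derivative_def)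
qed

text \<open>The mean value theorem is applied twice to the second difference over the parallelogram
  spanned by h v and h u: along u to a difference of values, then along v to the resulting
  difference of derivatives.\<close>

lemma second_difference_mvt:
  fixes f :: "'a::real_normed_vector \<Rightarrow> real"
  assumes "smooth_on S f" "0 < h"
    and "\<And>s t. 0 \<le> s \<Longrightarrow> s \<le> h \<Longrightarrow> 0 \<le> t \<Longrightarrow> t \<le> h \<Longrightarrow> x + s *\<^sub>R v + t *\<^sub>R u \<in> S"
  shows "\<exists>s t. 0 < s \<and> s < h \<and> 0 < t \<and> t < h \<and>
    f (x + h *\<^sub>R v + h *\<^sub>R u) - f (x + h *\<^sub>R v) - f (x + h *\<^sub>R u) + f x =
    h * h * frechet_derivative (\<lambda>y. frechet_derivative f (at y) u) (at (x + s *\<^sub>R v + t *\<^sub>R u)) v"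
proof -
  let ?Du = "\<lambda>y. frechet_derivative f (at y) u"
  have "((\<lambda>t. f (x + h *\<^sub>R v + t *\<^sub>R u) - f (x + t *\<^sub>R u)) has_real_derivative
      ?Du (x + h *\<^sub>R v + t *\<^sub>R u) - ?Du (x + t *\<^sub>R u)) (at t)" if "0 \<le> t" "t \<le> h" for t
    using assms(3)[of h t] assms(3)[of 0 t] that assms(2)
    by (intro DERIV_diff frechet_has_real_derivative_line[OF assms(1)]) simp_all
  from MVT2[OF assms(2), of "\<lambda>t. f (x + h *\<^sub>R v + t *\<^sub>R u) - f (x + t *\<^sub>R u)", OF this]
  obtain t where t: "0 < t" "t < h" "f (x + h *\<^sub>R v + h *\<^sub>R u) - f (x + h *\<^sub>R u) - (f (x + h *\<^sub>R v) - f x)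
      = h * (?Du (x + h *\<^sub>R v + t *\<^sub>R u) - ?Du (x + t *\<^sub>R u))" by auto
  have sm: "smooth_on S ?Du" by (rule smooth_on_frechet_derivative[OF assms(1)])
  have "((\<lambda>s. ?Du ((x + t *\<^sub>R u) + s *\<^sub>R v)) has_real_derivative
      frechet_derivative ?Du (at ((x + t *\<^sub>R u) + s *\<^sub>R v)) v) (at s)" if "0 \<le> s" "s \<le> h" for s
    using assms(3)[of s t] that t
    by (intro frechet_has_real_derivative_line[OF sm]) (simp add: add_ac)
  from MVT2[OF assms(2), of "\<lambda>s. ?Du ((x + t *\<^sub>R u) + s *\<^sub>R v)", OF this]
  obtain s where s: "0 < s" "s < h" "?Du ((x + t *\<^sub>R u) + h *\<^sub>R v) - ?Du (x + t *\<^sub>R u)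
      = h * frechet_derivative ?Du (at ((x + t *\<^sub>R u) + s *\<^sub>R v)) v" by auto
  show ?thesis
    using s t by (intro exI[of _ s] exI[of _ t]) (simp add: add_ac algebra_simps)
qed

text \<open>Both orders of differentiation express the same second difference divided by h * h, so
  the two mixed derivatives agree at points arbitrarily near x; their continuity then excludes a gap
  at x.\<close>

lemma second_derivative_symmetric_real:
  fixes f :: "'a::real_normed_vector \<Rightarrow> real"
  assumes "smooth_on S f" "open S" "x \<in> S"
  shows "frechet_derivative (\<lambda>y. frechet_derivative f (at y) u) (at x) v =
    frechet_derivative (\<lambda>y. frechet_derivative f (at y) v) (at x) u"
proof (rule ccontr)
  define F where "F y = frechet_derivative (\<lambda>y. frechet_derivative f (at y) u) (at y) v" for y
  define G where "G y = frechet_derivative (\<lambda>y. frechet_derivative f (at y) v) (at y) u" for y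
  assume "\<not> ?thesis"
  then have ne: "F x \<noteq> G x" by (simp add: F_def G_def)
  define e where "e = \<bar>F x - G x\<bar> / 2"
  have e: "e > 0" using ne by (simp add: e_def)
  have "continuous_on S F" "continuous_on S G"
    unfolding F_def G_def
    by (intro smooth_on_imp_continuous_on smooth_on_frechet_derivative assms)+
  then have "isCont F x" "isCont G x" using assms by (auto simp: continuous_on_eq_continuous_at)
  then obtain d1 d2 where d1: "d1 > 0" "\<And>y. dist y x < d1 \<Longrightarrow> dist (F y) (F x) < e"
    and d2: "d2 > 0" "\<And>y. dist y x < d2 \<Longrightarrow> dist (G y) (G x) < e"
    using e unfolding continuous_at_eps_delta by metis
  obtain d3 where d3: "d3 > 0" "\<And>y. dist y x < d3 \<Longrightarrow> y \<in> S"
    using assms unfolding open_dist by blast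
  define d where "d = min d1 (min d2 d3)"
  \<comment> \<open>The 1 keeps \<open>l\<close> positive when u and v vanish; the 2 in
    \<open>h\<close> keeps the whole parallelogram strictly inside the ball of radius
    \<open>d\<close>.\<close>
  define l where "l = norm u + norm v + 1"
  define h where "h = d / (2 * l)"
  have d: "d > 0" using d1 d2 d3 by (simp add: d_def)
  have pos: "l > 0" by (simp add: l_def add_nonneg_pos)
  have h: "h > 0" using d pos by (simp add: h_def)
  have hd: "h * (norm u + norm v) < d"
  proof -
    have "h * (norm u + norm v) \<le> h * l" using h by (simp add: l_def)
    also have "\<dots> = d / 2" using pos by (simp add: h_def)
    finally show ?thesis using d by simp
  qed
  have near: "dist (x + s *\<^sub>R v + t *\<^sub>R u) x < d" if "0 \<le> s" "s \<le> h" "0 \<le> t" "t \<le> h" for s t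
  proof -
    have "dist (x + s *\<^sub>R v + t *\<^sub>R u) x = norm (s *\<^sub>R v + t *\<^sub>R u)"
      by (simp add: dist_norm)
    also have "\<dots> \<le> s * norm v + t * norm u"
      using norm_triangle_ineq[of "s *\<^sub>R v" "t *\<^sub>R u"] that by simp
    also have "\<dots> \<le> h * norm v + h * norm u"
      using that by (intro add_mono mult_right_mono) auto
    finally show ?thesis using hd by (simp add: algebra_simps)
  qed
  obtain s t where st: "0 < s" "s < h" "0 < t" "t < h"
    "f (x + h *\<^sub>R v + h *\<^sub>R u) - f (x + h *\<^sub>R v) - f (x + h *\<^sub>R u) + f x = h * h * F (x + s *\<^sub>R v + t *\<^sub>R u)"
    using second_difference_mvt[OF assms(1) h, of x v u] near d3(2) unfolding F_def d_def by force
  have near': "dist (x + s *\<^sub>R u + t *\<^sub>R v) x < d" if "0 \<le> s" "s \<le> h" "0 \<le> t" "t \<le> h" for s t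
    using near[of t s] that by (simp add: add_ac)
  obtain s' t' where st': "0 < s'" "s' < h" "0 < t'" "t' < h"
    "f (x + h *\<^sub>R u + h *\<^sub>R v) - f (x + h *\<^sub>R u) - f (x + h *\<^sub>R v) + f x = h * h * G (x + s' *\<^sub>R u + t' *\<^sub>R v)"
    using second_difference_mvt[OF assms(1) h, of x u v] near' d3(2) unfolding G_def d_def by force
  have "h * h * F (x + s *\<^sub>R v + t *\<^sub>R u) = h * h * G (x + s' *\<^sub>R u + t' *\<^sub>R v)"
  proof -
    have "x + h *\<^sub>R u + h *\<^sub>R v = x + h *\<^sub>R v + h *\<^sub>R u" by simp
    then have "f (x + h *\<^sub>R u + h *\<^sub>R v) = f (x + h *\<^sub>R v + h *\<^sub>R u)" by (rule arg_cong)
    then show ?thesis using st(5) st'(5) by linarith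
  qed
  then have eq: "F (x + s *\<^sub>R v + t *\<^sub>R u) = G (x + s' *\<^sub>R u + t' *\<^sub>R v)" using h by simp
  have "\<bar>F (x + s *\<^sub>R v + t *\<^sub>R u) - F x\<bar> < e" "\<bar>G (x + s' *\<^sub>R u + t' *\<^sub>R v) - G x\<bar> < e"
    using d1(2) d2(2) near[of s t] near'[of s' t'] st st' unfolding d_def
    by (simp_all add: dist_real_def)
  moreover have "False" if "p = q" "\<bar>p - a\<bar> < \<bar>a - b\<bar> / 2" "\<bar>q - b\<bar> < \<bar>a - b\<bar> / 2" for a b p q :: real
    using that by (auto simp: abs_if split: if_splits)
  ultimately show False using eq unfolding e_def by blast
qed

lemma second_derivative_symmetric:
  fixes f :: "'a::real_normed_vector \<Rightarrow> 'b::euclidean_space"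
  assumes "smooth_on S f" "open S" "x \<in> S"
  shows "frechet_derivative (\<lambda>y. frechet_derivative f (at y) u) (at x) v =
    frechet_derivative (\<lambda>y. frechet_derivative f (at y) v) (at x) u"
proof (rule euclidean_eqI)
  fix e :: 'b
  let ?g = "\<lambda>y. f y \<bullet> e"
  have sg: "smooth_on S ?g"
    by (rule smooth_on_compose[OF assms(2) open_UNIV _ assms(1) smooth_on_bounded_linear[OF bounded_linear_inner_left]]) simp
  have 1: "frechet_derivative ?g (at y) w = frechet_derivative f (at y) w \<bullet> e" if "y \<in> S" for y w
    using frechet_derivative_eq[OF bounded_linear.has_derivative[OF bounded_linear_inner_left
          smooth_on_imp_has_derivative[OF assms(1) that]], of e] by simp
  have 2: "frechet_derivative (\<lambda>y. frechet_derivative ?g (at y) w) (at x) z =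
      frechet_derivative (\<lambda>y. frechet_derivative f (at y) w) (at x) z \<bullet> e" for w z
  proof -
    have "((\<lambda>y. frechet_derivative f (at y) w \<bullet> e) has_derivative
        (\<lambda>z. frechet_derivative (\<lambda>y. frechet_derivative f (at y) w) (at x) z \<bullet> e)) (at x)"
      by (intro bounded_linear.has_derivative[OF bounded_linear_inner_left]
          smooth_on_imp_has_derivative[OF smooth_on_frechet_derivative[OF assms(1)] assms(3)])
    then have "((\<lambda>y. frechet_derivative ?g (at y) w) has_derivative
        (\<lambda>z. frechet_derivative (\<lambda>y. frechet_derivative f (at y) w) (at x) z \<bullet> e)) (at x)"
      by (rule has_derivative_transform_within_open[OF _ assms(2,3)]) (simp add: 1)
    from frechet_derivative_eq[OF this] show ?thesis by simp
  qed
  show "frechet_derivative (\<lambda>y. frechet_derivative f (at y) u) (at x) v \<bullet> e =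
      frechet_derivative (\<lambda>y. frechet_derivative f (at y) v) (at x) u \<bullet> e"
    using second_derivative_symmetric_real[OF sg assms(2,3), of u v] unfolding 2 .
qed

lemma has_derivative_partial_fst:
  assumes "(f has_derivative D) (at (a, b))"
  shows "((\<lambda>p. f (p, b)) has_derivative (\<lambda>v. D (v, 0))) (at a)"
proof -
  have "((\<lambda>p. (p, b)) has_derivative (\<lambda>v. (v, 0))) (at a)"
    by (auto intro!: derivative_eq_intros)
  from diff_chain_at[OF this assms] show ?thesis by (simp add: o_def)
qed

lemma has_derivative_partial_snd:
  assumes "(f has_derivative D) (at (a, b))"
  shows "((\<lambda>q. f (a, q)) has_derivative (\<lambda>u. D (0, u))) (at b)"
proof -
  have "((\<lambda>q. (a, q)) has_derivative (\<lambda>u. (0, u))) (at b)"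
    by (auto intro!: derivative_eq_intros)
  from diff_chain_at[OF this assms] show ?thesis by (simp add: o_def)
qed

section \<open>The adjoint representation\<close>

text \<open>Coordinate form of a smooth operation in two group variables, with a neighbourhood
  \<open>T\<close> on which the charts and their inverses may be cancelled. It is used for product,
  difference and conjugation.\<close>

lemma smooth_map_prod_coord:
  assumes A: "charted \<A>" and sm: "smooth_map (prod_atlas \<A> \<A>) \<A> (\<lambda>z. P (fst z) (snd z))"
    and V: "(V, d) \<in> \<A>" "x \<in> V" and W: "(W, k) \<in> \<A>" "y \<in> W" and R: "(R, r) \<in> \<A>" "P x y \<in> R"
  obtains T where "open T" "(d x, k y) \<in> T" "T \<subseteq> d ` V \<times> k ` W"
    "\<forall>p q. (p, q) \<in> T \<longrightarrow> P (inv_into V d p) (inv_into W k q) \<in> R"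
    "smooth_on T (\<lambda>z. r (P (inv_into V d (fst z)) (inv_into W k (snd z))))"
proof -
  have VW: "(V \<times> W, map_prod d k) \<in> prod_atlas \<A> \<A>"
    unfolding prod_atlas_def using V W by blast
  note cV = charted_chart[OF A V(1)] and cW = charted_chart[OF A W(1)] and cR = charted_chart[OF A R(1)]
    and cVW = charted_chart[OF charted_prod_atlas[OF A A] VW]
  define T where "T = map_prod d k ` (V \<times> W \<inter> (\<lambda>z. P (fst z) (snd z)) -` R)"
  have oT: "open T" unfolding T_def
    by (rule chart_open_image[OF cVW smooth_map_open_vimage[OF sm is_chart_openD(1)[OF cR]]])
  have "smooth_on T (\<lambda>z. r (P (fst (inv_into (V \<times> W) (map_prod d k) z)) (snd (inv_into (V \<times> W) (map_prod d k) z))))"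
    unfolding T_def by (rule smooth_mapD[OF sm VW R(1)])
  then have "smooth_on T (\<lambda>z. r (P (inv_into V d (fst z)) (inv_into W k (snd z))))"
    by (subst smooth_on_cong[OF oT])
      (auto simp: T_def inv_into_map_prod[OF cV cW] chart_inv_into[OF cV] chart_inv_into[OF cW])
  moreover have "(d x, k y) \<in> T" unfolding T_def using V W R by (intro image_eqI[of _ _ "(x, y)"]) auto
  moreover have "T \<subseteq> d ` V \<times> k ` W" unfolding T_def by auto
  moreover have "P (inv_into V d p) (inv_into W k q) \<in> R" if "(p, q) \<in> T" for p q
    using that unfolding T_def by (auto simp: chart_inv_into[OF cV] chart_inv_into[OF cW])
  ultimately show ?thesis using that oT by blast
qed

locale lie_chart =
  fixes \<A> :: "('f::{group_add, t2_space, second_countable_topology}, 'e::euclidean_space) chart set"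
    and U :: "'f set" and c :: "'f \<Rightarrow> 'e"
  assumes lie: "lie_group \<A>" and chart: "(U, c) \<in> \<A>" and zero_in: "0 \<in> U"
begin

abbreviation inv_c :: "'e \<Rightarrow> 'f" where "inv_c \<equiv> inv_into U c"

lemma smooth_A: "smooth_atlas \<A>" and charted_A: "charted \<A>"
  using lie smooth_atlas_charted unfolding lie_group_def by blast+

lemma is_chart_Uc: "is_chart (U, c)"
  by (rule charted_chart[OF charted_A chart])

lemma inv_c [simp]: "x \<in> U \<Longrightarrow> inv_c (c x) = x"
  by (rule chart_inv_into[OF is_chart_Uc])

lemma c_inv [simp]: "p \<in> c ` U \<Longrightarrow> c (inv_c p) = p"
  by (rule f_inv_into_f)

lemma smooth_map_add:
  assumes "charted \<B>" "smooth_map \<B> \<A> f" "smooth_map \<B> \<A> g"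
  shows "smooth_map \<B> \<A> (\<lambda>x. f x + g x)"
proof -
  have "smooth_map (prod_atlas \<A> \<A>) \<A> (\<lambda>(x, y). x + y)" using lie unfolding lie_group_def by blast
  from smooth_map_compose[OF assms(1) charted_prod_atlas[OF charted_A charted_A] charted_A
      smooth_map_Pair[OF assms(1) charted_A charted_A assms(2,3)] this]
  show ?thesis by simp
qed

lemma smooth_map_diff:
  assumes "charted \<B>" "smooth_map \<B> \<A> f" "smooth_map \<B> \<A> g"
  shows "smooth_map \<B> \<A> (\<lambda>x. f x - g x)"
proof -
  have u: "smooth_map \<A> \<A> uminus" using lie unfolding lie_group_def by blast
  from smooth_map_add[OF assms(1,2) smooth_map_compose[OF assms(1) charted_A charted_A assms(3) u]]
  show ?thesis by simp
qed

lemmas charted_AA = charted_prod_atlas[OF charted_A charted_A]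
lemmas smooth_map_fst_A = smooth_map_fst[OF smooth_A charted_A]
lemmas smooth_map_snd_A = smooth_map_snd[OF charted_A smooth_A]

lemma smooth_map_conj:
  "smooth_map (prod_atlas \<A> \<A>) \<A> (\<lambda>z. fst z + snd z - fst z)"
  by (intro smooth_map_diff smooth_map_add charted_AA smooth_map_fst_A smooth_map_snd_A)

lemma smooth_map_plus:
  "smooth_map (prod_atlas \<A> \<A>) \<A> (\<lambda>z. fst z + snd z)"
  by (intro smooth_map_add charted_AA smooth_map_fst_A smooth_map_snd_A)

lemma smooth_map_minus:
  "smooth_map (prod_atlas \<A> \<A>) \<A> (\<lambda>z. fst z - snd z)"
  by (intro smooth_map_diff charted_AA smooth_map_fst_A smooth_map_snd_A)

definition Ad :: "'f \<Rightarrow> 'e \<Rightarrow> 'e" where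
  "Ad g = frechet_derivative (\<lambda>q. c (g + inv_c q - g)) (at (c 0))"

lemma conj_coord:
  assumes "(V, d) \<in> \<A>" "g \<in> V"
  obtains T where "open T" "(d g, c 0) \<in> T" "T \<subseteq> d ` V \<times> c ` U"
    "\<forall>p q. (p, q) \<in> T \<longrightarrow> inv_into V d p + inv_c q - inv_into V d p \<in> U"
    "smooth_on T (\<lambda>z. c (inv_into V d (fst z) + inv_c (snd z) - inv_into V d (fst z)))"
proof -
  have "g + 0 - g \<in> U" using zero_in by simp
  from smooth_map_prod_coord[OF charted_A smooth_map_conj assms chart zero_in chart this] that
  show ?thesis by blast
qed

text \<open>\<open>Ad\<close> is the partial derivative, in the second variable, of conjugation as a
  smooth function of both coordinates. Therefore it depends smoothly on the group element, which
  gives both \<open>continuous_Ad\<close> and its differentiability at the neutral element.\<close>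

lemma Ad_partial:
  assumes "(V, d) \<in> \<A>" "(p, c 0) \<in> T"
    "smooth_on T (\<lambda>z. c (inv_into V d (fst z) + inv_c (snd z) - inv_into V d (fst z)))" (is "smooth_on T ?f")
  shows "((\<lambda>q. c (inv_into V d p + inv_c q - inv_into V d p)) has_derivative Ad (inv_into V d p)) (at (c 0))"
    "Ad (inv_into V d p) u = frechet_derivative ?f (at (p, c 0)) (0, u)"
proof -
  have "((\<lambda>q. ?f (p, q)) has_derivative (\<lambda>u. frechet_derivative ?f (at (p, c 0)) (0, u))) (at (c 0))"
    by (rule has_derivative_partial_snd[OF smooth_on_imp_has_derivative[OF assms(3,2)]])
  then have *: "((\<lambda>q. c (inv_into V d p + inv_c q - inv_into V d p)) has_derivative
     (\<lambda>u. frechet_derivative ?f (at (p, c 0)) (0, u))) (at (c 0))" by simp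
  have "Ad (inv_into V d p) = (\<lambda>u. frechet_derivative ?f (at (p, c 0)) (0, u))"
    unfolding Ad_def by (rule frechet_derivative_eq[OF *])
  with * show "((\<lambda>q. c (inv_into V d p + inv_c q - inv_into V d p)) has_derivative Ad (inv_into V d p)) (at (c 0))"
    "Ad (inv_into V d p) u = frechet_derivative ?f (at (p, c 0)) (0, u)" by simp_all
qed

lemma has_derivative_Ad: "((\<lambda>q. c (g + inv_c q - g)) has_derivative Ad g) (at (c 0))"
proof -
  obtain V d where V: "(V, d) \<in> \<A>" "g \<in> V" using charted_cover[OF charted_A] .
  obtain T where T: "open T" "(d g, c 0) \<in> T" "T \<subseteq> d ` V \<times> c ` U"
    "\<forall>p q. (p, q) \<in> T \<longrightarrow> inv_into V d p + inv_c q - inv_into V d p \<in> U"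
    "smooth_on T (\<lambda>z. c (inv_into V d (fst z) + inv_c (snd z) - inv_into V d (fst z)))"
    by (rule conj_coord[OF V])
  from Ad_partial(1)[OF V(1) T(2) T(5)] show ?thesis
    using chart_inv_into[OF charted_chart[OF charted_A V(1)] V(2)] by simp
qed

lemma linear_Ad: "linear (Ad g)"
  using has_derivative_Ad has_derivative_linear by blast

lemma conj_near_zero: "\<exists>N. open N \<and> c 0 \<in> N \<and> N \<subseteq> c ` U \<and> (\<forall>q\<in>N. g + inv_c q - g \<in> U)"
proof -
  obtain V d where V: "(V, d) \<in> \<A>" "g \<in> V" using charted_cover[OF charted_A] .
  obtain T where T: "open T" "(d g, c 0) \<in> T" "T \<subseteq> d ` V \<times> c ` U"
    "\<forall>p q. (p, q) \<in> T \<longrightarrow> inv_into V d p + inv_c q - inv_into V d p \<in> U"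
    "smooth_on T (\<lambda>z. c (inv_into V d (fst z) + inv_c (snd z) - inv_into V d (fst z)))"
    by (rule conj_coord[OF V])
  have eq: "inv_into V d (d g) = g" by (rule chart_inv_into[OF charted_chart[OF charted_A V(1)] V(2)])
  have "open ((\<lambda>q. (d g, q)) -` T)" using T(1) by (intro open_vimage continuous_intros)
  moreover have "g + inv_c q - g \<in> U" if "(d g, q) \<in> T" for q
    using T(4)[rule_format, OF that] unfolding eq .
  ultimately show ?thesis
    using T(2,3) by (intro exI[of _ "(\<lambda>q. (d g, q)) -` T"]) auto
qed

lemma continuous_Ad: "continuous_on UNIV (\<lambda>g. Ad g u)"
proof -
  have "isCont (\<lambda>g. Ad g u) g" for g
  proof -
    obtain V d where V: "(V, d) \<in> \<A>" "g \<in> V" using charted_cover[OF charted_A] .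
    obtain T where T: "open T" "(d g, c 0) \<in> T" "T \<subseteq> d ` V \<times> c ` U"
      "\<forall>p q. (p, q) \<in> T \<longrightarrow> inv_into V d p + inv_c q - inv_into V d p \<in> U"
      "smooth_on T (\<lambda>z. c (inv_into V d (fst z) + inv_c (snd z) - inv_into V d (fst z)))" (is "smooth_on T ?f")
      by (rule conj_coord[OF V])
    note cV = charted_chart[OF charted_A V(1)]
    let ?D = "\<lambda>p. frechet_derivative ?f (at (p, c 0)) (0, u)"
    let ?N = "(\<lambda>p. (p, c 0)) -` T"
    have oN: "open ?N" using T(1) by (intro open_vimage continuous_intros)
    have D: "continuous_on ?N ?D"
      by (rule continuous_on_compose2[OF smooth_on_imp_continuous_on[OF
              smooth_on_frechet_derivative[OF T(5), of "(0, u)"]]]) (auto intro!: continuous_intros)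
    have oM: "open (V \<inter> d -` ?N)"
      by (rule continuous_open_preimage[OF is_chart_openD(3,1)[OF cV] oN])
    have "continuous_on (V \<inter> d -` ?N) (\<lambda>g. ?D (d g))"
      by (rule continuous_on_compose2[OF D continuous_on_subset[OF is_chart_openD(3)[OF cV]]]) auto
    moreover have "Ad g' u = ?D (d g')" if "g' \<in> V \<inter> d -` ?N" for g'
      using Ad_partial(2)[OF V(1) _ T(5), of "d g'" u] that chart_inv_into[OF cV] by auto
    ultimately have "continuous_on (V \<inter> d -` ?N) (\<lambda>g. Ad g u)"
      using continuous_on_eq by fastforce
    then show ?thesis using oM V(2) T(2) by (simp add: continuous_on_eq_continuous_at)
  qed
  then show ?thesis by (simp add: continuous_at_imp_continuous_on)
qed

lemma Ad_zero: "Ad 0 u = u"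
proof -
  have "((\<lambda>q. c (0 + inv_c q - 0)) has_derivative (\<lambda>u. u)) (at (c 0))"
    by (rule has_derivative_transform_within_open[OF has_derivative_ident is_chart_openD(2)[OF is_chart_Uc]])
      (use zero_in in auto)
  then show ?thesis unfolding Ad_def using frechet_derivative_eq by metis
qed

text \<open>Conjugations compose, so this is the chain rule; on \<open>N\<close> the inner
  conjugation stays in \<open>U\<close>, where the chart and its inverse cancel.\<close>

lemma Ad_add: "Ad (g + h) u = Ad g (Ad h u)"
proof -
  obtain N where N: "open N" "c 0 \<in> N" "N \<subseteq> c ` U" "\<And>q. q \<in> N \<Longrightarrow> h + inv_c q - h \<in> U"
    using conj_near_zero[of h] by blast
  have "((\<lambda>q. c (g + inv_c q - g)) has_derivative Ad g) (at (c (h + inv_c (c 0) - h)))"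
    using has_derivative_Ad zero_in by simp
  from diff_chain_at[OF has_derivative_Ad[of h] this]
  have "((\<lambda>q. c (g + inv_c (c (h + inv_c q - h)) - g)) has_derivative (\<lambda>u. Ad g (Ad h u))) (at (c 0))"
    by (simp add: o_def)
  then have "((\<lambda>q. c (g + h + inv_c q - (g + h))) has_derivative (\<lambda>u. Ad g (Ad h u))) (at (c 0))"
  proof (rule has_derivative_transform_within_open[OF _ N(1,2)])
    fix q assume "q \<in> N"
    then have eq: "inv_c (c (h + inv_c q - h)) = h + inv_c q - h" using N(4) by simp
    show "c (g + inv_c (c (h + inv_c q - h)) - g) = c (g + h + inv_c q - (g + h))"
      unfolding eq by (simp add: diff_conv_add_uminus minus_add add.assoc del: add_uminus_conv_diff)
  qed
  then show ?thesis unfolding Ad_def[of "g + h"] using frechet_derivative_eq by metis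
qed

lemma Ad_minus [simp]: "Ad (- g) (Ad g u) = u" "Ad g (Ad (- g) u) = u"
  using Ad_add[of "- g" g u] Ad_add[of g "- g" u] by (simp_all add: Ad_zero)

end

section \<open>The bracket as the derivative of the adjoint representation\<close>

context lie_chart
begin

abbreviation br :: "'e \<Rightarrow> 'e \<Rightarrow> 'e" where "br \<equiv> lie_bracket (U, c)"

text \<open>Differentiate \<open>(p + q - p) + p = p + q\<close>, first in \<open>q\<close> and then in \<open>p\<close>.\<close>

lemma has_derivative_Ad_bracket:
  "((\<lambda>p. Ad (inv_c p) u) has_derivative (\<lambda>v. br v u)) (at (c 0))"
proof -
  define m where "m z = c (inv_c (fst z) + inv_c (snd z))" for z
  define f where "f z = c (inv_c (fst z) + inv_c (snd z) - inv_c (fst z))" for z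
  define Dm where "Dm z b = frechet_derivative m (at z) b" for z b
  \<comment> \<open>The second derivative of the multiplication at the neutral element. It is
    symmetric, and both the bracket and the derivative of \<open>Ad\<close> are expressed by its
    mixed entries.\<close>
  define E where "E b a = frechet_derivative (\<lambda>z. Dm z b) (at (c 0, c 0)) a" for a b
  have c0: "c 0 \<in> c ` U" using zero_in by blast
  obtain T where T: "open T" "(c 0, c 0) \<in> T" "T \<subseteq> c ` U \<times> c ` U"
    "\<forall>p q. (p, q) \<in> T \<longrightarrow> inv_c p + inv_c q \<in> U" "smooth_on T m"
    unfolding m_def
    by (rule smooth_map_prod_coord[OF charted_A smooth_map_plus chart zero_in chart zero_in chart])
      (use zero_in in auto)
  obtain R where R: "open R" "(c 0, c 0) \<in> R" "R \<subseteq> c ` U \<times> c ` U"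
    "\<forall>p q. (p, q) \<in> R \<longrightarrow> inv_c p + inv_c q - inv_c p \<in> U" "smooth_on R f"
    unfolding f_def by (rule conj_coord[OF chart zero_in])
  define N where "N = (\<lambda>p. (p, c 0)) -` T \<inter> (\<lambda>p. (c 0, p)) -` T \<inter> (\<lambda>p. (p, c 0)) -` R"
  have oN: "open N" unfolding N_def using T(1) R(1)
    by (intro open_Int open_vimage continuous_intros)
  have N0: "c 0 \<in> N" unfolding N_def using T(2) R(2) by simp
  have NU: "N \<subseteq> c ` U" unfolding N_def using T(3) by auto
  have m': "(m has_derivative Dm z) (at z)" if "z \<in> T" for z
    unfolding Dm_def by (rule smooth_on_imp_has_derivative[OF T(5) that])
  have linDm: "linear (Dm z)" if "z \<in> T" for z using m'[OF that] has_derivative_linear by blast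
  have Dm': "((\<lambda>z. Dm z b) has_derivative E b) (at (c 0, c 0))" for b
    unfolding E_def
    by (rule smooth_on_imp_has_derivative[OF _ T(2)])
      (unfold Dm_def, rule smooth_on_frechet_derivative[OF T(5)])
  have sym: "E b a = E a b" for a b
    unfolding E_def Dm_def by (rule second_derivative_symmetric[OF T(5,1,2)])
  have left_field: "left_field (U, c) w p = Dm (p, c 0) (0, w)" if "p \<in> N" for w p
  proof -
    have "((\<lambda>q. m (p, q)) has_derivative (\<lambda>u. Dm (p, c 0) (0, u))) (at (c 0))"
      using that by (intro has_derivative_partial_snd m') (simp add: N_def)
    from frechet_derivative_eq[OF this] show ?thesis by (simp add: left_field_def m_def)
  qed
  have left_field': "(left_field (U, c) w has_derivative (\<lambda>v. E (0, w) (v, 0))) (at (c 0))" for w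
    by (rule has_derivative_transform_within_open[OF has_derivative_partial_fst[OF Dm'] oN N0])
      (simp add: left_field)
  have bracket: "br v w = E (0, w) (v, 0) - E (0, v) (w, 0)" for v w
    unfolding lie_bracket_def using frechet_derivative_eq[OF left_field'] by simp
  define a where "a e p = Ad (inv_c p) u \<bullet> e" for e p
  have Ad_f: "Ad (inv_c p) u = frechet_derivative f (at (p, c 0)) (0, u)" if "p \<in> N" for p
    using Ad_partial(2)[OF chart _ R(5)[unfolded f_def], of p u] that unfolding N_def f_def by simp
  have "((\<lambda>p. frechet_derivative f (at (p, c 0)) (0, u)) has_derivative
      (\<lambda>v. frechet_derivative (\<lambda>z. frechet_derivative f (at z) (0, u)) (at (c 0, c 0)) (v, 0))) (at (c 0))"
    by (rule has_derivative_partial_fst[OF smooth_on_imp_has_derivative[OF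
            smooth_on_frechet_derivative[OF R(5)] R(2)]])
  then obtain D where D: "((\<lambda>p. Ad (inv_c p) u) has_derivative D) (at (c 0))"
    using has_derivative_transform_within_open[OF _ oN N0] Ad_f by (metis (no_types, lifting))
  \<comment> \<open>The derivative in q, at the neutral element, of the identity quoted above the
    lemma.\<close>
  have rel: "Dm (c 0, p) (Ad (inv_c p) u, 0) = Dm (p, c 0) (0, u)" if p: "p \<in> N" for p
  proof -
    have "((\<lambda>q. c (inv_c p + inv_c q - inv_c p)) has_derivative Ad (inv_c p)) (at (c 0))"
      by (rule has_derivative_Ad)
    moreover have "((\<lambda>s. m (s, p)) has_derivative (\<lambda>v. Dm (c 0, p) (v, 0)))
        (at (c (inv_c p + inv_c (c 0) - inv_c p)))"
      using p zero_in by (simp add: N_def) (intro has_derivative_partial_fst m', simp)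
    ultimately have 1: "((\<lambda>q. m (c (inv_c p + inv_c q - inv_c p), p)) has_derivative
        (\<lambda>u. Dm (c 0, p) (Ad (inv_c p) u, 0))) (at (c 0))"
      using diff_chain_at by (fastforce simp: o_def)
    have o: "open ((\<lambda>q. (p, q)) -` R)" using R(1) by (intro open_vimage continuous_intros)
    have "((\<lambda>q. m (p, q)) has_derivative (\<lambda>u. Dm (c 0, p) (Ad (inv_c p) u, 0))) (at (c 0))"
    proof (rule has_derivative_transform_within_open[OF 1 o])
      show "c 0 \<in> (\<lambda>q. (p, q)) -` R" using p by (simp add: N_def)
      fix q assume "q \<in> (\<lambda>q. (p, q)) -` R"
      then have "inv_c p + inv_c q - inv_c p \<in> U" using R(4) by simp
      then show "m (c (inv_c p + inv_c q - inv_c p), p) = m (p, q)" by (simp add: m_def)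
    qed
    moreover have "((\<lambda>q. m (p, q)) has_derivative (\<lambda>u. Dm (p, c 0) (0, u))) (at (c 0))"
      using p by (intro has_derivative_partial_snd m') (simp add: N_def)
    ultimately have "(\<lambda>u. Dm (c 0, p) (Ad (inv_c p) u, 0)) = (\<lambda>u. Dm (p, c 0) (0, u))"
      by (rule has_derivative_unique)
    then show ?thesis by meson
  qed
  have a': "(a e has_derivative (\<lambda>v. D v \<bullet> e)) (at (c 0))" for e
    unfolding a_def by (rule bounded_linear.has_derivative[OF bounded_linear_inner_left D])
  have rho': "((\<lambda>p. Dm (c 0, p) (e, 0)) has_derivative (\<lambda>v. E (e, 0) (0, v))) (at (c 0))" for e
    by (rule has_derivative_partial_snd[OF Dm'])
  have a0: "a e (c 0) = u \<bullet> e" for e using zero_in by (simp add: a_def Ad_zero)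
  have rho0: "Dm (c 0, c 0) (e, 0) = e" for e
  proof -
    have "((\<lambda>p. m (p, c 0)) has_derivative (\<lambda>v. Dm (c 0, c 0) (v, 0))) (at (c 0))"
      by (rule has_derivative_partial_fst[OF m'[OF T(2)]])
    moreover have "((\<lambda>p. m (p, c 0)) has_derivative (\<lambda>v. v)) (at (c 0))"
      by (rule has_derivative_transform_within_open[OF has_derivative_ident oN N0])
        (use NU zero_in in \<open>auto simp: m_def\<close>)
    ultimately have "(\<lambda>v. Dm (c 0, c 0) (v, 0)) = (\<lambda>v. v)" by (rule has_derivative_unique)
    then show ?thesis by meson
  qed
  \<comment> \<open>A basis expansion turns \<open>Dm (c 0, p) (Ad (inv_c p) u, 0)\<close>, in which
    both the map and its argument vary with p, into a finite sum of products that the ordinary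
    product rule differentiates.\<close>
  have sumE: "(\<Sum>e\<in>Basis. (w \<bullet> e) *\<^sub>R L e) = L w" if "linear L" for w and L :: "'e \<Rightarrow> 'e"
    using linear_sum[OF that, of "\<lambda>e. (w \<bullet> e) *\<^sub>R e" Basis] linear_scale[OF that]
    by (simp add: euclidean_representation)
  have lin_fst: "linear (\<lambda>w. Dm (c 0, p) (w, 0))" if "p \<in> N" for p
  proof -
    have "(c 0, p) \<in> T" using that by (simp add: N_def)
    from has_derivative_linear[OF has_derivative_partial_fst[OF m'[OF this]]] show ?thesis .
  qed
  have "((\<lambda>p. \<Sum>e\<in>Basis. a e p *\<^sub>R Dm (c 0, p) (e, 0)) has_derivative
      (\<lambda>v. \<Sum>e\<in>Basis. a e (c 0) *\<^sub>R E (e, 0) (0, v) + (D v \<bullet> e) *\<^sub>R Dm (c 0, c 0) (e, 0))) (at (c 0))"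
    by (intro has_derivative_sum has_derivative_scaleR a' rho')
  then have "((\<lambda>p. Dm (p, c 0) (0, u)) has_derivative
      (\<lambda>v. \<Sum>e\<in>Basis. a e (c 0) *\<^sub>R E (e, 0) (0, v) + (D v \<bullet> e) *\<^sub>R Dm (c 0, c 0) (e, 0))) (at (c 0))"
  proof (rule has_derivative_transform_within_open[OF _ oN N0])
    fix p assume p: "p \<in> N"
    show "(\<Sum>e\<in>Basis. a e p *\<^sub>R Dm (c 0, p) (e, 0)) = Dm (p, c 0) (0, u)"
      unfolding a_def using sumE[OF lin_fst[OF p]] rel[OF p] by simp
  qed
  moreover have "((\<lambda>p. Dm (p, c 0) (0, u)) has_derivative (\<lambda>v. E (0, u) (v, 0))) (at (c 0))"
    by (rule has_derivative_partial_fst[OF Dm'])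
  ultimately have eq: "(\<lambda>v. E (0, u) (v, 0)) =
      (\<lambda>v. \<Sum>e\<in>Basis. a e (c 0) *\<^sub>R E (e, 0) (0, v) + (D v \<bullet> e) *\<^sub>R Dm (c 0, c 0) (e, 0))"
    using has_derivative_unique by blast
  have "D v = br v u" for v
  proof -
    have "linear (\<lambda>e. E (e, 0) (0, v))"
    proof -
      have "linear (\<lambda>e. E (0, v) (e, 0))"
        by (rule has_derivative_linear[OF has_derivative_partial_fst[OF Dm']])
      then show ?thesis by (simp add: sym[of _ "(0, v)"])
    qed
    \<comment> \<open>Symmetry of \<open>E\<close> turns the first term on the right into
      \<open>E (0, v) (u, 0)\<close>, so \<open>D v\<close> is exactly the bracket.\<close>
    then have "E (0, u) (v, 0) = E (u, 0) (0, v) + D v"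
      using fun_cong[OF eq, of v] by (simp add: sum.distrib a0 rho0 sumE euclidean_representation)
    then show ?thesis unfolding bracket sym[of "(0, v)"] by simp
  qed
  then have "D = (\<lambda>v. br v u)" by blast
  with D show ?thesis by simp
qed

lemma br_antisym: "br v u = - br u v"
  by (simp add: lie_bracket_def)

text \<open>The bracket is linear in its first slot because it is a derivative there; antisymmetry
  carries this over to the second slot.\<close>

lemma bilinear_br: "bilinear br"
proof -
  have l: "linear (\<lambda>v. br v u)" for u
    by (rule has_derivative_linear[OF has_derivative_Ad_bracket])
  have "linear (\<lambda>u. br v u)" for v
    unfolding br_antisym[of v] by (rule linear_compose_neg[OF l])
  then show ?thesis using l by (simp add: bilinear_def)
qed

text \<open>Differentiate \<open>Ad g (Ad h w) = Ad (g + h - g) (Ad g w)\<close> in h at the neutral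
  element.\<close>

lemma Ad_br: "Ad g (br v w) = br (Ad g v) (Ad g w)"
proof -
  obtain N where N: "open N" "c 0 \<in> N" "N \<subseteq> c ` U" "\<And>q. q \<in> N \<Longrightarrow> g + inv_c q - g \<in> U"
    using conj_near_zero[of g] by blast
  let ?f = "\<lambda>q. c (g + inv_c q - g)"
  have "((\<lambda>p. Ad (inv_c p) (Ad g w)) has_derivative (\<lambda>v. br v (Ad g w))) (at (?f (c 0)))"
    using has_derivative_Ad_bracket zero_in by simp
  from diff_chain_at[OF has_derivative_Ad[of g] this]
  have "((\<lambda>p. Ad (inv_c (?f p)) (Ad g w)) has_derivative (\<lambda>v. br (Ad g v) (Ad g w))) (at (c 0))"
    by (simp add: o_def)
  then have 1: "((\<lambda>p. Ad g (Ad (inv_c p) w)) has_derivative (\<lambda>v. br (Ad g v) (Ad g w))) (at (c 0))"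
  proof (rule has_derivative_transform_within_open[OF _ N(1,2)])
    fix p assume "p \<in> N"
    then have "Ad (inv_c (?f p)) (Ad g w) = Ad (g + inv_c p + - g) (Ad g w)"
      using N(4) by simp
    also have "\<dots> = Ad g (Ad (inv_c p) w)" by (simp only: Ad_add Ad_minus)
    finally show "Ad (inv_c (?f p)) (Ad g w) = Ad g (Ad (inv_c p) w)" .
  qed
  have "bounded_linear (Ad g)" using linear_Ad linear_conv_bounded_linear by blast
  from bounded_linear.has_derivative[OF this has_derivative_Ad_bracket]
  have 2: "((\<lambda>p. Ad g (Ad (inv_c p) w)) has_derivative (\<lambda>v. Ad g (br v w))) (at (c 0))" .
  show ?thesis using has_derivative_unique[OF 2 1] by meson
qed

text \<open>By the assumption \<open>\<beta> (Ad g u) (Ad g v)\<close> is constant in g; its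
  derivative at the neutral element is the claimed expression.\<close>

lemma Ad_invariant_imp_br_invariant:
  assumes "bilinear \<beta>" "\<And>g. \<beta> (Ad g u) (Ad g v) = (\<beta> u v :: real)"
  shows "\<beta> (br x u) v + \<beta> u (br x v) = 0"
proof -
  have "bounded_bilinear \<beta>" using assms(1) bilinear_conv_bounded_bilinear by blast
  from bounded_bilinear.FDERIV[OF this has_derivative_Ad_bracket has_derivative_Ad_bracket]
  have "((\<lambda>p. \<beta> (Ad (inv_c p) u) (Ad (inv_c p) v)) has_derivative
      (\<lambda>x. \<beta> (Ad (inv_c (c 0)) u) (br x v) + \<beta> (br x u) (Ad (inv_c (c 0)) v))) (at (c 0))" .
  then have 1: "((\<lambda>p. \<beta> u v) has_derivative (\<lambda>x. \<beta> u (br x v) + \<beta> (br x u) v)) (at (c 0))"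
    using zero_in by (simp add: assms(2) Ad_zero)
  have "\<beta> u (br x v) + \<beta> (br x u) v = 0"
    using has_derivative_unique[OF 1 has_derivative_const] by meson
  then show ?thesis by simp
qed

end

section \<open>Orthonormal frames\<close>

text \<open>Completeness takes the form of the expansion formula. The index set is kept apart from
  the vectors so that sets of vectors and families over a finite type both qualify.\<close>

definition orthonormal_frame :: "'a::real_vector form \<Rightarrow> 'i set \<Rightarrow> ('i \<Rightarrow> 'a) \<Rightarrow> bool" where
  "orthonormal_frame b I e \<longleftrightarrow> finite I \<and>
     (\<forall>i\<in>I. \<forall>j\<in>I. b (e i) (e j) = (if i = j then 1 else 0)) \<and>
     (\<forall>x. (\<Sum>i\<in>I. b x (e i) *\<^sub>R e i) = x)"

lemma inner_product_linear:
  assumes "inner_product b"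
  shows "linear (b x)" "linear (\<lambda>x. b x y)"
  using assms unfolding inner_product_def bilinear_def by simp_all

lemma inner_product_commute: "inner_product b \<Longrightarrow> b x y = b y x"
  unfolding inner_product_def by simp

lemma inner_product_eq_zero: "inner_product b \<Longrightarrow> b x x = 0 \<longleftrightarrow> x = 0"
  using linear_0[OF inner_product_linear(1)]
  unfolding inner_product_def by (metis less_irrefl)

lemma inner_product_nonneg: "inner_product b \<Longrightarrow> 0 \<le> b x x"
  using inner_product_eq_zero[of b x] unfolding inner_product_def by (cases "x = 0") force+

lemma frame_parseval:
  assumes "inner_product b" "orthonormal_frame b I e"
  shows "b x y = (\<Sum>i\<in>I. b x (e i) * b y (e i))"
proof -
  have "b x y = b x (\<Sum>i\<in>I. b y (e i) *\<^sub>R e i)"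
    using assms(2) unfolding orthonormal_frame_def by simp
  also have "\<dots> = (\<Sum>i\<in>I. b x (e i) * b y (e i))"
    by (simp add: linear_sum[OF inner_product_linear(1)[OF assms(1)]]
        linear_scale[OF inner_product_linear(1)[OF assms(1)]] mult.commute)
  finally show ?thesis .
qed

lemma frame_expand_linear:
  assumes "orthonormal_frame b I e" "linear (f :: 'a::real_vector \<Rightarrow> 'b::real_vector)"
  shows "f x = (\<Sum>i\<in>I. b x (e i) *\<^sub>R f (e i))"
proof -
  have "f x = f (\<Sum>i\<in>I. b x (e i) *\<^sub>R e i)"
    using assms(1) unfolding orthonormal_frame_def by simp
  then show ?thesis by (simp add: linear_sum[OF assms(2)] linear_scale[OF assms(2)])
qed

text \<open>Basis independence of the trace: expand in the frame and in the standard basis and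
  interchange the two sums.\<close>

lemma frame_lin_trace:
  fixes L :: "'a::euclidean_space \<Rightarrow> 'a"
  assumes "inner_product b" "orthonormal_frame b I e" "linear L"
  shows "lin_trace L = (\<Sum>i\<in>I. b (L (e i)) (e i))"
proof -
  have "lin_trace L = (\<Sum>k\<in>Basis. (\<Sum>i\<in>I. b k (e i) *\<^sub>R L (e i)) \<bullet> k)"
    unfolding lin_trace_def
    by (intro sum.cong arg_cong2[where f = inner] frame_expand_linear[OF assms(2,3)] refl)
  also have "\<dots> = (\<Sum>k\<in>Basis. \<Sum>i\<in>I. b k (e i) * (L (e i) \<bullet> k))"
    by (simp add: inner_sum_left)
  also have "\<dots> = (\<Sum>i\<in>I. \<Sum>k\<in>Basis. b k (e i) * (L (e i) \<bullet> k))"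
    by (rule sum.swap)
  also have "\<dots> = (\<Sum>i\<in>I. b (\<Sum>k\<in>Basis. (L (e i) \<bullet> k) *\<^sub>R k) (e i))"
    by (simp add: linear_sum[OF inner_product_linear(2)[OF assms(1)]]
        linear_scale[OF inner_product_linear(2)[OF assms(1)]] mult.commute)
  finally show ?thesis by (simp add: euclidean_representation)
qed

lemma orthonormal_set_independent:
  assumes "inner_product b" "finite E"
    and "\<And>x y. x \<in> E \<Longrightarrow> y \<in> E \<Longrightarrow> b x y = (if x = y then 1 else 0)"
  shows "independent E"
proof (rule independent_if_scalars_zero[OF assms(2)])
  fix f :: "'a \<Rightarrow> real" and v
  assume s: "(\<Sum>x\<in>E. f x *\<^sub>R x) = 0" and v: "v \<in> E"
  have "0 = b (\<Sum>x\<in>E. f x *\<^sub>R x) v"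
    unfolding s using linear_0[OF inner_product_linear(2)[OF assms(1)]] by simp
  also have "\<dots> = (\<Sum>x\<in>E. f x * b x v)"
    by (simp add: linear_sum[OF inner_product_linear(2)[OF assms(1)]]
        linear_scale[OF inner_product_linear(2)[OF assms(1)]])
  also have "\<dots> = (\<Sum>x\<in>E. if x = v then f x else 0)"
    using assms(3) v by (intro sum.cong) auto
  also have "\<dots> = f v" using v assms(2) by simp
  finally show "f v = 0" by simp
qed

text \<open>Orthonormal sets are independent, so there is one of greatest cardinality. It is
  complete, since a vector with a nonzero remainder could be normalized and added to it.\<close>

lemma orthonormal_frame_exists:
  fixes b :: "'a::euclidean_space form"
  assumes "inner_product b"
  shows "\<exists>E. orthonormal_frame b E (\<lambda>x. x) \<and> card E = DIM('a)"
proof -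
  note lin = inner_product_linear[OF assms]
  define on where "on E \<longleftrightarrow> finite E \<and> (\<forall>x\<in>E. \<forall>y\<in>E. b x y = (if x = y then 1 else 0))" for E
  have bd: "card E \<le> DIM('a)" if "on E" for E
    using that independent_bound orthonormal_set_independent[OF assms, of E] unfolding on_def by blast
  have "\<exists>E. on E \<and> (\<forall>E'. on E' \<longrightarrow> card E' \<le> card E)"
    by (rule ex_has_greatest_nat[of on "{}" card "Suc (DIM('a))"]) (use bd in \<open>auto simp: on_def less_Suc_eq_le\<close>)
  then obtain E where E: "on E" "\<And>E'. on E' \<Longrightarrow> card E' \<le> card E" by blast
  have fin: "finite E" and oE: "\<And>x y. x \<in> E \<Longrightarrow> y \<in> E \<Longrightarrow> b x y = (if x = y then 1 else 0)"
    using E(1) unfolding on_def by auto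
  have complete: "(\<Sum>e\<in>E. b x e *\<^sub>R e) = x" for x
  proof (rule ccontr)
    assume ne: "\<not> ?thesis"
    define r where "r = x - (\<Sum>e\<in>E. b x e *\<^sub>R e)"
    have r0: "r \<noteq> 0" using ne by (simp add: r_def)
    have re: "b r e = 0" if "e \<in> E" for e
    proof -
      have "b (\<Sum>f\<in>E. b x f *\<^sub>R f) e = (\<Sum>f\<in>E. if f = e then b x f else 0)"
        using oE that by (simp add: linear_sum[OF lin(2)] linear_scale[OF lin(2)]) (intro sum.cong, auto)
      then show ?thesis using that fin by (simp add: r_def linear_diff[OF lin(2)])
    qed
    have brr: "b r r > 0" using r0 assms unfolding inner_product_def by blast
    define s where "s = (1 / sqrt (b r r)) *\<^sub>R r"
    have ss: "b s s = 1"
      using brr by (simp add: s_def linear_scale[OF lin(1)] linear_scale[OF lin(2)])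
    have se: "b s e = 0" "b e s = 0" if "e \<in> E" for e
      using re[OF that] inner_product_commute[OF assms, of e]
      by (simp_all add: s_def linear_scale[OF lin(1)] linear_scale[OF lin(2)])
    have "s \<notin> E" using ss se by fastforce
    moreover have "on (insert s E)"
      using ss se oE fin \<open>s \<notin> E\<close> unfolding on_def by auto
    ultimately show False using E(2)[of "insert s E"] fin by simp
  qed
  have "x \<in> span E" for x
    by (subst complete[of x, symmetric]) (intro span_sum span_scale span_base)
  then have "span E = UNIV" by blast
  then have "card E = DIM('a)"
    using orthonormal_set_independent[OF assms fin oE] dim_eq_card_independent[of E] dim_span[of E]
    by (simp add: dim_UNIV)
  then show ?thesis using complete oE fin unfolding orthonormal_frame_def by blast
qed

lemma orthonormal_frame_exists_vec:
  fixes b :: "(real ^ 'd) form"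
  assumes "inner_product b"
  shows "\<exists>X :: 'd \<Rightarrow> real ^ 'd. orthonormal_frame b UNIV X"
proof -
  obtain E where E: "orthonormal_frame b E (\<lambda>x. x)" "card E = DIM(real ^ 'd)"
    using orthonormal_frame_exists[OF assms] by blast
  have "finite E" using E(1) unfolding orthonormal_frame_def by blast
  then obtain X where X: "bij_betw X (UNIV :: 'd set) E"
    using finite_same_card_bij[of "UNIV :: 'd set" E] E(2) by auto
  have "(\<Sum>i\<in>UNIV. b x (X i) *\<^sub>R X i) = x" for x
    using sum.reindex_bij_betw[OF X, of "\<lambda>e. b x e *\<^sub>R e"] E(1)
    unfolding orthonormal_frame_def by simp
  moreover have "b (X i) (X j) = (if i = j then 1 else 0)" for i j
    using E(1) X unfolding orthonormal_frame_def bij_betw_def inj_def by auto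
  ultimately have "orthonormal_frame b UNIV X" unfolding orthonormal_frame_def by simp
  then show ?thesis by blast
qed

text \<open>\<open>sharp\<close> is a definite description: a frame supplies the Riesz representer,
  and definiteness of b its uniqueness.\<close>

lemma sharp_works:
  fixes b :: "'a::euclidean_space form"
  assumes "inner_product b" "linear f"
  shows "b (sharp b f) z = f z"
proof -
  note lin = inner_product_linear[OF assms(1)]
  obtain E where E: "orthonormal_frame b E (\<lambda>x. x)" using orthonormal_frame_exists[OF assms(1)] by blast
  define w where "w = (\<Sum>e\<in>E. f e *\<^sub>R e)"
  have w: "b w z = f z" for z
    using frame_expand_linear[OF E assms(2), of z] inner_product_commute[OF assms(1), of z]
    by (simp add: w_def linear_sum[OF lin(2)] linear_scale[OF lin(2)] mult.commute)
  have "\<exists>!w. \<forall>z. b w z = f z"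
  proof (rule ex1I[of _ w])
    fix w' assume w': "\<forall>z. b w' z = f z"
    have "b (w' - w) (w' - w) = 0" using w w' by (simp add: linear_diff[OF lin(2)])
    then show "w' = w" by (simp add: inner_product_eq_zero[OF assms(1)])
  qed (use w in blast)
  from theI'[OF this] show ?thesis unfolding sharp_def by blast
qed

lemma lin_trace_commute:
  fixes L M :: "'a::euclidean_space \<Rightarrow> 'a"
  assumes "linear L" "linear M"
  shows "lin_trace (\<lambda>x. L (M x)) = lin_trace (\<lambda>x. M (L x))"
proof -
  have *: "lin_trace (\<lambda>x. L (M x)) = (\<Sum>e\<in>Basis. \<Sum>f\<in>Basis. (M e \<bullet> f) * (L f \<bullet> e))"
    if "linear L" for L M :: "'a \<Rightarrow> 'a"
  proof -
    have "L (M e) = (\<Sum>f\<in>Basis. (M e \<bullet> f) *\<^sub>R L f)" for e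
      by (subst euclidean_representation[of "M e", symmetric])
        (simp add: linear_sum[OF that] linear_scale[OF that])
    then show ?thesis by (simp add: lin_trace_def inner_sum_left)
  qed
  show ?thesis
    unfolding *[OF assms(1)] *[OF assms(2)] by (subst sum.swap) (simp add: mult.commute)
qed

section \<open>Invariant inner products for compact groups\<close>

text \<open>
  On the convex hull of the orbit of the standard inner product, the largest norm along an orbit
  is an invariant function; by strict convexity of the Euclidean norm its minimizer is unique,
  hence a fixed point.
\<close>

lemma compact_group_invariant_inner_product:
  fixes A :: "'g::{group_add, topological_space} \<Rightarrow> real ^ 'd \<Rightarrow> real ^ 'd"
  assumes comp: "compact (UNIV :: 'g set)" and lin: "\<And>g. linear (A g)"
    and cont: "\<And>u. continuous_on UNIV (\<lambda>g. A g u)"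
    and add: "\<And>g h u. A (g + h) u = A g (A h u)" and zero: "\<And>u. A 0 u = u"
  shows "\<exists>q. inner_product q \<and> (\<forall>g u v. q (A g u) (A g v) = q u v)"
proof -
  define B where "B g = matrix (A g)" for g
  \<comment> \<open>The pullback of the form with matrix M along \<open>A h\<close>; hence a right
    action, as the order in \<open>act_act\<close> shows.\<close>
  define act where "act h M = transpose (B h) ** M ** B h" for h and M :: "real ^ 'd ^ 'd"
  have B_mult: "B g ** B h = B (g + h)" for g h
  proof -
    have "A (g + h) = A g \<circ> A h" by (simp add: fun_eq_iff add)
    then show ?thesis using matrix_compose[OF lin[of h] lin[of g]] by (simp add: B_def)
  qed
  have B_vec: "B g *v u = A g u" for g u
    by (simp add: B_def matrix_works linear_matrix_vector_mul_eq lin)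
  have B_zero: "B 0 = mat 1"
    by (simp add: matrix_eq B_vec zero)
  have act_act: "act g (act h M) = act (h + g) M" for g h M
    by (simp add: act_def B_mult[symmetric] matrix_transpose_mul matrix_mul_assoc)
  have act_zero: "act 0 M = M" for M
    by (simp add: act_def B_zero transpose_mat)
  have act_lin: "linear (act h)" for h
  proof (rule linearI)
    have "(X + Y) ** Z = X ** Z + Y ** Z" for X Y Z :: "real ^ 'd ^ 'd"
      by (simp add: matrix_matrix_mult_def vec_eq_iff sum.distrib distrib_right)
    then show "act h (X + Y) = act h X + act h Y" for X Y
      by (simp add: act_def matrix_add_ldistrib)
    show "act h (r *\<^sub>R X) = r *\<^sub>R act h X" for r X
      by (simp add: act_def matrix_scalar_ac scalar_matrix_assoc[symmetric])
  qed
  have cB: "continuous_on UNIV (\<lambda>g. B g $ i $ j)" for i j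
    unfolding B_def matrix_def by (simp add: continuous_on_component cont)
  have cact: "continuous_on S (\<lambda>z. act (fst z) (snd z))" for S
    unfolding act_def matrix_matrix_mult_def transpose_def
    by (simp, intro continuous_on_vec_lambda continuous_on_sum continuous_on_mult continuous_on_component
        continuous_on_compose2[OF cB] continuous_intros) auto
  have cacth: "continuous_on UNIV (\<lambda>h. act h M)" for M
  proof -
    have "continuous_on UNIV (\<lambda>h. act (fst (h, M)) (snd (h, M)))"
      by (rule continuous_on_compose2[OF cact[of UNIV]])
        (auto intro!: continuous_on_Pair continuous_on_const continuous_on_id)
    then show ?thesis by simp
  qed
  then have cactM: "continuous_on UNIV (\<lambda>h. norm (act h M))" for M
    by (rule continuous_on_norm)
  \<comment> \<open>Compactness of the group bounds all operators \<open>act h\<close> at once; this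
    makes the largest norm along an orbit finite and Lipschitz in its starting point.\<close>
  have "bounded ((\<lambda>z. norm (act (fst z) (snd z))) ` (UNIV \<times> sphere 0 1))"
    by (intro compact_imp_bounded compact_continuous_image continuous_on_norm cact compact_Times comp compact_sphere)
  then obtain K where K: "\<And>h M. M \<in> sphere 0 1 \<Longrightarrow> norm (act h M) \<le> K"
    unfolding bounded_iff by (force simp: image_iff)
  have K0: "norm (act h M) \<le> \<bar>K\<bar> * norm M" for h M
  proof (cases "M = 0")
    case True
    then show ?thesis using linear_0[OF act_lin] by simp
  next
    case False
    have "norm (act h ((1 / norm M) *\<^sub>R M)) \<le> K" using False by (intro K) simp
    then have "norm (act h M) / norm M \<le> \<bar>K\<bar>" by (simp add: linear_scale[OF act_lin])
    then show ?thesis using False by (simp add: divide_le_eq)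
  qed
  define \<phi> where "\<phi> M = (SUP h. norm (act h M))" for M
  have bdd: "bdd_above (range (\<lambda>h. norm (act h M)))" for M
    using K0 by (intro bdd_aboveI[of _ "\<bar>K\<bar> * norm M"]) auto
  have le_phi: "norm (act h M) \<le> \<phi> M" for h M
    unfolding \<phi>_def by (rule cSUP_upper[OF _ bdd]) simp
  have phi_le: "\<phi> M \<le> \<phi> N + \<bar>K\<bar> * norm (M - N)" for M N
    unfolding \<phi>_def[of M]
  proof (rule cSUP_least)
    fix h
    have "act h M = act h N + act h (M - N)" by (simp add: linear_diff[OF act_lin])
    then have "norm (act h M) \<le> norm (act h N) + norm (act h (M - N))" using norm_triangle_ineq by metis
    then show "norm (act h M) \<le> \<phi> N + \<bar>K\<bar> * norm (M - N)" using le_phi[of h N] K0[of h "M - N"] by linarith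
  qed simp
  define Orb where "Orb = range (\<lambda>g. act g (mat 1))"
  define C where "C = convex hull Orb"
  have contphi: "continuous_on C \<phi>"
  proof (rule lipschitz_on_continuous_on[of "\<bar>K\<bar>"], rule lipschitz_onI)
    fix M N
    show "dist (\<phi> M) (\<phi> N) \<le> \<bar>K\<bar> * dist M N"
      using phi_le[of M N] phi_le[of N M] by (simp add: dist_real_def dist_norm norm_minus_commute)
  qed simp
  have "compact Orb" unfolding Orb_def by (rule compact_continuous_image[OF cacth comp])
  then have compC: "compact C" unfolding C_def by (rule compact_convex_hull)
  have neC: "C \<noteq> {}" unfolding C_def Orb_def by simp
  have actC: "act h M \<in> C" if "M \<in> C" for h M
  proof -
    have "act h ` Orb \<subseteq> Orb" unfolding Orb_def using act_act by auto
    then have "act h ` C \<subseteq> C"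
      unfolding C_def convex_hull_linear_image[OF act_lin] by (rule hull_mono)
    then show ?thesis using that by blast
  qed
  obtain M where M: "M \<in> C" "\<And>N. N \<in> C \<Longrightarrow> \<phi> M \<le> \<phi> N"
    using continuous_attains_inf[OF compC neC contphi] by blast
  have phi_act: "\<phi> (act g N) \<le> \<phi> N" for g N
    unfolding \<phi>_def[of "act g N"] by (rule cSUP_least) (simp_all add: act_act le_phi)
  have fixed: "act g M = M" for g
  proof -
    \<comment> \<open>If g moved the minimizer M, the parallelogram law would make
      \<open>\<phi>\<close> smaller at this midpoint than at M; \<open>h\<close> below is where the
      largest norm on the orbit of the midpoint is attained.\<close>
    define N where "N = (1 / 2) *\<^sub>R M + (1 / 2) *\<^sub>R act g M"
    have NC: "N \<in> C"
      unfolding N_def by (intro convexD M(1) actC) (auto simp: C_def)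
    obtain h where h: "\<And>h'. norm (act h' N) \<le> norm (act h N)"
      using continuous_attains_sup[OF comp UNIV_not_empty cactM[of N]] by auto
    have "\<phi> N \<le> norm (act h N)" unfolding \<phi>_def using h by (intro cSUP_least) auto
    then have 1: "\<phi> M \<le> norm (act h N)" using M(2)[OF NC] by linarith
    define x y where "x = act h M" and "y = act h (act g M)"
    have N': "act h N = (1 / 2) *\<^sub>R (x + y)"
      by (simp add: N_def x_def y_def linear_add[OF act_lin] linear_scale[OF act_lin] scaleR_add_right)
    have "norm x \<le> \<phi> M" "norm y \<le> \<phi> M"
      using le_phi[of h M] le_phi[of h "act g M"] phi_act[of g M] by (simp_all add: x_def y_def)
    then have xy: "(norm x)\<^sup>2 \<le> (\<phi> M)\<^sup>2" "(norm y)\<^sup>2 \<le> (\<phi> M)\<^sup>2" by (simp_all add: power_mono)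
    have "0 \<le> \<phi> M" using le_phi[of 0 M] norm_ge_zero order_trans by blast
    then have "(\<phi> M)\<^sup>2 \<le> (norm (act h N))\<^sup>2" using 1 by (simp add: power_mono)
    also have "\<dots> = ((norm x)\<^sup>2 + (norm y)\<^sup>2) / 2 - (norm (x - y))\<^sup>2 / 4"
    proof -
      have "(norm (x + y))\<^sup>2 + (norm (x - y))\<^sup>2 = 2 * (norm x)\<^sup>2 + 2 * (norm y)\<^sup>2"
        unfolding power2_norm_eq_inner
        by (simp add: inner_add_left inner_add_right inner_diff_left inner_diff_right inner_commute)
      moreover have "(norm (act h N))\<^sup>2 = (norm (x + y))\<^sup>2 / 4"
        unfolding N' by (simp add: power_divide)
      ultimately show ?thesis by (simp add: field_simps)
    qed
    finally have "(norm (x - y))\<^sup>2 \<le> 0" using xy by argo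
    then have "x = y" by simp
    then have "act (- h) (act h M) = act (- h) (act h (act g M))" by (simp add: x_def y_def)
    then show ?thesis by (simp add: act_act act_zero)
  qed
  \<comment> \<open>The positive definite symmetric matrices form a convex set containing the orbit,
    hence also its convex hull and the fixed point M.\<close>
  define P where "P = {N :: real ^ 'd ^ 'd. transpose N = N \<and> (\<forall>x. x \<noteq> 0 \<longrightarrow> 0 < x \<bullet> (N *v x))}"
  have inner_act: "u \<bullet> (act g N *v v) = A g u \<bullet> (N *v A g v)" for u v g N
  proof -
    have "u \<bullet> (act g N *v v) = u \<bullet> (transpose (B g) *v (N *v A g v))"
      by (simp only: act_def matrix_vector_mul_assoc[symmetric] B_vec)
    also have "\<dots> = (u v* transpose (B g)) \<bullet> (N *v A g v)" by (simp only: dot_lmul_matrix)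
    finally show ?thesis by (simp only: vector_transpose_matrix B_vec)
  qed
  have "convex P"
    unfolding convex_def P_def
  proof (clarsimp, intro conjI allI impI)
    fix M N :: "real ^ 'd ^ 'd" and s t :: real
    assume MN: "transpose M = M" "transpose N = N" "0 \<le> s" "0 \<le> t" "s + t = 1"
      "\<forall>x. x \<noteq> 0 \<longrightarrow> 0 < x \<bullet> (M *v x)" "\<forall>x. x \<noteq> 0 \<longrightarrow> 0 < x \<bullet> (N *v x)"
    show "transpose (s *\<^sub>R M + t *\<^sub>R N) = s *\<^sub>R M + t *\<^sub>R N"
      using MN(1,2) by (simp add: transpose_def vec_eq_iff)
    fix x :: "real ^ 'd" assume x: "x \<noteq> 0"
    have "s * (x \<bullet> (M *v x)) + t * (x \<bullet> (N *v x)) > 0"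
    proof (cases "s = 0")
      case True
      then show ?thesis using MN x by simp
    next
      case False
      then show ?thesis using MN x by (intro add_pos_nonneg mult_pos_pos mult_nonneg_nonneg) (auto intro: less_imp_le)
    qed
    then show "0 < x \<bullet> ((s *\<^sub>R M + t *\<^sub>R N) *v x)"
      by (simp add: matrix_vector_mult_add_rdistrib scaleR_matrix_vector_assoc[symmetric] inner_add_right)
  qed
  moreover have "Orb \<subseteq> P"
  proof
    fix N assume "N \<in> Orb"
    then obtain g where N: "N = act g (mat 1)" unfolding Orb_def by auto
    have "transpose N = N" unfolding N act_def by (simp add: matrix_transpose_mul transpose_mat)
    moreover have "0 < x \<bullet> (N *v x)" if "x \<noteq> 0" for x
    proof -
      have "A g x \<noteq> 0"
      proof
        assume "A g x = 0"
        then have "A (- g) (A g x) = 0" using linear_0[OF lin] by simp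
        then show False using that by (simp add: add[symmetric] zero)
      qed
      then show ?thesis unfolding N inner_act by simp
    qed
    ultimately show "N \<in> P" unfolding P_def by simp
  qed
  ultimately have "M \<in> P" using M(1) hull_minimal[of Orb P convex] unfolding C_def by blast
  then have MP: "transpose M = M" "\<And>x. x \<noteq> 0 \<Longrightarrow> 0 < x \<bullet> (M *v x)" unfolding P_def by auto
  define q where "q u v = u \<bullet> (M *v v)" for u v
  have "bilinear q"
    unfolding q_def bilinear_def
    by (auto intro!: linearI simp: inner_add_left inner_add_right matrix_vector_right_distrib
        matrix_vector_mult_scaleR)
  moreover have "q u v = q v u" for u v
    unfolding q_def using MP(1) by (metis dot_lmul_matrix inner_commute transpose_matrix_vector)
  ultimately have "inner_product q" using MP(2) unfolding inner_product_def q_def by blast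
  moreover have "q (A g u) (A g v) = q u v" for g u v
    unfolding q_def inner_act[symmetric] fixed ..
  ultimately show ?thesis by blast
qed

section \<open>The Killing form of a compact simple Lie group\<close>

locale compact_simple_lie_chart = lie_chart \<A> U c
  for \<A> :: "('f::{group_add, t2_space, second_countable_topology}, real ^ 'd) chart set"
    and U :: "'f set" and c :: "'f \<Rightarrow> real ^ 'd" +
  assumes compact_F: "compact (UNIV :: 'f set)" and simple_br: "simple_bracket br"
begin

abbreviation mk :: "(real ^ 'd) form" where "mk \<equiv> minus_killing br"

lemma linear_br: "linear (br x)" "linear (\<lambda>x. br x y)"
  using bilinear_br unfolding bilinear_def by simp_all

text \<open>The centre is an ideal, and it is not the whole algebra because some bracket is nonzero;
  simplicity leaves only zero.\<close>

lemma br_center: "br x = (\<lambda>y. 0) \<Longrightarrow> x = 0"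
proof -
  assume x: "br x = (\<lambda>y. 0)"
  let ?Z = "{z. \<forall>y. br z y = 0}"
  have "subspace ?Z"
    by (rule subspaceI) (simp_all add: linear_0[OF linear_br(2)] linear_add[OF linear_br(2)] linear_scale[OF linear_br(2)])
  moreover have "br w z \<in> ?Z" if "z \<in> ?Z" for w z
    using that br_antisym[of w z] linear_0[OF linear_br(2)] by simp
  ultimately have "?Z = {0} \<or> ?Z = UNIV" using simple_br unfolding simple_bracket_def by blast
  moreover have "?Z \<noteq> UNIV" using simple_br unfolding simple_bracket_def by blast
  ultimately have "?Z = {0}" by blast
  moreover have "x \<in> ?Z" using x by simp
  ultimately show "x = 0" by blast
qed

lemma linear_br_br: "linear (\<lambda>z. br x (br y z))"
  using linear_compose[OF linear_br(1) linear_br(1)] by (simp add: o_def)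

text \<open>ad (Ad g x) is the conjugate of ad x by Ad g, and the trace is invariant under
  conjugation.\<close>

lemma mk_Ad: "mk (Ad g x) (Ad g y) = mk x y"
proof -
  have eq: "br (Ad g x) (br (Ad g y) z) = Ad g (br x (br y (Ad (- g) z)))" for z
    by (simp add: Ad_br)
  have l: "linear (\<lambda>z. br x (br y (Ad (- g) z)))"
    using linear_compose[OF linear_Ad linear_br_br] by (simp add: o_def)
  show ?thesis
    unfolding minus_killing_def eq lin_trace_commute[OF linear_Ad l] by simp
qed

lemma bilinear_mk: "bilinear mk"
  unfolding bilinear_def minus_killing_def lin_trace_def
  by (auto intro!: linearI simp: linear_add[OF linear_br(1)] linear_scale[OF linear_br(1)]
      linear_add[OF linear_br(2)] linear_scale[OF linear_br(2)] inner_add_left sum.distrib sum_distrib_left)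

text \<open>Usually derived from the Jacobi identity; here it is the derivative of the invariance
  under \<open>Ad\<close>.\<close>

lemma mk_br: "mk (br x u) v + mk u (br x v) = 0"
  by (rule Ad_invariant_imp_br_invariant[OF bilinear_mk mk_Ad])

text \<open>For an inner product q invariant under the compact group every ad x is skew, so minus
  the trace of its square is a sum of squares, which vanishes for central x only.\<close>

lemma inner_product_mk: "inner_product mk"
proof -
  obtain q where q: "inner_product q" "\<And>g u v. q (Ad g u) (Ad g v) = q u v"
    using compact_group_invariant_inner_product[OF compact_F linear_Ad continuous_Ad Ad_add Ad_zero] by blast
  have qbr: "q (br x u) v + q u (br x v) = 0" for x u v
    using q by (intro Ad_invariant_imp_br_invariant) (auto simp: inner_product_def)
  obtain E where E: "orthonormal_frame q E (\<lambda>x. x)" using orthonormal_frame_exists[OF q(1)] by blast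
  have mkxx: "mk x x = (\<Sum>e\<in>E. q (br x e) (br x e))" for x
  proof -
    have "q (br x (br x e)) e = - q (br x e) (br x e)" for e using qbr[of x "br x e" e] by linarith
    then show ?thesis
      unfolding minus_killing_def frame_lin_trace[OF q(1) E linear_br_br] by (simp add: sum_negf)
  qed
  have "mk x x > 0" if "x \<noteq> 0" for x
  proof -
    have nonneg: "\<forall>e\<in>E. 0 \<le> q (br x e) (br x e)" using inner_product_nonneg[OF q(1)] by blast
    have "mk x x \<noteq> 0"
    proof
      assume "mk x x = 0"
      then have "\<forall>e\<in>E. q (br x e) (br x e) = 0"
        using E nonneg unfolding mkxx orthonormal_frame_def by (subst (asm) sum_nonneg_eq_0_iff) auto
      then have "br x e = 0" if "e \<in> E" for e using that inner_product_eq_zero[OF q(1)] by blast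
      then have "br x y = 0" for y using frame_expand_linear[OF E linear_br(1), of x y] by simp
      then show False using br_center that by blast
    qed
    then show ?thesis using nonneg unfolding mkxx by (simp add: sum_nonneg order_less_le)
  qed
  moreover have "mk x y = mk y x" for x y
    unfolding minus_killing_def using lin_trace_commute[OF linear_br(1) linear_br(1)] by simp
  ultimately show ?thesis using bilinear_mk unfolding inner_product_def by blast
qed

text \<open>ad x is skew with respect to \<open>mk\<close>, hence traceless. This is the
  unimodularity that the curvature formulas assume.\<close>

lemma lin_trace_br: "lin_trace (br x) = 0"
proof -
  obtain E where E: "orthonormal_frame mk E (\<lambda>x. x)" using orthonormal_frame_exists[OF inner_product_mk] by blast
  have "mk (br x e) e = 0" for e
    using mk_br[of x e e] inner_product_commute[OF inner_product_mk, of e "br x e"] by simp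
  then show ?thesis unfolding frame_lin_trace[OF inner_product_mk E linear_br(1)] by simp
qed

end

section \<open>The curvature of left-invariant metrics on unimodular groups\<close>

lemma inner_product_ext:
  assumes "inner_product b" "\<And>z. b x z = b y z"
  shows "x = y"
proof -
  have "b (x - y) (x - y) = 0"
    using assms(2) by (simp add: linear_diff[OF inner_product_linear(2)[OF assms(1)]])
  then show ?thesis using inner_product_eq_zero[OF assms(1)] by simp
qed

lemma sum_antisymmetric:
  fixes K :: "'i \<Rightarrow> 'i \<Rightarrow> real"
  assumes "\<And>a c. K c a = - K a c"
  shows "(\<Sum>a\<in>I. \<Sum>c\<in>I. K a c) = 0"
proof -
  have "(\<Sum>a\<in>I. \<Sum>c\<in>I. K a c) = (\<Sum>a\<in>I. \<Sum>c\<in>I. K c a)" by (rule sum.swap)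
  also have "\<dots> = - (\<Sum>a\<in>I. \<Sum>c\<in>I. K a c)" by (subst assms) (simp add: sum_negf)
  finally show ?thesis by simp
qed

locale unimodular_bracket =
  fixes br :: "'a::euclidean_space bracket"
  assumes bilinear: "bilinear br" and antisym: "\<And>x y. br y x = - br x y"
    and unimodular: "\<And>x. lin_trace (br x) = 0"
begin

lemma linear_bracket: "linear (br x)" "linear (\<lambda>x. br x y)"
  using bilinear unfolding bilinear_def by simp_all

lemma bracket_self [simp]: "br x x = 0"
  using antisym[of x x] by (simp add: eq_neg_iff_add_eq_0 flip: scaleR_2)

lemmas bracket_simps = linear_add[OF linear_bracket(1)] linear_add[OF linear_bracket(2)]
  linear_scale[OF linear_bracket(1)] linear_scale[OF linear_bracket(2)]

context
  fixes b :: "'a form"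
  assumes ip: "inner_product b"
begin

lemmas linear_b = inner_product_linear[OF ip]
lemmas b_simps = linear_add[OF linear_b(1)] linear_add[OF linear_b(2)]
  linear_scale[OF linear_b(1)] linear_scale[OF linear_b(2)]
  linear_diff[OF linear_b(1)] linear_diff[OF linear_b(2)]
  linear_neg[OF linear_b(1)] linear_neg[OF linear_b(2)]

lemma levi_civita_works:
  "b (levi_civita br b x y) z = (b (br x y) z - b (br y z) x + b (br z x) y) / 2"
  unfolding levi_civita_def
  by (rule sharp_works[OF ip, of "\<lambda>z. (b (br x y) z - b (br y z) x + b (br z x) y) / 2"])
    (rule linearI, simp_all add: bracket_simps b_simps field_simps)

lemma linear_levi_civita: "linear (\<lambda>x. levi_civita br b x y)" "linear (levi_civita br b x)"
proof -
  show "linear (\<lambda>x. levi_civita br b x y)"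
    by (rule linearI; rule inner_product_ext[OF ip])
      (simp_all add: b_simps levi_civita_works bracket_simps field_simps)
  show "linear (levi_civita br b x)"
    by (rule linearI; rule inner_product_ext[OF ip])
      (simp_all add: b_simps levi_civita_works bracket_simps field_simps)
qed

text \<open>Compatibility of the connection with the metric: inner products of left-invariant fields
  are constant, so no derivative term appears.\<close>

lemma levi_civita_skew: "b (levi_civita br b x y) z = - b (levi_civita br b x z) y"
proof -
  have "br z y = - br y z" "br y x = - br x y" "br z x = - br x z" by (rule antisym)+
  then show ?thesis unfolding levi_civita_works by (simp add: b_simps field_simps)
qed

context
  fixes I :: "'i set" and e :: "'i \<Rightarrow> 'a"
  assumes frame: "orthonormal_frame b I e"
begin

lemma killing_frame:
  "minus_killing br y z = - (\<Sum>a\<in>I. \<Sum>c\<in>I. b (br y (e a)) (e c) * b (br z (e c)) (e a))"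
proof -
  have l: "linear (\<lambda>x. br y (br z x))"
    using linear_compose[OF linear_bracket(1) linear_bracket(1)] by (simp add: o_def)
  have "b (br y (br z (e c))) (e c) = (\<Sum>a\<in>I. b (br y (e a)) (e c) * b (br z (e c)) (e a))" for c
    using frame_expand_linear[OF frame linear_bracket(1), of y "br z (e c)"]
    by (simp add: linear_sum[OF linear_b(2)] linear_scale[OF linear_b(2)] mult.commute)
  then show ?thesis
    unfolding minus_killing_def frame_lin_trace[OF ip frame l]
    by simp (rule sum.swap)
qed

text \<open>The classical formula for unimodular groups. The Koszul formula expands the trace of the
  curvature into quadratic expressions in the structure constants; they match the claimed ones only
  after summation over both frame indices.\<close>

lemma ricci_frame:
  "ricci br b y z = - (\<Sum>a\<in>I. b (br y (e a)) (br z (e a))) / 2 + minus_killing br y z / 2 +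
     (\<Sum>a\<in>I. \<Sum>c\<in>I. b (br (e a) (e c)) y * b (br (e a) (e c)) z) / 4"
proof -
  let ?D = "levi_civita br b"
  define Y Z where "Y a c = b (br y (e a)) (e c)" and "Z a c = b (br z (e a)) (e c)" for a c
  define \<eta> \<zeta> where "\<eta> a c = b (br (e a) (e c)) y" and "\<zeta> a c = b (br (e a) (e c)) z" for a c
  have anti: "\<eta> c a = - \<eta> a c" "\<zeta> c a = - \<zeta> a c" for a c
    unfolding \<eta>_def \<zeta>_def by (subst antisym, simp add: b_simps)+
  have comm: "b u v = b v u" for u v by (rule inner_product_commute[OF ip])
  have "linear (\<lambda>x. riemann br b x y z)"
    unfolding riemann_def Let_def
    by (intro linear_compose_sub linear_levi_civita linear_compose[unfolded o_def, OF linear_levi_civita(1) linear_levi_civita(2)]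
        linear_compose[unfolded o_def, OF linear_bracket(2) linear_levi_civita(1)])
  then have "ricci br b y z = (\<Sum>a\<in>I. b (riemann br b (e a) y z) (e a))"
    unfolding ricci_def by (rule frame_lin_trace[OF ip frame])
  also have "\<dots> = (\<Sum>a\<in>I. b (?D (e a) (?D y z)) (e a)) - (\<Sum>a\<in>I. b (?D y (?D (e a) z)) (e a))
      - (\<Sum>a\<in>I. b (?D (br (e a) y) z) (e a))"
    by (simp add: riemann_def Let_def b_simps sum_subtractf)
  \<comment> \<open>The divergence of a left-invariant field w is minus the trace of ad w, which
    unimodularity makes zero.\<close>
  also have "(\<Sum>a\<in>I. b (?D (e a) (?D y z)) (e a)) = 0"
  proof -
    have "b (?D (e a) w) (e a) = - b (br w (e a)) (e a)" for a w
      unfolding levi_civita_works using antisym[of "e a" w] by (simp add: b_simps linear_0[OF linear_b(2)])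
    then show ?thesis
      using unimodular[of "?D y z"] unfolding frame_lin_trace[OF ip frame linear_bracket(1)]
      by (simp add: sum_negf)
  qed
  also have "(\<Sum>a\<in>I. b (?D y (?D (e a) z)) (e a)) =
      - (\<Sum>a\<in>I. \<Sum>c\<in>I. (- Z a c - Z c a - \<zeta> a c) / 2 * ((Y a c - \<eta> a c - Y c a) / 2))"
  proof -
    have "b (?D y (?D (e a) z)) (e a) = - b (?D (e a) z) (?D y (e a))" for a
      by (subst levi_civita_skew) (simp add: comm)
    moreover have "b (?D (e a) z) (e c) = (- Z a c - Z c a - \<zeta> a c) / 2" for a c
      unfolding levi_civita_works using antisym[of "e a" z] antisym[of "e c" "e a"]
      by (simp add: Z_def \<zeta>_def b_simps)
    moreover have "b (?D y (e a)) (e c) = (Y a c - \<eta> a c - Y c a) / 2" for a c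
      unfolding levi_civita_works using antisym[of "e c" y]
      by (simp add: Y_def \<eta>_def b_simps)
    moreover have "b (?D (e a) z) (?D y (e a)) = (\<Sum>c\<in>I. b (?D (e a) z) (e c) * b (?D y (e a)) (e c))" for a
      by (rule frame_parseval[OF ip frame])
    ultimately show ?thesis by (simp only: sum_negf)
  qed
  also have "(\<Sum>a\<in>I. b (?D (br (e a) y) z) (e a)) =
      (\<Sum>a\<in>I. \<Sum>c\<in>I. - Y a c * ((- Z c a - Z a c + \<zeta> a c) / 2))"
  proof -
    have "b (?D (e c) z) (e a) = (- Z c a - Z a c + \<zeta> a c) / 2" for a c
      unfolding levi_civita_works using antisym[of "e c" z]
      by (simp add: Z_def \<zeta>_def b_simps)
    moreover have "b (br (e a) y) (e c) = - Y a c" for a c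
      using antisym[of "e a" y] by (simp add: Y_def b_simps)
    moreover have "b (?D (br (e a) y) z) (e a) = (\<Sum>c\<in>I. b (br (e a) y) (e c) * b (?D (e c) z) (e a))" for a
      using frame_expand_linear[OF frame linear_levi_civita(1), of "br (e a) y" z]
      by (simp add: linear_sum[OF linear_b(2)] linear_scale[OF linear_b(2)])
    ultimately show ?thesis by (simp only:)
  qed
  finally have 1: "ricci br b y z =
      (\<Sum>a\<in>I. \<Sum>c\<in>I. (- Z a c - Z c a - \<zeta> a c) / 2 * ((Y a c - \<eta> a c - Y c a) / 2)
        + Y a c * ((- Z c a - Z a c + \<zeta> a c) / 2))"
    by (simp add: sum.distrib sum_negf)
  \<comment> \<open>The two summands differ by an expression that changes sign when the indices are
    exchanged, so the difference cancels in the double sum.\<close>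
  have 2: "(\<Sum>a\<in>I. \<Sum>c\<in>I. ((- Z a c - Z c a - \<zeta> a c) / 2 * ((Y a c - \<eta> a c - Y c a) / 2)
        + Y a c * ((- Z c a - Z a c + \<zeta> a c) / 2))
        - (- (Y a c * Z a c) / 2 - (Y a c * Z c a) / 2 + (\<eta> a c * \<zeta> a c) / 4)) = 0"
  proof (rule sum_antisymmetric)
    fix a c
    have e: "\<eta> c a = - \<eta> a c" "\<zeta> c a = - \<zeta> a c" by (rule anti)+
    show "(- Z c a - Z a c - \<zeta> c a) / 2 * ((Y c a - \<eta> c a - Y a c) / 2)
        + Y c a * ((- Z a c - Z c a + \<zeta> c a) / 2)
        - (- (Y c a * Z c a) / 2 - (Y c a * Z a c) / 2 + (\<eta> c a * \<zeta> c a) / 4) =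
      - ((- Z a c - Z c a - \<zeta> a c) / 2 * ((Y a c - \<eta> a c - Y c a) / 2)
        + Y a c * ((- Z c a - Z a c + \<zeta> a c) / 2)
        - (- (Y a c * Z a c) / 2 - (Y a c * Z c a) / 2 + (\<eta> a c * \<zeta> a c) / 4))"
      unfolding e by (simp add: field_simps)
  qed
  have 3: "ricci br b y z = (\<Sum>a\<in>I. \<Sum>c\<in>I. - (Y a c * Z a c) / 2 - (Y a c * Z c a) / 2 + (\<eta> a c * \<zeta> a c) / 4)"
    using 2 unfolding 1 by (simp only: sum_subtractf)
  have "(\<Sum>a\<in>I. \<Sum>c\<in>I. Y a c * Z a c) = (\<Sum>a\<in>I. b (br y (e a)) (br z (e a)))"
    unfolding Y_def Z_def frame_parseval[OF ip frame, of "br y _" "br z _"] ..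
  moreover have "(\<Sum>a\<in>I. \<Sum>c\<in>I. Y a c * Z c a) = - minus_killing br y z"
    unfolding Y_def Z_def killing_frame by simp
  moreover have "ricci br b y z = - (\<Sum>a\<in>I. \<Sum>c\<in>I. Y a c * Z a c) / 2 - (\<Sum>a\<in>I. \<Sum>c\<in>I. Y a c * Z c a) / 2
      + (\<Sum>a\<in>I. \<Sum>c\<in>I. \<eta> a c * \<zeta> a c) / 4"
    unfolding 3 by (simp only: sum.distrib sum_subtractf sum_negf flip: sum_divide_distrib)
  ultimately show ?thesis unfolding \<eta>_def \<zeta>_def by simp
qed

lemma linear_ricci: "linear (ricci br b y)" "linear (\<lambda>y. ricci br b y z)"
proof -
  have mk: "linear (minus_killing br y)" "linear (\<lambda>y. minus_killing br y z)" for y z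
    unfolding killing_frame
    by (auto intro!: linearI simp: bracket_simps b_simps distrib_left distrib_right sum.distrib
        sum_distrib_left mult_ac)
  have l1: "linear (\<lambda>z. \<Sum>a\<in>I. b (br y (e a)) (br z (e a)))"
    "linear (\<lambda>y. \<Sum>a\<in>I. b (br y (e a)) (br z (e a)))"
    by (intro linear_compose_sum ballI linear_compose[unfolded o_def, OF linear_bracket(2) linear_b(1)]
        linear_compose[unfolded o_def, OF linear_bracket(2) linear_b(2)])+
  have l2: "linear (\<lambda>z. \<Sum>a\<in>I. \<Sum>c\<in>I. b (br (e a) (e c)) y * b (br (e a) (e c)) z)"
    "linear (\<lambda>y. \<Sum>a\<in>I. \<Sum>c\<in>I. b (br (e a) (e c)) y * b (br (e a) (e c)) z)"
    by (intro linear_compose_sum ballI, rule linearI, simp_all add: b_simps algebra_simps)+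
  show "linear (ricci br b y)"
    unfolding ricci_frame
    by (rule linearI) (simp_all only: linear_add[OF mk(1)] linear_scale[OF mk(1)]
        linear_add[OF l1(1)] linear_scale[OF l1(1)] linear_add[OF l2(1)] linear_scale[OF l2(1)],
        simp_all add: field_simps)
  show "linear (\<lambda>y. ricci br b y z)"
    unfolding ricci_frame
    by (rule linearI) (simp_all only: linear_add[OF mk(2)] linear_scale[OF mk(2)]
        linear_add[OF l1(2)] linear_scale[OF l1(2)] linear_add[OF l2(2)] linear_scale[OF l2(2)],
        simp_all add: field_simps)
qed

text \<open>The trace of \<open>ricci_frame\<close>: by Parseval its first and last terms give the
  same sum of squares, with total coefficient -1/2 + 1/4 = -1/4.\<close>

lemma scalar_curvature_frame:
  "scalar_curvature br b = - (\<Sum>a\<in>I. \<Sum>c\<in>I. b (br (e a) (e c)) (br (e a) (e c))) / 4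
     + (\<Sum>a\<in>I. minus_killing br (e a) (e a)) / 2"
proof -
  have works: "b (sharp b (ricci br b x)) z = ricci br b x z" for x z
    by (rule sharp_works[OF ip linear_ricci(1)])
  have "linear (\<lambda>x. sharp b (ricci br b x))"
    by (rule linearI; rule inner_product_ext[OF ip])
      (simp_all add: b_simps works linear_add[OF linear_ricci(2)] linear_scale[OF linear_ricci(2)])
  then have "scalar_curvature br b = (\<Sum>d\<in>I. ricci br b (e d) (e d))"
    unfolding scalar_curvature_def by (simp add: frame_lin_trace[OF ip frame] works)
  also have "\<dots> = - (\<Sum>d\<in>I. \<Sum>a\<in>I. b (br (e d) (e a)) (br (e d) (e a))) / 2
      + (\<Sum>d\<in>I. minus_killing br (e d) (e d)) / 2
      + (\<Sum>d\<in>I. \<Sum>a\<in>I. \<Sum>c\<in>I. b (br (e a) (e c)) (e d) * b (br (e a) (e c)) (e d)) / 4"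
    unfolding ricci_frame by (simp only: sum.distrib sum_negf flip: sum_divide_distrib)
  also have "(\<Sum>d\<in>I. \<Sum>a\<in>I. \<Sum>c\<in>I. b (br (e a) (e c)) (e d) * b (br (e a) (e c)) (e d)) =
      (\<Sum>a\<in>I. \<Sum>c\<in>I. b (br (e a) (e c)) (br (e a) (e c)))"
    unfolding frame_parseval[OF ip frame, of "br _ _" "br _ _"]
    by (subst sum.swap) (intro sum.cong refl sum.swap)
  finally show ?thesis by (simp add: field_simps)
qed

end

end

end

section \<open>Einstein metrics are critical\<close>

lemma det_has_derivative:
  fixes G :: "real \<Rightarrow> real ^ 'i ^ 'i"
  assumes "\<And>i j. ((\<lambda>t. G t $ i $ j) has_real_derivative D i j) (at x)"
  shows "((\<lambda>t. det (G t)) has_real_derivative (\<Sum>p | p permutes (UNIV :: 'i set).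
    of_int (sign p) * (\<Sum>i\<in>UNIV. D i (p i) * (\<Prod>j\<in>UNIV - {i}. G x $ j $ p j)))) (at x)"
  unfolding det_def by (intro DERIV_sum DERIV_cmult has_field_derivative_prod assms)

lemma det_differentiable:
  fixes G :: "real \<Rightarrow> real ^ 'i ^ 'i"
  assumes "\<And>i j. (\<lambda>t. G t $ i $ j) differentiable (at x)"
  shows "(\<lambda>t. det (G t)) differentiable (at x)"
proof -
  have "\<exists>D. \<forall>i j. ((\<lambda>t. G t $ i $ j) has_real_derivative D i j) (at x)"
    using assms unfolding real_differentiable_def by metis
  then obtain D where "\<And>i j. ((\<lambda>t. G t $ i $ j) has_real_derivative D i j) (at x)" by blast
  from det_has_derivative[OF this] show ?thesis unfolding real_differentiable_def by blast
qed

text \<open>A term of the Leibniz expansion survives differentiation only if its permutation fixes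
  all indices but at most one, hence all of them; what remains is the trace.\<close>

lemma det_derivative_at_identity:
  fixes G :: "real \<Rightarrow> real ^ 'i ^ 'i"
  assumes "G x = mat 1" "\<And>i j. ((\<lambda>t. G t $ i $ j) has_real_derivative D i j) (at x)"
  shows "((\<lambda>t. det (G t)) has_real_derivative (\<Sum>i\<in>UNIV. D i i)) (at x)"
proof -
  let ?P = "{p. p permutes (UNIV :: 'i set)}"
  let ?T = "\<lambda>p. of_int (sign p) * (\<Sum>i\<in>UNIV. D i (p i) * (\<Prod>j\<in>UNIV - {i}. G x $ j $ p j))"
  have 1: "((\<lambda>t. det (G t)) has_real_derivative (\<Sum>p\<in>?P. ?T p)) (at x)"
    by (rule det_has_derivative[OF assms(2)])
  have zero: "?T p = 0" if "p \<in> ?P" "p \<noteq> id" for p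
  proof -
    have "(\<Prod>j\<in>UNIV - {i}. G x $ j $ p j) = 0" for i
    proof (rule ccontr)
      assume "\<not> ?thesis"
      then have ne: "\<forall>j\<in>UNIV - {i}. G x $ j $ p j \<noteq> 0" by (simp add: prod_zero_iff)
      have j: "p j = j" if "j \<noteq> i" for j
        using ne that by (auto simp: assms(1) mat_def split: if_splits)
      have "p i = i"
      proof (rule ccontr)
        assume "p i \<noteq> i"
        then have "p (p i) = p i" by (rule j)
        then have "p i = i" using that(1) permutes_inj by (metis injD mem_Collect_eq)
        then show False using \<open>p i \<noteq> i\<close> by simp
      qed
      then have "p = id" using j by (metis eq_id_iff)
      then show False using that(2) by simp
    qed
    then show ?thesis by (simp only: mult_zero_right sum.neutral_const)
  qed
  have "(\<Sum>p\<in>?P. ?T p) = (\<Sum>p\<in>{id}. ?T p)"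
    using zero by (intro sum.mono_neutral_right) (auto simp: permutes_id finite_permutations)
  also have "\<dots> = (\<Sum>i\<in>UNIV. D i i)"
    by (simp add: assms(1) mat_def sign_id)
  finally show ?thesis using 1 by simp
qed

text \<open>By Cramer's rule the entries of the inverse are quotients of determinants, and here the
  denominator is 1.\<close>

lemma right_inverse_differentiable:
  fixes G H :: "real \<Rightarrow> real ^ 'i ^ 'i"
  assumes "\<And>i j. (\<lambda>t. G t $ i $ j) differentiable (at x)"
    "\<And>t. det (G t) = 1" "\<And>t. G t ** H t = mat 1"
  shows "(\<lambda>t. H t $ i $ j) differentiable (at x)"
proof -
  define N where "N t = (\<chi> k l. if l = i then (if k = j then 1 else 0) else G t $ k $ l)" for t
  have "H t $ i $ j = det (N t)" for t
  proof -
    have "G t *v column j (H t) = axis j 1"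
      using assms(3)[of t]
      by (simp add: vec_eq_iff matrix_vector_mult_def matrix_matrix_mult_def column_def mat_def axis_def)
    then have "column j (H t) = (\<chi> k. det (\<chi> i' l. if l = k then axis j 1 $ i' else G t $ i' $ l) / det (G t))"
      using cramer[of "G t"] assms(2) by simp
    then have "column j (H t) $ i = det (\<chi> i' l. if l = i then axis j 1 $ i' else G t $ i' $ l)"
      using assms(2) by simp
    then show ?thesis by (simp add: column_def N_def axis_def cong: if_cong)
  qed
  moreover have "(\<lambda>t. det (N t)) differentiable (at x)"
  proof (rule det_differentiable)
    show "(\<lambda>t. N t $ k $ l) differentiable (at x)" for k l
      using assms(1)[of k l] by (cases "l = i"; cases "k = j") (simp_all add: N_def)
  qed
  ultimately show ?thesis by simp
qed

lemma sum_rotate: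
  "(\<Sum>l\<in>A. \<Sum>p\<in>B. \<Sum>q\<in>C. f l p q) = (\<Sum>p\<in>B. \<Sum>q\<in>C. \<Sum>l\<in>A. f l p q)"
proof -
  have "(\<Sum>l\<in>A. \<Sum>p\<in>B. \<Sum>q\<in>C. f l p q) = (\<Sum>p\<in>B. \<Sum>l\<in>A. \<Sum>q\<in>C. f l p q)"
    by (rule sum.swap)
  also have "\<dots> = (\<Sum>p\<in>B. \<Sum>q\<in>C. \<Sum>l\<in>A. f l p q)"
    by (rule sum.cong[OF refl sum.swap])
  finally show ?thesis .
qed

lemma frame_expand_real:
  assumes "orthonormal_frame b I e" "linear (f :: 'a::real_vector \<Rightarrow> real)"
  shows "(\<Sum>i\<in>I. b x (e i) * f (e i)) = f x"
  using frame_expand_linear[OF assms, of x] unfolding real_scaleR_def by (rule sym)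

text \<open>Rewrites a trace over vectors \<open>E\<close> in a fixed frame with a coefficient
  matrix. Orthonormal frames of a varying metric need not depend differentiably on the parameter,
  but for them this matrix does.\<close>

lemma frame_sum_bilinear:
  fixes e :: "'i::finite \<Rightarrow> 'a::euclidean_space"
  assumes "orthonormal_frame b0 UNIV e" "bilinear \<beta>"
  shows "(\<Sum>a\<in>E. \<beta> a a) = (\<Sum>i\<in>UNIV. \<Sum>j\<in>UNIV. (\<Sum>a\<in>E. b0 a (e i) * b0 a (e j)) * (\<beta> (e i) (e j) :: real))"
proof -
  have lin: "linear (\<beta> x)" "linear (\<lambda>x. \<beta> x y)" for x y
    using assms(2) unfolding bilinear_def by auto
  have "\<beta> a a = (\<Sum>i\<in>UNIV. \<Sum>j\<in>UNIV. b0 a (e i) * b0 a (e j) * \<beta> (e i) (e j))" for a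
  proof -
    have 1: "\<beta> a a = (\<Sum>i\<in>UNIV. b0 a (e i) * \<beta> (e i) a)"
      by (rule frame_expand_real[OF assms(1) lin(2), symmetric])
    have 2: "\<beta> (e i) a = (\<Sum>j\<in>UNIV. b0 a (e j) * \<beta> (e i) (e j))" for i
      by (rule frame_expand_real[OF assms(1) lin(1), symmetric])
    show ?thesis by (subst 1, subst 2) (simp add: sum_distrib_left mult.assoc)
  qed
  then have "(\<Sum>a\<in>E. \<beta> a a) = (\<Sum>a\<in>E. \<Sum>i\<in>UNIV. \<Sum>j\<in>UNIV. b0 a (e i) * b0 a (e j) * \<beta> (e i) (e j))"
    by simp
  also have "\<dots> = (\<Sum>i\<in>UNIV. \<Sum>j\<in>UNIV. \<Sum>a\<in>E. b0 a (e i) * b0 a (e j) * \<beta> (e i) (e j))"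
    by (rule sum_rotate)
  finally show ?thesis by (simp add: sum_distrib_right)
qed

context unimodular_bracket
begin

text \<open>With h the velocity of the metric at 0 in the frame e, the derivative of the scalar
  curvature is minus the sum of \<open>h i j * ricci br (\<gamma> 0) (e i) (e j)\<close>. For an
  Einstein metric this is -r times the trace of h, and the trace vanishes because the volume is
  constant.\<close>

theorem einstein_imp_critical:
  fixes e :: "'i::finite \<Rightarrow> 'a" and \<gamma> :: "real \<Rightarrow> 'a form"
  assumes ip: "\<And>t. inner_product (\<gamma> t)"
    and frame: "orthonormal_frame (\<gamma> 0) UNIV e"
    and diff: "\<And>u v. (\<lambda>t. \<gamma> t u v) differentiable (at 0)"
    and vol: "\<And>t. det (\<chi> i j. \<gamma> t (e i) (e j)) = 1"
    and einstein: "\<And>x y. ricci br (\<gamma> 0) x y = r * \<gamma> 0 x y"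
  shows "((\<lambda>t. scalar_curvature br (\<gamma> t)) has_real_derivative 0) (at 0)"
proof -
  let ?b0 = "\<gamma> 0"
  define G where "G t = (\<chi> i j. \<gamma> t (e i) (e j))" for t
  have "\<forall>t. \<exists>E. orthonormal_frame (\<gamma> t) E (\<lambda>x. x)" using orthonormal_frame_exists[OF ip] by blast
  from choice[OF this] obtain E where E: "\<And>t. orthonormal_frame (\<gamma> t) (E t) (\<lambda>x. x)" by blast
  \<comment> \<open>The inverse of the Gram matrix \<open>G t\<close>, as \<open>GH\<close> shows.
    Hence it is differentiable although the frames \<open>E t\<close> are chosen without any
    regularity in t.\<close>
  define H :: "real \<Rightarrow> real ^ 'i ^ 'i"
    where "H t = (\<chi> i j. \<Sum>a\<in>E t. ?b0 a (e i) * ?b0 a (e j))" for t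
  have e0: "?b0 (e i) (e j) = (if i = j then 1 else 0)" for i j
    using frame unfolding orthonormal_frame_def by simp
  have G0: "G 0 = mat 1" by (simp add: G_def e0 mat_def vec_eq_iff)
  have GH: "G t ** H t = mat 1" for t
  proof -
    have "(\<Sum>j\<in>UNIV. \<gamma> t (e i) (e j) * (\<Sum>a\<in>E t. ?b0 a (e j) * ?b0 a (e k))) = ?b0 (e i) (e k)" for i k
    proof -
      have "(\<Sum>j\<in>UNIV. \<gamma> t (e i) (e j) * (\<Sum>a\<in>E t. ?b0 a (e j) * ?b0 a (e k))) =
          (\<Sum>a\<in>E t. (\<Sum>j\<in>UNIV. ?b0 a (e j) * \<gamma> t (e i) (e j)) * ?b0 a (e k))"
        unfolding sum_distrib_left sum_distrib_right by (subst sum.swap) (simp add: mult_ac)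
      also have "\<dots> = (\<Sum>a\<in>E t. \<gamma> t (e i) a * ?b0 a (e k))"
        by (simp only: frame_expand_real[OF frame inner_product_linear(1)[OF ip[of t]]])
      also have "\<dots> = ?b0 (e i) (e k)"
        by (rule frame_expand_real[OF E inner_product_linear(2)[OF ip[of 0]]])
      finally show ?thesis .
    qed
    then show ?thesis by (simp add: vec_eq_iff matrix_matrix_mult_def G_def H_def e0 mat_def)
  qed
  have detG: "det (G t) = 1" for t unfolding G_def by (rule vol)
  have diffG: "(\<lambda>t. G t $ i $ j) differentiable (at 0)" for i j using diff by (simp add: G_def)
  have diffH: "(\<lambda>t. H t $ i $ j) differentiable (at 0)" for i j
    by (rule right_inverse_differentiable[OF diffG detG GH])
  have "\<exists>h. \<forall>i j. ((\<lambda>t. G t $ i $ j) has_real_derivative h i j) (at 0)"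
    using diffG unfolding real_differentiable_def by metis
  then obtain h where h: "\<And>i j. ((\<lambda>t. G t $ i $ j) has_real_derivative h i j) (at 0)" by blast
  have "\<exists>k. \<forall>i j. ((\<lambda>t. H t $ i $ j) has_real_derivative k i j) (at 0)"
    using diffH unfolding real_differentiable_def by metis
  then obtain k where k: "\<And>i j. ((\<lambda>t. H t $ i $ j) has_real_derivative k i j) (at 0)" by blast
  have H0: "H 0 $ i $ j = (if i = j then 1 else 0)" for i j
  proof -
    have "H 0 = mat 1" using GH[of 0] unfolding G0 by simp
    then show ?thesis by (simp add: mat_def)
  qed
  have G0': "G 0 $ i $ j = (if i = j then 1 else 0)" for i j
    by (simp add: G0 mat_def)
  \<comment> \<open>The product of \<open>G t\<close> and \<open>H t\<close> has derivative zero,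
    and both factors are the identity at 0.\<close>
  have kh: "k i j = - h i j" for i j
  proof -
    have "((\<lambda>t. \<Sum>l\<in>UNIV. G t $ i $ l * H t $ l $ j) has_real_derivative
        (\<Sum>l\<in>UNIV. h i l * H 0 $ l $ j + k l j * G 0 $ i $ l)) (at 0)"
      by (intro DERIV_sum DERIV_mult h k)
    moreover have "(\<Sum>l\<in>UNIV. G t $ i $ l * H t $ l $ j) = (mat 1 :: real ^ 'i ^ 'i) $ i $ j" for t
      unfolding GH[of t, symmetric] by (simp add: matrix_matrix_mult_def)
    ultimately have "(\<Sum>l\<in>UNIV. h i l * H 0 $ l $ j + k l j * G 0 $ i $ l) = 0"
      using DERIV_unique[OF _ DERIV_const] by simp
    then show ?thesis by (simp add: sum.distrib H0 G0' mult_delta_right)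
  qed
  have tr: "(\<Sum>i\<in>UNIV. h i i) = 0"
    using DERIV_unique[OF det_derivative_at_identity[OF G0 h, unfolded detG] DERIV_const] .
  define coef where "coef u i = ?b0 u (e i)" for u i
  define C where "C i j l = coef (br (e i) (e j)) l" for i j l
  have expand: "\<gamma> t u v = (\<Sum>p\<in>UNIV. \<Sum>q\<in>UNIV. coef u p * coef v q * G t $ p $ q)" for t u v
  proof -
    have 1: "\<gamma> t u v = (\<Sum>p\<in>UNIV. coef u p * \<gamma> t (e p) v)"
      unfolding coef_def by (rule frame_expand_real[OF frame inner_product_linear(2)[OF ip], symmetric])
    have 2: "\<gamma> t (e p) v = (\<Sum>q\<in>UNIV. coef v q * \<gamma> t (e p) (e q))" for p
      unfolding coef_def by (rule frame_expand_real[OF frame inner_product_linear(1)[OF ip], symmetric])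
    show ?thesis by (subst 1, subst 2) (simp add: sum_distrib_left mult.assoc G_def)
  qed
  define g where "g u v = (\<Sum>p\<in>UNIV. \<Sum>q\<in>UNIV. coef u p * coef v q * h p q)" for u v
  have g: "((\<lambda>t. \<gamma> t u v) has_real_derivative g u v) (at 0)" for u v
    unfolding expand g_def by (intro DERIV_sum DERIV_cmult h)
  have bil_mk: "bilinear (minus_killing br)"
    unfolding bilinear_def minus_killing_def lin_trace_def
    by (auto intro!: linearI simp: bracket_simps inner_add_left sum.distrib sum_distrib_left)
  \<comment> \<open>The scalar curvature in the fixed frame: the dependence on t now sits in
    \<open>H t\<close> and \<open>\<gamma> t\<close>, which can be differentiated.\<close>
  have S: "scalar_curvature br (\<gamma> t) =
      - (\<Sum>i\<in>UNIV. \<Sum>j\<in>UNIV. H t $ i $ j * (\<Sum>l\<in>UNIV. \<Sum>m\<in>UNIV. H t $ l $ m * \<gamma> t (br (e i) (e l)) (br (e j) (e m)))) / 4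
      + (\<Sum>i\<in>UNIV. \<Sum>j\<in>UNIV. H t $ i $ j * minus_killing br (e i) (e j)) / 2" for t
  proof -
    have b1: "bilinear (\<lambda>x y. \<gamma> t (br u x) (br v y))" for u v
      unfolding bilinear_def
      by (auto intro!: linearI simp: bracket_simps b_simps[OF ip])
    have b2: "bilinear (\<lambda>x y. \<Sum>c\<in>E t. \<gamma> t (br x c) (br y c))"
      unfolding bilinear_def
      by (auto intro!: linearI simp: bracket_simps b_simps[OF ip] sum.distrib sum_distrib_left)
    have inner: "(\<Sum>c\<in>E t. \<gamma> t (br u c) (br v c)) =
        (\<Sum>l\<in>UNIV. \<Sum>m\<in>UNIV. H t $ l $ m * \<gamma> t (br u (e l)) (br v (e m)))" for u v
      unfolding frame_sum_bilinear[OF frame b1] H_def by simp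
    have outer: "(\<Sum>a\<in>E t. \<Sum>c\<in>E t. \<gamma> t (br a c) (br a c)) =
        (\<Sum>i\<in>UNIV. \<Sum>j\<in>UNIV. H t $ i $ j * (\<Sum>c\<in>E t. \<gamma> t (br (e i) c) (br (e j) c)))"
      unfolding frame_sum_bilinear[OF frame b2] H_def by simp
    have killing: "(\<Sum>a\<in>E t. minus_killing br a a) =
        (\<Sum>i\<in>UNIV. \<Sum>j\<in>UNIV. H t $ i $ j * minus_killing br (e i) (e j))"
      unfolding frame_sum_bilinear[OF frame bil_mk] H_def by simp
    show ?thesis
      unfolding scalar_curvature_frame[OF ip E] outer killing by (simp only: inner)
  qed
  let ?X = "\<lambda>i j l m. ?b0 (br (e i) (e l)) (br (e j) (e m))"
  have "((\<lambda>t. scalar_curvature br (\<gamma> t)) has_real_derivative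
      - (\<Sum>i\<in>UNIV. \<Sum>j\<in>UNIV. k i j * (\<Sum>l\<in>UNIV. \<Sum>m\<in>UNIV. H 0 $ l $ m * ?X i j l m)
          + (\<Sum>l\<in>UNIV. \<Sum>m\<in>UNIV. k l m * ?X i j l m + g (br (e i) (e l)) (br (e j) (e m)) * H 0 $ l $ m) * H 0 $ i $ j) / 4
      + (\<Sum>i\<in>UNIV. \<Sum>j\<in>UNIV. k i j * minus_killing br (e i) (e j)) / 2) (at 0)"
    unfolding S
    by (intro DERIV_add DERIV_cdivide DERIV_minus DERIV_sum DERIV_mult DERIV_cmult_right g k)
  moreover have "- (\<Sum>i\<in>UNIV. \<Sum>j\<in>UNIV. k i j * (\<Sum>l\<in>UNIV. \<Sum>m\<in>UNIV. H 0 $ l $ m * ?X i j l m)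
          + (\<Sum>l\<in>UNIV. \<Sum>m\<in>UNIV. k l m * ?X i j l m + g (br (e i) (e l)) (br (e j) (e m)) * H 0 $ l $ m) * H 0 $ i $ j) / 4
      + (\<Sum>i\<in>UNIV. \<Sum>j\<in>UNIV. k i j * minus_killing br (e i) (e j)) / 2 = 0" (is "?L = 0")
  proof -
    have delta: "(\<Sum>m\<in>UNIV. H 0 $ l $ m * f m) = f l" "(\<Sum>m\<in>UNIV. f m * H 0 $ l $ m) = f l" for l and f :: "'i \<Rightarrow> real"
      by (simp_all add: H0 mult_delta_left mult_delta_right)
    have sw: "(\<Sum>i\<in>UNIV. \<Sum>l\<in>UNIV. \<Sum>m\<in>UNIV. h l m * ?X i i l m) = (\<Sum>l\<in>UNIV. \<Sum>m\<in>UNIV. h l m * (\<Sum>i\<in>UNIV. ?X l m i i))"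
    proof -
      have X: "?X i i l m = ?X l m i i" for i l m
        using antisym[of "e i" "e l"] antisym[of "e i" "e m"] by (simp add: b_simps[OF ip])
      have "(\<Sum>i\<in>UNIV. \<Sum>l\<in>UNIV. \<Sum>m\<in>UNIV. h l m * ?X i i l m) = (\<Sum>l\<in>UNIV. \<Sum>m\<in>UNIV. \<Sum>i\<in>UNIV. h l m * ?X i i l m)"
        by (rule sum_rotate)
      then show ?thesis unfolding X sum_distrib_left .
    qed
    have gg: "(\<Sum>i\<in>UNIV. \<Sum>l\<in>UNIV. g (br (e i) (e l)) (br (e i) (e l))) =
        (\<Sum>p\<in>UNIV. \<Sum>q\<in>UNIV. h p q * (\<Sum>i\<in>UNIV. \<Sum>l\<in>UNIV. C i l p * C i l q))"
    proof -
      have "(\<Sum>i\<in>UNIV. \<Sum>l\<in>UNIV. g (br (e i) (e l)) (br (e i) (e l))) =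
          (\<Sum>i\<in>UNIV. \<Sum>l\<in>UNIV. \<Sum>p\<in>UNIV. \<Sum>q\<in>UNIV. h p q * (C i l p * C i l q))"
        by (simp add: g_def C_def mult_ac)
      also have "\<dots> = (\<Sum>i\<in>UNIV. \<Sum>p\<in>UNIV. \<Sum>q\<in>UNIV. \<Sum>l\<in>UNIV. h p q * (C i l p * C i l q))"
        by (rule sum.cong[OF refl sum_rotate])
      also have "\<dots> = (\<Sum>p\<in>UNIV. \<Sum>q\<in>UNIV. \<Sum>i\<in>UNIV. \<Sum>l\<in>UNIV. h p q * (C i l p * C i l q))"
        by (rule sum_rotate)
      finally show ?thesis by (simp add: sum_distrib_left)
    qed
    \<comment> \<open>With k = -h, the first two sums come from the two inverse Gram factors, the
      third from the metric on the brackets, the last from the Killing term. The first two agree by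
      \<open>sw\<close>, which produces the coefficient 1/2 of the Ricci formula.\<close>
    have "?L = (\<Sum>i\<in>UNIV. \<Sum>j\<in>UNIV. h i j * (\<Sum>l\<in>UNIV. ?X i j l l)) / 4
        + (\<Sum>i\<in>UNIV. \<Sum>l\<in>UNIV. \<Sum>m\<in>UNIV. h l m * ?X i i l m) / 4
        - (\<Sum>i\<in>UNIV. \<Sum>l\<in>UNIV. g (br (e i) (e l)) (br (e i) (e l))) / 4
        - (\<Sum>i\<in>UNIV. \<Sum>j\<in>UNIV. h i j * minus_killing br (e i) (e j)) / 2"
      by (simp only: sum.distrib delta) (simp add: kh sum_negf add_divide_distrib diff_divide_distrib)
    also have "\<dots> = - (\<Sum>i\<in>UNIV. \<Sum>j\<in>UNIV. h i j * (- (\<Sum>l\<in>UNIV. ?X i j l l) / 2 + minus_killing br (e i) (e j) / 2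
        + (\<Sum>p\<in>UNIV. \<Sum>q\<in>UNIV. C p q i * C p q j) / 4))"
      unfolding sw gg
      by (simp add: distrib_left sum.distrib sum_negf sum_subtractf right_diff_distrib flip: sum_divide_distrib)
    also have "\<dots> = - (\<Sum>i\<in>UNIV. \<Sum>j\<in>UNIV. h i j * ricci br ?b0 (e i) (e j))"
      unfolding ricci_frame[OF ip frame] by (simp add: C_def coef_def)
    also have "\<dots> = - r * (\<Sum>i\<in>UNIV. h i i)"
      by (simp add: einstein e0 mult_delta_right sum_distrib_left sum_negf mult.commute)
    finally show ?thesis using tr by simp
  qed
  ultimately show ?thesis by (simp only:)
qed

end

section \<open>The direct power of a Lie algebra\<close>

lemma sum_Basis_vec:
  "(\<Sum>e\<in>(Basis :: ('a::euclidean_space ^ 'n) set). f e) = (\<Sum>i\<in>UNIV. \<Sum>u\<in>Basis. f (axis i u))"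
proof -
  have "bij_betw (\<lambda>(i, u). axis i u) (UNIV \<times> (Basis :: 'a set)) (Basis :: ('a ^ 'n) set)"
    by (auto simp: bij_betw_def inj_on_def Basis_vec_def axis_eq_axis)
  from sum.reindex_bij_betw[OF this, of f] show ?thesis
    by (simp add: sum.cartesian_product split_beta)
qed

lemma lin_trace_componentwise:
  fixes T :: "'n::finite \<Rightarrow> 'a::euclidean_space \<Rightarrow> 'a"
  shows "lin_trace (\<lambda>z :: 'a ^ 'n. \<chi> i. T i (z $ i)) = (\<Sum>i\<in>UNIV. lin_trace (T i))"
  unfolding lin_trace_def sum_Basis_vec by (simp add: inner_axis)

lemma minus_killing_power_bracket:
  "minus_killing (power_bracket br) x y = (\<Sum>i\<in>UNIV. minus_killing br (x $ i) (y $ i))"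
  unfolding minus_killing_def power_bracket_def
  by (simp add: lin_trace_componentwise[of "\<lambda>i z. br (x $ i) (br (y $ i) z)"] sum_negf)

lemma inner_product_minus_killing_power:
  fixes br :: "'a::euclidean_space bracket"
  assumes "inner_product (minus_killing br)"
  shows "inner_product (minus_killing (power_bracket br :: ('a ^ 'n) bracket))"
proof -
  note lin = inner_product_linear[OF assms]
  have "0 < (\<Sum>i\<in>UNIV. minus_killing br (x $ i) (x $ i))" if x: "x \<noteq> 0" for x :: "'a ^ 'n"
  proof -
    obtain i where i: "x $ i \<noteq> 0" using x by (auto simp: vec_eq_iff)
    then have "0 < minus_killing br (x $ i) (x $ i)" using assms unfolding inner_product_def by blast
    then show ?thesis by (rule sum_pos2[of _ i, rotated 2]) (simp_all add: inner_product_nonneg[OF assms])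
  qed
  then show ?thesis
    unfolding inner_product_def bilinear_def minus_killing_power_bracket
    using inner_product_commute[OF assms]
    by (auto intro!: linearI simp: linear_add[OF lin(1)] linear_add[OF lin(2)]
        linear_scale[OF lin(1)] linear_scale[OF lin(2)] sum.distrib sum_distrib_left)
qed

lemma unimodular_power_bracket:
  fixes br :: "'a::euclidean_space bracket"
  assumes "unimodular_bracket br"
  shows "unimodular_bracket (power_bracket br :: ('a ^ 'n) bracket)"
proof -
  interpret unimodular_bracket br by (rule assms)
  show ?thesis
  proof
    show "bilinear (power_bracket br :: ('a ^ 'n) bracket)"
      unfolding bilinear_def power_bracket_def
      by (auto intro!: linearI simp: bracket_simps vec_eq_iff)
    show "power_bracket br y x = - power_bracket br x y" for x y :: "'a ^ 'n"
      by (simp add: power_bracket_def vec_eq_iff) (blast intro: antisym)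
    show "lin_trace (power_bracket br x) = 0" for x :: "'a ^ 'n"
      using lin_trace_componentwise[of "\<lambda>i. br (x $ i)"]
      by (simp add: power_bracket_def[abs_def] unimodular)
  qed
qed

section \<open>Gram matrices\<close>

lemma vec_vec_expand:
  fixes y :: "real ^ 'd ^ 'n"
  shows "(\<Sum>s\<in>UNIV. (y $ fst s $ snd s) *\<^sub>R axis (fst s) (axis (snd s) 1)) = y"
proof -
  have "(\<Sum>s\<in>UNIV. (y $ fst s $ snd s) *\<^sub>R axis (fst s) (axis (snd s) 1)) $ i $ k =
      (\<Sum>s\<in>UNIV. if s = (i, k) then y $ fst s $ snd s else 0)" for i k
    unfolding sum_component by (intro sum.cong) (auto simp: axis_def)
  then show ?thesis by (simp add: vec_eq_iff)
qed

lemma gram_transform: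
  fixes b :: "(real ^ 'd ^ 'n) form" and e :: "'n \<times> 'd \<Rightarrow> real ^ 'd ^ 'n"
  assumes "bilinear b"
  defines "W \<equiv> (\<chi> p s. e p $ fst s $ snd s)"
  shows "(\<chi> p q. b (e p) (e q)) = W ** gram b ** transpose W"
proof -
  have lin: "linear (b x)" "linear (\<lambda>x. b x y)" for x y
    using assms(1) unfolding bilinear_def by simp_all
  let ?\<epsilon> = "\<lambda>s. axis (fst s) (axis (snd s) 1) :: real ^ 'd ^ 'n"
  have ex: "e p = (\<Sum>s\<in>UNIV. (W $ p $ s) *\<^sub>R ?\<epsilon> s)" for p
    using vec_vec_expand[of "e p"] by (simp add: W_def)
  have "b (e p) (e q) = (\<Sum>s\<in>UNIV. \<Sum>r\<in>UNIV. W $ p $ s * gram b $ s $ r * W $ q $ r)" for p q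
  proof -
    have "b (e p) (e q) = (\<Sum>s\<in>UNIV. W $ p $ s * b (?\<epsilon> s) (e q))"
      by (subst ex[of p]) (simp add: linear_sum[OF lin(2)] linear_scale[OF lin(2)])
    also have "\<dots> = (\<Sum>s\<in>UNIV. W $ p $ s * (\<Sum>r\<in>UNIV. W $ q $ r * b (?\<epsilon> s) (?\<epsilon> r)))"
      by (subst ex[of q]) (simp add: linear_sum[OF lin(1)] linear_scale[OF lin(1)])
    finally show ?thesis by (simp add: gram_def sum_distrib_left mult_ac)
  qed
  moreover have "(W ** gram b ** transpose W) $ p $ q = (\<Sum>s\<in>UNIV. \<Sum>r\<in>UNIV. W $ p $ s * gram b $ s $ r * W $ q $ r)" for p q
    unfolding matrix_matrix_mult_def transpose_def
    by (simp add: sum_distrib_right) (rule sum.swap)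
  ultimately show ?thesis by (simp add: vec_eq_iff)
qed

lemma det_gram_nonzero:
  fixes b :: "(real ^ 'd ^ 'n) form"
  assumes "inner_product b"
  shows "det (gram b) \<noteq> 0"
proof -
  note lin = inner_product_linear[OF assms]
  let ?\<epsilon> = "\<lambda>s. axis (fst s) (axis (snd s) 1) :: real ^ 'd ^ 'n"
  have "x = 0" if x: "gram b *v x = 0" for x
  proof -
    define y where "y = (\<Sum>s\<in>UNIV. x $ s *\<^sub>R ?\<epsilon> s)"
    have "b (?\<epsilon> p) y = (gram b *v x) $ p" for p
      by (simp add: y_def linear_sum[OF lin(1)] linear_scale[OF lin(1)] matrix_vector_mult_def gram_def mult.commute)
    then have 0: "b (?\<epsilon> p) y = 0" for p using x by simp
    have "b y y = (\<Sum>s\<in>UNIV. x $ s * b (?\<epsilon> s) y)"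
      by (subst (1) y_def) (simp add: linear_sum[OF lin(2)] linear_scale[OF lin(2)])
    then have "y = 0" using 0 inner_product_eq_zero[OF assms, of y] by simp
    moreover have "y $ i $ k = (\<Sum>s\<in>UNIV. if s = (i, k) then x $ s else 0)" for i k
      unfolding y_def sum_component by (intro sum.cong) (auto simp: axis_def)
    ultimately have "x $ (i, k) = 0" for i k by simp
    then show "x = 0" by (simp add: vec_eq_iff)
  qed
  then show ?thesis
    using matrix_left_invertible_ker[of "gram b"] invertible_left_inverse[of "gram b"] invertible_det_nz[of "gram b"]
    by blast
qed

lemma det_Ints:
  fixes A :: "real ^ 'i ^ 'i"
  assumes "\<And>i j. A $ i $ j \<in> \<int>"
  shows "det A \<in> \<int>"
  unfolding det_def by (intro Ints_sum Ints_mult Ints_prod Ints_of_int assms)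

text \<open>Both determinants are integers and their product is 1, so each is 1 or -1.\<close>

lemma integer_unimodular_det_square:
  fixes A B :: "real ^ 'i ^ 'i"
  assumes "\<And>i j. A $ i $ j \<in> \<int>" "\<And>i j. B $ i $ j \<in> \<int>" "B ** A = mat 1"
  shows "(det A)\<^sup>2 = 1"
proof -
  obtain m n where mn: "det A = of_int m" "det B = of_int n"
    using det_Ints[OF assms(1)] det_Ints[OF assms(2)] by (auto elim!: Ints_cases)
  have "det B * det A = 1" using assms(3) det_mul[of B A] by simp
  then have "n * m = 1" unfolding mn by (metis of_int_eq_1_iff of_int_mult)
  then have "m = 1 \<or> m = - 1" by (metis mult.commute zmult_eq_1_iff)
  then show ?thesis unfolding mn by auto
qed

text \<open>Scaling the form multiplies every row of its Gram matrix by r, and the exponent is the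
  number of rows.\<close>

lemma relative_det_scale:
  fixes b q :: "(real ^ 'd ^ 'n) form"
  shows "relative_det q (\<lambda>u v. r * b u v) = r ^ (CARD('n) * CARD('d)) * relative_det q b"
proof -
  have "gram (\<lambda>u v. r * b u v) = (\<chi> p. r *s (gram b $ p))"
    by (simp add: gram_def vec_eq_iff)
  then have "det (gram (\<lambda>u v. r * b u v)) = r ^ (CARD('n) * CARD('d)) * det (gram b)"
    using det_rows_mul[of "\<lambda>_. r" "\<lambda>p. gram b $ p"] by simp
  then show ?thesis by (simp add: relative_det_def)
qed

section \<open>Forests\<close>

text \<open>\<open>up i\<close> is the path from i to its root, i included. It is a parameter tied
  to the parents by its recursion, and \<open>not_up\<close> rules out cycles; together they make
  \<open>card (up i)\<close> a depth on which induction and termination rest.\<close>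

locale forest =
  fixes par :: "'n::finite \<Rightarrow> 'n option" and up :: "'n \<Rightarrow> 'n set"
  assumes up_rec: "up i = insert i (case par i of None \<Rightarrow> {} | Some j \<Rightarrow> up j)"
    and not_up: "par i = Some j \<Longrightarrow> i \<notin> up j"
begin

lemma up_None: "par i = None \<Longrightarrow> up i = {i}"
  and up_Some: "par i = Some j \<Longrightarrow> up i = insert i (up j)"
  using up_rec[of i] by simp_all

lemma card_up_less: "par i = Some j \<Longrightarrow> card (up j) < card (up i)"
  using up_Some[of i j] not_up[of i j] by (simp add: card_insert_disjoint)

lemma forest_induct [case_names step]:
  assumes "\<And>i. (\<And>j. par i = Some j \<Longrightarrow> P j) \<Longrightarrow> P i"
  shows "P i"
proof (induction "card (up i)" arbitrary: i rule: less_induct)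
  case less
  show ?case by (rule assms) (rule less, rule card_up_less)
qed

lemma up_self: "i \<in> up i"
  using up_rec[of i] by blast

lemma up_trans: "j \<in> up i \<Longrightarrow> up j \<subseteq> up i"
proof (induction i rule: forest_induct)
  case (step i)
  then show ?case by (cases "par i") (auto simp: up_None up_Some)
qed

lemma up_linear: "j \<in> up i \<Longrightarrow> k \<in> up i \<Longrightarrow> j \<in> up k \<or> k \<in> up j"
proof (induction i rule: forest_induct)
  case (step i)
  show ?case
  proof (cases "par i")
    case None
    then show ?thesis using step.prems by (auto simp: up_None up_self)
  next
    case (Some p)
    then have "j = i \<or> j \<in> up p" "k = i \<or> k \<in> up p" using step.prems by (auto simp: up_Some)
    then show ?thesis using step.IH[OF Some] step.prems by blast
  qed
qed

lemma up_antisym: "j \<in> up i \<Longrightarrow> i \<in> up j \<Longrightarrow> i = j"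
proof (rule ccontr)
  assume ij: "j \<in> up i" "i \<in> up j" "i \<noteq> j"
  then obtain p where p: "par i = Some p" by (cases "par i") (auto simp: up_None)
  then have "j \<in> up p" using ij by (auto simp: up_Some)
  then have "i \<in> up p" using up_trans ij by blast
  then show False using not_up[OF p] by blast
qed

text \<open>The linearization, at the neutral element, of the diffeomorphism that is later called
  \<open>edge_map\<close>.\<close>

definition edge_diff :: "'a::real_vector ^ 'n \<Rightarrow> 'a ^ 'n" where
  "edge_diff x = (\<chi> i. x $ i - (case par i of None \<Rightarrow> 0 | Some j \<Rightarrow> x $ j))"

text \<open>\<open>u \<in> up i\<close> means that i lies in the subtree below u. These vectors are
  the preimages under \<open>edge_diff\<close> of the coordinate vectors.\<close>

definition branch :: "'n \<Rightarrow> 'a::real_vector \<Rightarrow> 'a ^ 'n" where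
  "branch u P = (\<chi> i. if u \<in> up i then P else 0)"

lemma linear_edge_diff: "linear edge_diff"
  by (rule linearI) (auto simp: edge_diff_def vec_eq_iff scaleR_diff_right split: option.split)

lemma linear_branch: "linear (branch u)"
  by (rule linearI) (auto simp: branch_def vec_eq_iff)

text \<open>The indicator of a subtree jumps only at the edge above its top vertex.\<close>

lemma edge_diff_branch: "edge_diff (branch u P) = axis u P"
proof -
  have "edge_diff (branch u P) $ i = axis u P $ i" for i
  proof (cases "par i")
    case None
    then show ?thesis by (auto simp: edge_diff_def branch_def axis_def up_None)
  next
    case (Some j)
    then show ?thesis using not_up[OF Some] by (auto simp: edge_diff_def branch_def axis_def up_Some)
  qed
  then show ?thesis by (simp add: vec_eq_iff)
qed

text \<open>The differences telescope along the path to the root, where the missing parent counts as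
  0.\<close>

lemma sum_edge_diff_up: "(\<Sum>u\<in>up i. edge_diff x $ u) = x $ i"
proof (induction i rule: forest_induct)
  case (step i)
  show ?case
  proof (cases "par i")
    case None
    then show ?thesis by (simp add: up_None edge_diff_def)
  next
    case (Some j)
    then show ?thesis using step[OF Some] not_up[OF Some] by (simp add: up_Some edge_diff_def)
  qed
qed

lemma sum_branch_edge_diff: "(\<Sum>u\<in>UNIV. branch u (edge_diff x $ u)) = x"
proof -
  have "(\<Sum>u\<in>UNIV. branch u (edge_diff x $ u)) $ i = x $ i" for i
  proof -
    have "(\<Sum>u\<in>UNIV. branch u (edge_diff x $ u)) $ i = (\<Sum>u\<in>UNIV. if u \<in> up i then edge_diff x $ u else 0)"
      by (simp add: sum_component branch_def)
    also have "\<dots> = (\<Sum>u\<in>up i. edge_diff x $ u)"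
      by (simp add: sum.If_cases)
    finally show ?thesis by (simp only: sum_edge_diff_up)
  qed
  then show ?thesis by (simp add: vec_eq_iff)
qed

text \<open>Two subtrees are nested or disjoint. This is the top vertex of their intersection,
  namely the lower of the two vertices, or \<open>None\<close> if they are disjoint.\<close>

definition meet :: "'n \<Rightarrow> 'n \<Rightarrow> 'n option" where
  "meet u w = (if w \<in> up u then Some u else if u \<in> up w then Some w else None)"

definition tree_metric :: "'a::real_vector form \<Rightarrow> ('a ^ 'n) form" where
  "tree_metric q x y = (\<Sum>i\<in>UNIV. q (edge_diff x $ i) (edge_diff y $ i))"

text \<open>The vertices comparable with u are its ancestors and its descendants; u itself is both,
  hence the 1.\<close>

lemma card_comparable:
  "card {w. meet u w \<noteq> None} + 1 = card (up u) + card {w. u \<in> up w}"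
proof -
  have "{w. meet u w \<noteq> None} = up u \<union> {w. u \<in> up w}" by (auto simp: meet_def)
  moreover have "up u \<inter> {w. u \<in> up w} = {u}" using up_antisym up_self by blast
  ultimately show ?thesis using card_Un_Int[of "up u" "{w. u \<in> up w}"] by simp
qed

text \<open>One member of such a pair is u and the other lies on the path from u to its root; the
  pair (u, u) arises in both ways.\<close>

lemma card_meet_eq:
  "card {p. meet (fst p) (snd p) = Some u} + 1 = 2 * card (up u)"
proof -
  have "{p. meet (fst p) (snd p) = Some u} = {u} \<times> up u \<union> up u \<times> {u}"
    using up_antisym up_self by (auto simp: meet_def split: if_splits)
  moreover have "{u} \<times> up u \<inter> up u \<times> {u} = {(u, u)}" using up_self by blast
  ultimately show ?thesis
    using card_Un_Int[of "{u} \<times> up u" "up u \<times> {u}"] by (simp add: card_cartesian_product)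
qed

text \<open>For distinct u and v a common value of the two meets can only be w itself, which then
  lies below both.\<close>

lemma meet_eq_distinct:
  assumes "u \<noteq> v"
  shows "{w. meet u w = meet v w \<and> meet u w \<noteq> None} = {w. u \<in> up w \<and> v \<in> up w}"
  using assms up_antisym up_self up_linear
  by (auto simp: meet_def split: if_splits) (metis up_trans subsetD)+

text \<open>The cardinalities are the coefficients of the three terms of \<open>ricci_frame\<close>
  on two branch vectors. If u = v has a path of a vertices and a subtree of s vertices, they are a +
  s - 1, s and 2a - 1, and -(a + s - 1)/2 + s/2 + (2a - 1)/4 = 1/4. If u and v differ, the first two
  terms cancel and the third is 0.\<close>

lemma meet_count:
  "- real (card {w. meet u w = meet v w \<and> meet u w \<noteq> None}) / 2 + real (card {i. u \<in> up i \<and> v \<in> up i}) / 2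
    + real (card {p. meet (fst p) (snd p) = Some u \<and> meet (fst p) (snd p) = Some v}) / 4 = (if u = v then 1 / 4 else 0)"
proof (cases "u = v")
  case True
  have "real (card {w. meet u w \<noteq> None}) + 1 = real (card (up u)) + real (card {w. u \<in> up w})"
    using arg_cong[OF card_comparable[of u], of real] by (simp only: of_nat_add of_nat_1)
  moreover have "real (card {p. meet (fst p) (snd p) = Some u}) + 1 = 2 * real (card (up u))"
    using arg_cong[OF card_meet_eq[of u], of real]
    by (simp only: of_nat_add of_nat_1 of_nat_mult of_nat_numeral)
  ultimately show ?thesis using True by (simp add: field_simps)
next
  case False
  then have e: "{p. meet (fst p) (snd p) = Some u \<and> meet (fst p) (snd p) = Some v} = {}" by auto
  show ?thesis unfolding e meet_eq_distinct[OF False] using False by simp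
qed

end

section \<open>Einstein metrics from forests\<close>

lemma sum_UNIV_pair:
  "(\<Sum>p\<in>(UNIV :: ('a::finite \<times> 'b::finite) set). f (fst p) (snd p)) = (\<Sum>i\<in>UNIV. \<Sum>j\<in>UNIV. f i j)"
  by (simp add: sum.cartesian_product split_beta flip: UNIV_Times_UNIV)

lemma sum_if_const: "(\<Sum>j\<in>I. f j) = s \<Longrightarrow> (\<Sum>j\<in>I. if b then f j else 0) = (if b then s else 0)"
  by simp

lemma sum_sum_if_const: "(\<Sum>j\<in>I. \<Sum>k\<in>K. f j k) = s \<Longrightarrow>
    (\<Sum>j\<in>I. \<Sum>k\<in>K. if b then f j k else 0) = (if b then s else 0)"
  by simp

context forest
begin

text \<open>A branch vector has its only nonzero edge difference at u, so pairing with it reads off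
  a single edge difference of x.\<close>

lemma tree_metric_branch_right:
  assumes "inner_product q"
  shows "tree_metric q x (branch u P) = q (edge_diff x $ u) P"
proof -
  have "tree_metric q x (branch u P) = (\<Sum>i\<in>UNIV. if i = u then q (edge_diff x $ i) P else 0)"
    unfolding tree_metric_def edge_diff_branch
    by (intro sum.cong) (auto simp: axis_def linear_0[OF inner_product_linear(1)[OF assms]])
  then show ?thesis by simp
qed

lemma tree_metric_branch:
  assumes "inner_product q"
  shows "tree_metric q (branch u P) (branch v Q) = (if u = v then q P Q else 0)"
  unfolding tree_metric_branch_right[OF assms] edge_diff_branch
  by (auto simp: axis_def linear_0[OF inner_product_linear(2)[OF assms]])

lemma inner_product_tree_metric:
  assumes "inner_product q"
  shows "inner_product (tree_metric q)"
proof -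
  note lin = inner_product_linear[OF assms]
  have "0 < tree_metric q x x" if x: "x \<noteq> 0" for x
  proof -
    have "\<exists>i. edge_diff x $ i \<noteq> 0"
    proof (rule ccontr)
      assume "\<nexists>i. edge_diff x $ i \<noteq> 0"
      then have "x = (\<Sum>u\<in>UNIV. branch u 0)" using sum_branch_edge_diff[of x] by simp
      then show False using x by (simp add: linear_0[OF linear_branch])
    qed
    then obtain i where "edge_diff x $ i \<noteq> 0" ..
    then have "0 < q (edge_diff x $ i) (edge_diff x $ i)" using assms unfolding inner_product_def by blast
    then show ?thesis
      unfolding tree_metric_def
      by (rule sum_pos2[of _ i, rotated 2]) (simp_all add: inner_product_nonneg[OF assms])
  qed
  moreover have "bilinear (tree_metric q)"
    unfolding bilinear_def tree_metric_def
    by (auto intro!: linearI simp: linear_add[OF linear_edge_diff] linear_scale[OF linear_edge_diff]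
        linear_add[OF lin(1)] linear_add[OF lin(2)] linear_scale[OF lin(1)] linear_scale[OF lin(2)]
        sum.distrib sum_distrib_left)
  ultimately show ?thesis
    unfolding inner_product_def using inner_product_commute[OF assms] by (auto simp: tree_metric_def)
qed

lemma orthonormal_frame_tree_metric:
  fixes X :: "'d::finite \<Rightarrow> 'a::euclidean_space"
  assumes "inner_product q" "orthonormal_frame q UNIV X"
  shows "orthonormal_frame (tree_metric q) UNIV (\<lambda>p. branch (fst p) (X (snd p)))"
proof -
  have "(\<Sum>p\<in>UNIV. tree_metric q x (branch (fst p) (X (snd p))) *\<^sub>R branch (fst p) (X (snd p))) = x" for x
  proof -
    have "(\<Sum>p\<in>UNIV. tree_metric q x (branch (fst p) (X (snd p))) *\<^sub>R branch (fst p) (X (snd p))) =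
        (\<Sum>u\<in>UNIV. \<Sum>j\<in>UNIV. q (edge_diff x $ u) (X j) *\<^sub>R branch u (X j))"
      unfolding tree_metric_branch_right[OF assms(1)]
      by (rule sum_UNIV_pair[of "\<lambda>u j. q (edge_diff x $ u) (X j) *\<^sub>R branch u (X j)"])
    also have "\<dots> = (\<Sum>u\<in>UNIV. branch u (edge_diff x $ u))"
      by (simp only: frame_expand_linear[OF assms(2) linear_branch, symmetric])
    finally show ?thesis by (simp only: sum_branch_edge_diff)
  qed
  then show ?thesis
    using assms(2) unfolding orthonormal_frame_def
    by (auto simp: tree_metric_branch[OF assms(1)] split: if_splits)
qed

text \<open>The bracket is componentwise, hence supported on the intersection of two subtrees, which
  is empty or again a subtree. So the structure constants of the branch basis are governed by
  \<open>meet\<close>.\<close>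

lemma power_bracket_branch:
  assumes "bilinear br"
  shows "power_bracket br (branch u P) (branch w Q) =
    (case meet u w of None \<Rightarrow> 0 | Some m \<Rightarrow> branch m (br P Q))"
proof -
  have z: "br x 0 = 0" "br 0 x = 0" for x
    using assms bilinear_rzero bilinear_lzero by blast+
  have "power_bracket br (branch u P) (branch w Q) = (\<chi> i. if u \<in> up i \<and> w \<in> up i then br P Q else 0)"
    by (simp add: power_bracket_def branch_def z vec_eq_iff)
  moreover have "u \<in> up i \<and> w \<in> up i \<longleftrightarrow> (case meet u w of None \<Rightarrow> False | Some m \<Rightarrow> m \<in> up i)" for i
    using up_trans[of u i] up_trans[of w i] up_linear[of u i w] by (auto simp: meet_def)
  ultimately show ?thesis by (simp add: branch_def vec_eq_iff split: option.split)
qed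

lemma tree_metric_bracket:
  assumes "inner_product q" "bilinear br"
  shows "tree_metric q (power_bracket br (branch u P) (branch w R)) (power_bracket br (branch v Q) (branch w R')) =
      (if meet u w = meet v w \<and> meet u w \<noteq> None then q (br P R) (br Q R') else 0)"
    "tree_metric q (power_bracket br (branch w R) (branch w' R')) (branch u P) =
      (if meet w w' = Some u then q (br R R') P else 0)"
  unfolding power_bracket_branch[OF assms(2)]
  by (auto simp: tree_metric_branch[OF assms(1)]
      linear_0[OF inner_product_linear(1)[OF inner_product_tree_metric[OF assms(1)]]]
      linear_0[OF inner_product_linear(2)[OF inner_product_tree_metric[OF assms(1)]]] split: option.split)

text \<open>\<open>edge_diff\<close> and its inverse, made of the branch vectors, both have integer
  matrices. So the determinant of the change of basis is 1 or -1, and only its square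
  enters.\<close>

lemma relative_det_tree_metric:
  fixes q :: "(real ^ 'd) form" and Q :: "(real ^ 'd ^ 'n) form"
  assumes "inner_product q" "inner_product Q" "\<And>x y. Q x y = (\<Sum>i\<in>UNIV. q (x $ i) (y $ i))"
  shows "relative_det Q (tree_metric q) = 1"
proof -
  let ?\<epsilon> = "\<lambda>s. axis (fst s) (axis (snd s) 1) :: real ^ 'd ^ 'n"
  define W :: "real ^ ('n \<times> 'd) ^ ('n \<times> 'd)" where "W = (\<chi> p s. edge_diff (?\<epsilon> p) $ fst s $ snd s)"
  define M :: "real ^ ('n \<times> 'd) ^ ('n \<times> 'd)"
    where "M = (\<chi> r p. branch (fst r) (axis (snd r) 1) $ fst p $ snd p)"
  have "bilinear Q" using assms(2) unfolding inner_product_def by blast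
  from gram_transform[OF this, of "\<lambda>p. edge_diff (?\<epsilon> p)"]
  have "gram (tree_metric q) = W ** gram Q ** transpose W"
    unfolding W_def by (simp add: gram_def tree_metric_def assms(3))
  then have g: "det (gram (tree_metric q)) = (det W)\<^sup>2 * det (gram Q)"
    by (simp add: det_mul power2_eq_square)
  have "(M ** W) $ r $ s = mat 1 $ r $ s" for r s
  proof -
    have "(M ** W) $ r $ s = (\<Sum>p\<in>UNIV. M $ r $ p *\<^sub>R edge_diff (?\<epsilon> p)) $ fst s $ snd s"
      by (simp add: matrix_matrix_mult_def W_def sum_component)
    also have "(\<Sum>p\<in>UNIV. M $ r $ p *\<^sub>R edge_diff (?\<epsilon> p)) = edge_diff (\<Sum>p\<in>UNIV. M $ r $ p *\<^sub>R ?\<epsilon> p)"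
      by (simp add: linear_sum[OF linear_edge_diff] linear_scale[OF linear_edge_diff])
    also have "\<dots> = ?\<epsilon> r"
      using vec_vec_expand[of "branch (fst r) (axis (snd r) 1 :: real ^ 'd)"]
      by (simp add: M_def edge_diff_branch)
    finally show ?thesis by (cases r; cases s) (auto simp: axis_def mat_def)
  qed
  then have "M ** W = mat 1" by (simp add: vec_eq_iff)
  moreover have "M $ r $ p \<in> \<int>" "W $ r $ p \<in> \<int>" for r p
    by (auto simp: M_def W_def branch_def edge_diff_def axis_def split: option.split)
  ultimately have "(det W)\<^sup>2 = 1" by (intro integer_unimodular_det_square)
  then show ?thesis using g det_gram_nonzero[OF assms(2)] by (simp add: relative_det_def)
qed

end

context compact_simple_lie_chart
begin

lemma unimodular_br: "unimodular_bracket br"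
  using bilinear_br br_antisym lin_trace_br by unfold_locales blast+

text \<open>By invariance the first sum is minus the trace of ad Q ad P, which is how
  \<open>mk\<close> is defined. The second reduces to the first: invariance moves P and Q into the
  brackets and Parseval carries out the inner sum.\<close>

lemma frame_killing_sum:
  assumes "orthonormal_frame mk (UNIV :: 'i::finite set) X"
  shows "(\<Sum>j\<in>UNIV. mk (br P (X j)) (br Q (X j))) = mk P Q"
    "(\<Sum>j\<in>UNIV. \<Sum>k\<in>UNIV. mk (br (X j) (X k)) P * mk (br (X j) (X k)) Q) = mk P Q"
proof -
  show 1: "(\<Sum>j\<in>UNIV. mk (br P (X j)) (br Q (X j))) = mk P Q" for P Q
  proof -
    have "mk (br P a) (br Q a) = - mk (br Q (br P a)) a" for a
      using mk_br[of Q "br P a" a] by linarith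
    then have "(\<Sum>j\<in>UNIV. mk (br P (X j)) (br Q (X j))) = mk Q P"
      unfolding minus_killing_def[of br Q P] frame_lin_trace[OF inner_product_mk assms linear_br_br]
      by (simp add: sum_negf)
    then show ?thesis by (simp add: inner_product_commute[OF inner_product_mk, of Q P])
  qed
  have sw: "mk (br a b) R = mk (br R a) b" for a b R
  proof -
    have "mk (br a b) R = - mk b (br a R)" using mk_br[of a b R] by linarith
    also have "\<dots> = mk b (br R a)"
      using br_antisym[of a R] by (simp add: linear_neg[OF inner_product_linear(1)[OF inner_product_mk]])
    finally show ?thesis by (simp only: inner_product_commute[OF inner_product_mk, of b])
  qed
  show "(\<Sum>j\<in>UNIV. \<Sum>k\<in>UNIV. mk (br (X j) (X k)) P * mk (br (X j) (X k)) Q) = mk P Q"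
    unfolding sw[of "X _" "X _"] frame_parseval[OF inner_product_mk assms, symmetric] by (rule 1)
qed

end

section \<open>Ricci tensor, criticality and representers of the tree metric\<close>

locale forest_lie_chart = compact_simple_lie_chart \<A> U c + forest par up
  for \<A> :: "('f::{group_add, t2_space, second_countable_topology}, real ^ 'd) chart set"
    and U :: "'f set" and c :: "'f \<Rightarrow> real ^ 'd"
    and par :: "'n::finite \<Rightarrow> 'n option" and up :: "'n \<Rightarrow> 'n set"
begin

abbreviation tm :: "(real ^ 'd ^ 'n) form" where "tm \<equiv> tree_metric mk"
abbreviation pbr :: "(real ^ 'd ^ 'n) bracket" where "pbr \<equiv> power_bracket br"

lemmas inner_product_tm = inner_product_tree_metric[OF inner_product_mk]
lemmas linear_mk = inner_product_linear[OF inner_product_mk]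
lemmas inner_product_mk_power = inner_product_minus_killing_power[OF inner_product_mk]

lemma unimodular_pbr: "unimodular_bracket pbr"
  by (rule unimodular_power_bracket[OF unimodular_br])

text \<open>Each of the three terms of the Ricci formula factors into a combinatorial count and
  \<open>mk P Q\<close>; the counts combine by \<open>meet_count\<close>.\<close>

lemma ricci_branch:
  "ricci pbr tm (branch u P) (branch v Q) = (if u = v then 1 / 4 else 0) * mk P Q"
proof -
  obtain X :: "'d \<Rightarrow> real ^ 'd" where X: "orthonormal_frame mk UNIV X"
    using orthonormal_frame_exists_vec[OF inner_product_mk] by blast
  note fr = orthonormal_frame_tree_metric[OF inner_product_mk X]
  note tb = tree_metric_bracket[OF inner_product_mk bilinear_br]
  have T1: "(\<Sum>p\<in>UNIV. tm (pbr (branch u P) (branch (fst p) (X (snd p)))) (pbr (branch v Q) (branch (fst p) (X (snd p)))))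
      = real (card {w. meet u w = meet v w \<and> meet u w \<noteq> None}) * mk P Q"
  proof -
    have "(\<Sum>p\<in>UNIV. tm (pbr (branch u P) (branch (fst p) (X (snd p)))) (pbr (branch v Q) (branch (fst p) (X (snd p)))))
        = (\<Sum>w\<in>UNIV. \<Sum>j\<in>UNIV. if meet u w = meet v w \<and> meet u w \<noteq> None then mk (br P (X j)) (br Q (X j)) else 0)"
      unfolding tb by (rule sum_UNIV_pair)
    also have "\<dots> = (\<Sum>w\<in>UNIV. if meet u w = meet v w \<and> meet u w \<noteq> None then mk P Q else 0)"
    proof (intro sum.cong refl)
      fix w
      show "(\<Sum>j\<in>UNIV. if meet u w = meet v w \<and> meet u w \<noteq> None then mk (br P (X j)) (br Q (X j)) else 0) =
          (if meet u w = meet v w \<and> meet u w \<noteq> None then mk P Q else 0)"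
        using frame_killing_sum(1)[OF X, of P Q] by (rule sum_if_const)
    qed
    finally show ?thesis by (simp add: sum.If_cases)
  qed
  have T2: "minus_killing pbr (branch u P) (branch v Q) = real (card {i. u \<in> up i \<and> v \<in> up i}) * mk P Q"
  proof -
    have "minus_killing pbr (branch u P) (branch v Q) = (\<Sum>i\<in>UNIV. if u \<in> up i \<and> v \<in> up i then mk P Q else 0)"
      unfolding minus_killing_power_bracket
      by (intro sum.cong) (auto simp: branch_def linear_0[OF linear_mk(1)] linear_0[OF linear_mk(2)])
    then show ?thesis by (simp add: sum.If_cases)
  qed
  have T3: "(\<Sum>p\<in>UNIV. \<Sum>r\<in>UNIV. tm (pbr (branch (fst p) (X (snd p))) (branch (fst r) (X (snd r)))) (branch u P)
        * tm (pbr (branch (fst p) (X (snd p))) (branch (fst r) (X (snd r)))) (branch v Q))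
      = real (card {p. meet (fst p) (snd p) = Some u \<and> meet (fst p) (snd p) = Some v}) * mk P Q"
  proof -
    let ?F = "\<lambda>w j w' k. (if meet w w' = Some u then mk (br (X j) (X k)) P else 0) *
      (if meet w w' = Some v then mk (br (X j) (X k)) Q else 0)"
    have "(\<Sum>p\<in>UNIV. \<Sum>r\<in>UNIV. ?F (fst p) (snd p) (fst r) (snd r)) = (\<Sum>p\<in>UNIV. \<Sum>w'\<in>UNIV. \<Sum>k\<in>UNIV. ?F (fst p) (snd p) w' k)"
      by (intro sum.cong refl) (rule sum_UNIV_pair)
    also have "\<dots> = (\<Sum>w\<in>UNIV. \<Sum>j\<in>UNIV. \<Sum>w'\<in>UNIV. \<Sum>k\<in>UNIV. ?F w j w' k)"
      by (rule sum_UNIV_pair)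
    also have "\<dots> = (\<Sum>w\<in>UNIV. \<Sum>w'\<in>UNIV. \<Sum>j\<in>UNIV. \<Sum>k\<in>UNIV. ?F w j w' k)"
      by (rule sum.cong[OF refl sum.swap])
    also have "\<dots> = (\<Sum>w\<in>UNIV. \<Sum>w'\<in>UNIV. \<Sum>j\<in>UNIV. \<Sum>k\<in>UNIV.
        if meet w w' = Some u \<and> meet w w' = Some v then mk (br (X j) (X k)) P * mk (br (X j) (X k)) Q else 0)"
      by (intro sum.cong refl) simp
    also have "\<dots> = (\<Sum>w\<in>UNIV. \<Sum>w'\<in>UNIV. if meet w w' = Some u \<and> meet w w' = Some v then mk P Q else 0)"
      using frame_killing_sum(2)[OF X, of P Q] by (intro sum.cong refl sum_sum_if_const)
    also have "\<dots> = (\<Sum>p\<in>UNIV. if meet (fst p) (snd p) = Some u \<and> meet (fst p) (snd p) = Some v then mk P Q else 0)"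
      by (rule sum_UNIV_pair[symmetric])
    finally show ?thesis unfolding tb by (simp add: sum.If_cases)
  qed
  have "ricci pbr tm (branch u P) (branch v Q) =
     (- real (card {w. meet u w = meet v w \<and> meet u w \<noteq> None}) / 2 + real (card {i. u \<in> up i \<and> v \<in> up i}) / 2
    + real (card {p. meet (fst p) (snd p) = Some u \<and> meet (fst p) (snd p) = Some v}) / 4) * mk P Q"
    unfolding unimodular_bracket.ricci_frame[OF unimodular_pbr inner_product_tm fr] T1 T2 T3
    by (simp add: field_simps)
  then show ?thesis unfolding meet_count .
qed

lemma ricci_tm: "ricci pbr tm x y = 1 / 4 * tm x y"
proof -
  obtain X :: "'d \<Rightarrow> real ^ 'd" where X: "orthonormal_frame mk UNIV X"
    using orthonormal_frame_exists_vec[OF inner_product_mk] by blast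
  note lin = unimodular_bracket.linear_ricci[OF unimodular_pbr inner_product_tm
      orthonormal_frame_tree_metric[OF inner_product_mk X]]
  have "ricci pbr tm x y = (\<Sum>u\<in>UNIV. \<Sum>v\<in>UNIV. ricci pbr tm (branch u (edge_diff x $ u)) (branch v (edge_diff y $ v)))"
    by (subst (1) sum_branch_edge_diff[of x, symmetric], subst (1) sum_branch_edge_diff[of y, symmetric])
      (simp only: linear_sum[OF lin(1)] linear_sum[OF lin(2)], rule sum.swap)
  also have "\<dots> = (\<Sum>u\<in>UNIV. \<Sum>v\<in>UNIV. if u = v then 1 / 4 * mk (edge_diff x $ u) (edge_diff y $ v) else 0)"
    unfolding ricci_branch by (intro sum.cong refl) simp
  also have "\<dots> = 1 / 4 * tm x y" by (simp add: tree_metric_def sum_divide_distrib)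
  finally show ?thesis .
qed

text \<open>\<open>edge_diff\<close> commutes with ad of a diagonal element, because all components
  are bracketed with the same x.\<close>

lemma invariant_metric_tm: "invariant_metric br tm"
proof -
  have e: "edge_diff (pbr (diag x) u) $ i = br x (edge_diff u $ i)" for x u i
    by (simp add: edge_diff_def power_bracket_def diag_def linear_diff[OF linear_br(1)]
        linear_0[OF linear_br(1)] split: option.split)
  have "tm (pbr (diag x) u) v + tm u (pbr (diag x) v) = 0" for x u v
    unfolding tree_metric_def e sum.distrib[symmetric] by (simp only: mk_br sum.neutral_const)
  then show ?thesis unfolding invariant_metric_def using inner_product_tm by blast
qed

lemma tm_unit_volume: "tm \<in> unit_volume_metrics br"
  unfolding unit_volume_metrics_def
  using invariant_metric_tm relative_det_tree_metric[OF inner_product_mk inner_product_mk_power minus_killing_power_bracket]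
  by blast

lemma tm_critical: "tm \<in> critical_metrics br"
  unfolding critical_metrics_def
proof (intro CollectI conjI tm_unit_volume allI impI)
  fix \<gamma> :: "real \<Rightarrow> (real ^ 'd ^ 'n) form"
  assume \<gamma>: "\<gamma> 0 = tm \<and> (\<forall>t. \<gamma> t \<in> unit_volume_metrics br) \<and> (\<forall>u v t. (\<lambda>s. \<gamma> s u v) differentiable (at t))"
  obtain X :: "'d \<Rightarrow> real ^ 'd" where X: "orthonormal_frame mk UNIV X"
    using orthonormal_frame_exists_vec[OF inner_product_mk] by blast
  note fr = orthonormal_frame_tree_metric[OF inner_product_mk X]
  define e where "e p = branch (fst p) (X (snd p))" for p :: "'n \<times> 'd"
  \<comment> \<open>Unit volume refers to the Killing form, whereas
    \<open>einstein_imp_critical\<close> asks for Gram determinant 1 in the frame \<open>e\<close>.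
    The former makes the latter constant along the curve, and at t = 0, where \<open>e\<close> is
    orthonormal, it is 1.\<close>
  define W :: "real ^ ('n \<times> 'd) ^ ('n \<times> 'd)" where "W = (\<chi> p s. e p $ fst s $ snd s)"
  let ?K = "det (gram (minus_killing pbr))"
  have K: "?K \<noteq> 0" by (rule det_gram_nonzero[OF inner_product_mk_power])
  have ip: "inner_product (\<gamma> t)" for t
    using \<gamma> unfolding unit_volume_metrics_def invariant_metric_def by blast
  have det: "det (\<chi> i j. \<gamma> t (e i) (e j)) = (det W)\<^sup>2 * ?K" for t
  proof -
    have "bilinear (\<gamma> t)" using ip unfolding inner_product_def by blast
    from gram_transform[OF this, of e]
    have "det (\<chi> i j. \<gamma> t (e i) (e j)) = (det W)\<^sup>2 * det (gram (\<gamma> t))"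
      unfolding W_def by (simp add: det_mul power2_eq_square)
    moreover have "relative_det (minus_killing pbr) (\<gamma> t) = 1"
      using \<gamma> unfolding unit_volume_metrics_def by blast
    then have "det (gram (\<gamma> t)) = ?K" using K by (simp add: relative_det_def)
    ultimately show ?thesis by simp
  qed
  have "(\<chi> i j. \<gamma> 0 (e i) (e j)) = mat 1"
    using \<gamma> fr unfolding e_def orthonormal_frame_def by (simp add: mat_def vec_eq_iff)
  then have 1: "(det W)\<^sup>2 * ?K = 1" using det[of 0] by simp
  show "((\<lambda>t. scalar_curvature pbr (\<gamma> t)) has_real_derivative 0) (at 0)"
  proof (rule unimodular_bracket.einstein_imp_critical[OF unimodular_pbr ip])
    show "orthonormal_frame (\<gamma> 0) UNIV e" using \<gamma> fr unfolding e_def by simp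
    show "(\<lambda>t. \<gamma> t u v) differentiable (at 0)" for u v using \<gamma> by blast
    show "det (\<chi> i j. \<gamma> t (e i) (e j)) = 1" for t unfolding det 1 ..
    show "ricci pbr (\<gamma> 0) x y = 1 / 4 * \<gamma> 0 x y" for x y using \<gamma> ricci_tm by simp
  qed
qed

text \<open>The vector on the left represents, with respect to \<open>tm\<close>, the functional
  sending z to \<open>mk Y (z $ i)\<close>, which does not involve the forest. Its components count
  common ancestors, and so the forest can be recovered from the metric.\<close>

lemma tm_dual:
  "tm (\<Sum>v\<in>up i. branch v Y) z = mk Y (z $ i)"
proof -
  have "tm (branch v Y) z = mk Y (edge_diff z $ v)" for v
    using tree_metric_branch_right[OF inner_product_mk, of z v Y]
    by (simp only: inner_product_commute[OF inner_product_tm, of "branch v Y"]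
        inner_product_commute[OF inner_product_mk, of Y])
  then have "tm (\<Sum>v\<in>up i. branch v Y) z = (\<Sum>v\<in>up i. mk Y (edge_diff z $ v))"
    by (simp only: linear_sum[OF inner_product_linear(2)[OF inner_product_tm]])
  also have "\<dots> = mk Y (\<Sum>v\<in>up i. edge_diff z $ v)" by (simp only: linear_sum[OF linear_mk(1)])
  finally show ?thesis by (simp only: sum_edge_diff_up)
qed

lemma dual_component: "(\<Sum>v\<in>up i. branch v Y) $ j = real (card (up i \<inter> up j)) *\<^sub>R Y"
proof -
  have "(\<Sum>v\<in>up i. branch v Y) $ j = (\<Sum>v\<in>up i. if v \<in> up j then Y else 0)"
    by (simp add: sum_component branch_def)
  also have "\<dots> = real (card (up i \<inter> up j)) *\<^sub>R Y"
    by (simp add: sum.If_cases scaleR_conv_of_real sum_constant_scaleR)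
  finally show ?thesis .
qed

end

section \<open>The isometry with the product metric\<close>

lemma has_derivative_vecI:
  fixes f :: "'a::real_normed_vector \<Rightarrow> 'b::euclidean_space ^ 'n"
  assumes "\<And>i. ((\<lambda>x. f x $ i) has_derivative (\<lambda>v. f' v $ i)) (at a)"
  shows "(f has_derivative f') (at a)"
proof (rule has_derivative_componentwise_within[THEN iffD2], rule ballI)
  fix e :: "'b ^ 'n" assume "e \<in> Basis"
  then obtain i u where e: "e = axis i u" by (auto simp: Basis_vec_def)
  show "((\<lambda>x. f x \<bullet> e) has_derivative (\<lambda>x. f' x \<bullet> e)) (at a)"
    unfolding e inner_axis by (rule bounded_linear.has_derivative[OF bounded_linear_inner_left assms])
qed

context forest
begin

definition edge_map :: "'f::group_add ^ 'n \<Rightarrow> 'f ^ 'n" where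
  "edge_map x = (\<chi> i. case par i of None \<Rightarrow> x $ i | Some j \<Rightarrow> x $ i - x $ j)"

text \<open>The inverse of \<open>edge_map\<close>: the ordered product of the entries along the
  path to the root, which telescopes.\<close>

function path_add :: "'n \<Rightarrow> 'f::monoid_add ^ 'n \<Rightarrow> 'f" where
  "path_add i y = (case par i of None \<Rightarrow> y $ i | Some j \<Rightarrow> y $ i + path_add j y)"
  by pat_completeness auto
termination
  by (relation "Wellfounded.measure (\<lambda>(i, y). card (up i))") (auto intro: card_up_less)

declare path_add.simps [simp del]

lemma path_add_edge_map: "path_add i (edge_map x) = x $ i"
proof (induction i rule: forest_induct)
  case (step i)
  then show ?case by (subst path_add.simps) (auto simp: edge_map_def split: option.split)
qed

lemma edge_map_path_add: "edge_map (\<chi> i. path_add i y) = y"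
proof -
  have "edge_map (\<chi> i. path_add i y) $ i = y $ i" for i
    by (cases "par i") (simp_all add: edge_map_def path_add.simps[of i])
  then show ?thesis by (simp add: vec_eq_iff)
qed

lemma bij_edge_map: "bij edge_map" and inv_edge_map: "inv edge_map = (\<lambda>y. \<chi> i. path_add i y)"
proof -
  have 1: "(\<chi> i. path_add i (edge_map x)) = x" for x :: "'a ^ 'n" by (simp add: path_add_edge_map)
  show "bij (edge_map :: 'a ^ 'n \<Rightarrow> _)"
    by (rule bij_betw_byWitness[of _ "\<lambda>y. \<chi> i. path_add i y"]) (simp_all add: 1 edge_map_path_add)
  show "inv edge_map = (\<lambda>y :: 'b::group_add ^ 'n. \<chi> i. path_add i y)"
    by (rule inv_equality) (simp_all add: path_add_edge_map edge_map_path_add)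
qed

end

context lie_chart
begin

text \<open>The derivative is determined by two restrictions: to the first variable, where it is the
  identity, and to the diagonal, where it is 0.\<close>

lemma has_derivative_minus_coord:
  obtains T where "open T" "(c 0, c 0) \<in> T" "T \<subseteq> c ` U \<times> c ` U"
    "\<forall>p q. (p, q) \<in> T \<longrightarrow> inv_c p - inv_c q \<in> U"
    "((\<lambda>z. c (inv_c (fst z) - inv_c (snd z))) has_derivative (\<lambda>z. fst z - snd z)) (at (c 0, c 0))"
proof -
  let ?f = "\<lambda>z. c (inv_c (fst z) - inv_c (snd z))"
  have z: "0 - 0 \<in> U" using zero_in by simp
  obtain T where T: "open T" "(c 0, c 0) \<in> T" "T \<subseteq> c ` U \<times> c ` U"
    "\<forall>p q. (p, q) \<in> T \<longrightarrow> inv_c p - inv_c q \<in> U" "smooth_on T ?f"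
    by (rule smooth_map_prod_coord[OF charted_A smooth_map_minus chart zero_in chart zero_in chart z])
  define D where "D = frechet_derivative ?f (at (c 0, c 0))"
  have D: "(?f has_derivative D) (at (c 0, c 0))"
    unfolding D_def by (rule smooth_on_imp_has_derivative[OF T(5,2)])
  have lin: "linear D" using D has_derivative_linear by blast
  have oc: "open (c ` U)" and c0: "c 0 \<in> c ` U"
    using is_chart_openD(2)[OF is_chart_Uc] zero_in by auto
  have "((\<lambda>p. ?f (p, c 0)) has_derivative (\<lambda>v. v)) (at (c 0))"
    by (rule has_derivative_transform_within_open[OF has_derivative_ident oc c0]) (use zero_in in auto)
  from has_derivative_unique[OF has_derivative_partial_fst[OF D] this]
  have 1: "D (v, 0) = v" for v by meson
  have "((\<lambda>p. (p, p)) has_derivative (\<lambda>v. (v, v))) (at (c 0))"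
    by (auto intro!: derivative_eq_intros)
  from diff_chain_at[OF this D]
  have "((\<lambda>p. ?f (p, p)) has_derivative (\<lambda>v. D (v, v))) (at (c 0))" by (simp add: o_def)
  moreover have "((\<lambda>p. ?f (p, p)) has_derivative (\<lambda>v. 0)) (at (c 0))" by simp
  ultimately have "(\<lambda>v. D (v, v)) = (\<lambda>v. 0)" by (rule has_derivative_unique)
  then have 2: "D (v, v) = 0" for v by meson
  have "D (a, b) = a - b" for a b
    using linear_add[OF lin, of "(a - b, 0)" "(b, b)"] by (simp add: 1 2)
  then have "D = (\<lambda>z. fst z - snd z)" by (simp add: fun_eq_iff)
  then show ?thesis using that[OF T(1-4)] D by simp
qed

end

context forest_lie_chart
begin

lemma diffeo_edge_map: "diffeo (power_atlas \<A>) (edge_map :: 'f ^ 'n \<Rightarrow> 'f ^ 'n)"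
proof -
  note ch = charted_power_atlas[OF charted_A]
  have "smooth_map (power_atlas \<A>) \<A> (\<lambda>x :: 'f ^ 'n. case par i of None \<Rightarrow> x $ i | Some j \<Rightarrow> x $ i - x $ j)" for i
    by (cases "par i") (auto intro!: smooth_map_diff ch smooth_map_vec_nth smooth_A)
  then have "smooth_map (power_atlas \<A>) (power_atlas \<A>) (edge_map :: 'f ^ 'n \<Rightarrow> _)"
    unfolding edge_map_def[abs_def] by (intro smooth_map_vec_lambda ch charted_A)
  moreover have "smooth_map (power_atlas \<A>) \<A> (path_add i :: 'f ^ 'n \<Rightarrow> 'f)" for i
  proof (induction i rule: forest_induct)
    case (step i)
    show ?case
    proof (cases "par i")
      case None
      then have "path_add i = (\<lambda>y :: 'f ^ 'n. y $ i)" by (simp add: fun_eq_iff path_add.simps)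
      then show ?thesis using smooth_map_vec_nth[OF smooth_A] by metis
    next
      case (Some j)
      then have "path_add i = (\<lambda>y :: 'f ^ 'n. y $ i + path_add j y)"
        by (simp add: fun_eq_iff path_add.simps[of i])
      then show ?thesis
        using smooth_map_add[OF ch smooth_map_vec_nth[OF smooth_A] step[OF Some]] by simp
    qed
  qed
  then have "smooth_map (power_atlas \<A>) (power_atlas \<A>) (inv (edge_map :: 'f ^ 'n \<Rightarrow> _))"
    unfolding inv_edge_map by (intro smooth_map_vec_lambda ch charted_A)
  ultimately show ?thesis unfolding diffeo_def using bij_edge_map by blast
qed

text \<open>Written multiplicatively, (x y^-1)^-1 (x a) (y b)^-1 = y (a b^-1) y^-1, with x the entry
  of p at i and y the one at its parent: a difference of tangent vectors, followed by Ad of the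
  entry at the parent.\<close>

lemma left_differential_edge_map:
  "left_differential (power_chart (\<lambda>_. (U, c))) edge_map p u =
    (\<chi> i. case par i of None \<Rightarrow> u $ i | Some j \<Rightarrow> Ad (p $ j) (u $ i - u $ j))"
proof -
  define PU :: "('f ^ 'n) set" where "PU = {x. \<forall>i. x $ i \<in> U}"
  define pc :: "'f ^ 'n \<Rightarrow> real ^ 'd ^ 'n" where "pc x = (\<chi> i. c (x $ i))" for x
  have chart': "power_chart (\<lambda>_. (U, c)) = (PU, pc)"
    by (simp add: power_chart_def PU_def pc_def fun_eq_iff)
  have inv: "inv_into PU pc q $ i = inv_c (q $ i)" if q: "\<forall>i. q $ i \<in> c ` U" for q i
  proof -
    have x: "(\<chi> i. inv_c (q $ i)) $ i \<in> fst (U, c)" for i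
      using q by (simp add: inv_into_into)
    have "inv_into PU pc (\<chi> i. c ((\<chi> i. inv_c (q $ i)) $ i)) = (\<chi> i. inv_c (q $ i))"
      using inv_into_power_chart[of "\<lambda>_. (U, c)", OF is_chart_Uc x] unfolding chart' by simp
    moreover have "(\<chi> i. c ((\<chi> i. inv_c (q $ i)) $ i)) = q" using q by (simp add: vec_eq_iff)
    ultimately show ?thesis by simp
  qed
  obtain T where T: "open T" "(c 0, c 0) \<in> T" "T \<subseteq> c ` U \<times> c ` U"
    "\<forall>p q. (p, q) \<in> T \<longrightarrow> inv_c p - inv_c q \<in> U"
    "((\<lambda>z. c (inv_c (fst z) - inv_c (snd z))) has_derivative (\<lambda>z. fst z - snd z)) (at (c 0, c 0))"
    by (rule has_derivative_minus_coord)
  \<comment> \<open>Here all coordinates, and all differences of two of them, stay in the domain of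
    the chart, so that \<open>inv_c\<close> cancels \<open>c\<close>.\<close>
  define N where "N = {q :: real ^ 'd ^ 'n. \<forall>i. q $ i \<in> c ` U} \<inter> (\<Inter>i. \<Inter>j. (\<lambda>q. (q $ i, q $ j)) -` T)"
  have oN: "open N"
    unfolding N_def using is_chart_openD(2)[OF is_chart_Uc] T(1)
    by (intro open_Int open_vector_box open_INT open_vimage continuous_intros ballI) auto
  have N0: "pc 0 \<in> N" unfolding N_def pc_def using T(2) zero_in by auto
  let ?F = "\<lambda>q. pc (- edge_map p + edge_map (p + inv_into PU pc q))"
  let ?D = "\<lambda>u. \<chi> i. case par i of None \<Rightarrow> u $ i | Some j \<Rightarrow> Ad (p $ j) (u $ i - u $ j)"
  have "(?F has_derivative ?D) (at (pc 0))"
  proof (rule has_derivative_vecI)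
    fix i
    show "((\<lambda>q. ?F q $ i) has_derivative (\<lambda>u. ?D u $ i)) (at (pc 0))"
    proof (cases "par i")
      case None
      have "((\<lambda>q. q $ i) has_derivative (\<lambda>u. u $ i)) (at (pc 0))"
        by (rule bounded_linear_imp_has_derivative[OF bounded_linear_vec_nth])
      then have "((\<lambda>q. ?F q $ i) has_derivative (\<lambda>u. u $ i)) (at (pc 0))"
      proof (rule has_derivative_transform_within_open[OF _ oN N0])
        fix q assume "q \<in> N"
        then have q: "\<forall>i. q $ i \<in> c ` U" by (simp add: N_def)
        show "q $ i = ?F q $ i"
          using q by (simp add: pc_def edge_map_def None inv[OF q] add.assoc[symmetric])
      qed
      then show ?thesis by (simp add: None)
    next
      case (Some j)
      have "((\<lambda>q. (q $ i, q $ j)) has_derivative (\<lambda>u. (u $ i, u $ j))) (at (pc 0))"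
        by (intro has_derivative_Pair bounded_linear_imp_has_derivative[OF bounded_linear_vec_nth])
      moreover have "(pc 0 $ i, pc 0 $ j) = (c 0, c 0)" by (simp add: pc_def)
      ultimately have "((\<lambda>q. c (inv_c (q $ i) - inv_c (q $ j))) has_derivative (\<lambda>u. u $ i - u $ j)) (at (pc 0))"
        using diff_chain_at[of "\<lambda>q. (q $ i, q $ j)" "\<lambda>u. (u $ i, u $ j)" "pc 0"] T(5) by (fastforce simp: o_def)
      moreover have "((\<lambda>z. c (p $ j + inv_c z - p $ j)) has_derivative Ad (p $ j)) (at (c (inv_c (pc 0 $ i) - inv_c (pc 0 $ j))))"
        using has_derivative_Ad[of "p $ j"] by (simp add: pc_def)
      ultimately have "((\<lambda>q. c (p $ j + inv_c (c (inv_c (q $ i) - inv_c (q $ j))) - p $ j)) has_derivative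
          (\<lambda>u. Ad (p $ j) (u $ i - u $ j))) (at (pc 0))"
        using diff_chain_at by (fastforce simp: o_def)
      then have "((\<lambda>q. ?F q $ i) has_derivative (\<lambda>u. Ad (p $ j) (u $ i - u $ j))) (at (pc 0))"
      proof (rule has_derivative_transform_within_open[OF _ oN N0])
        fix q assume qN: "q \<in> N"
        then have q: "\<forall>i. q $ i \<in> c ` U" by (simp add: N_def)
        have "(q $ i, q $ j) \<in> T" using qN by (simp add: N_def)
        then have "inv_c (c (inv_c (q $ i) - inv_c (q $ j))) = inv_c (q $ i) - inv_c (q $ j)"
          using T(4) by simp
        moreover have "- (p $ i - p $ j) + (p $ i + a - (p $ j + b)) = p $ j + (a - b) - p $ j" for a b
          by (simp add: diff_conv_add_uminus minus_add add.assoc del: add_uminus_conv_diff)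
        ultimately show "c (p $ j + inv_c (c (inv_c (q $ i) - inv_c (q $ j))) - p $ j) = ?F q $ i"
          by (simp add: pc_def edge_map_def Some inv[OF q])
      qed
      then show ?thesis by (simp add: Some)
    qed
  qed
  from frechet_derivative_eq[OF this] show ?thesis unfolding chart' by (simp add: left_differential_def)
qed

text \<open>The factors \<open>Ad (p $ j)\<close> in the differential disappear by the invariance of
  the Killing form, which leaves the edge differences.\<close>

lemma isometric_tm: "isometric \<A> (U, c) tm (minus_killing pbr)"
  unfolding isometric_def
proof (intro exI conjI allI)
  show "diffeo (power_atlas \<A>) (edge_map :: 'f ^ 'n \<Rightarrow> 'f ^ 'n)" by (rule diffeo_edge_map)
  fix p u v
  have "mk ((\<chi> i. case par i of None \<Rightarrow> u $ i | Some j \<Rightarrow> Ad (p $ j) (u $ i - u $ j)) $ i)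
      ((\<chi> i. case par i of None \<Rightarrow> v $ i | Some j \<Rightarrow> Ad (p $ j) (v $ i - v $ j)) $ i) =
      mk (edge_diff u $ i) (edge_diff v $ i)" for i
    by (cases "par i") (simp_all add: edge_diff_def mk_Ad)
  then show "let D = left_differential (power_chart (\<lambda>_. (U, c))) edge_map p
      in minus_killing pbr (D u) (D v) = tm u v"
    unfolding Let_def left_differential_edge_map minus_killing_power_bracket tree_metric_def by simp
qed

end

section \<open>The standard metrics for blocks of size one\<close>

lemma block_entry_replicate:
  "block_entry (replicate n 1) i j = (if i = j \<and> i < n then 2 else 0)"
proof (induction n arbitrary: i j)
  case (Suc n)
  \<comment> \<open>For k = 1 the prefactor and the diagonal entry are both sqrt 2.\<close>
  have "standard_entry 1 1 1 = 2" by (simp add: standard_entry_def)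
  then show ?case using Suc[of "i - 1" "j - 1"] by (cases i; cases j) auto
qed simp

lemma card_less_inject:
  fixes i j :: "'n::{finite, linorder}"
  shows "card {l. l < i} = card {l. l < j} \<longleftrightarrow> i = j"
proof -
  have "card {l. l < i} < card {l. l < j}" if "i < j" for i j :: 'n
    using that by (intro psubset_card_mono) auto
  then show ?thesis by (metis less_irrefl linorder_neqE)
qed

lemma block_matrix_replicate:
  fixes i j :: "'n::{finite, linorder}"
  shows "block_matrix (replicate CARD('n) 1) $ i $ j = (if i = j then 2 else 0)"
proof -
  have "card {l. l < i} < CARD('n)" by (intro psubset_card_mono) auto
  then show ?thesis
    unfolding block_matrix_def vec_lambda_beta block_entry_replicate by (simp add: card_less_inject)
qed

context compact_simple_lie_chart
begin

text \<open>The matrix is twice the identity, so in each component the vectors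
  \<open>2 *\<^sub>R X j\<close> are orthonormal for the generated metric; hence the factor
  1/4.\<close>

lemma generates_replicate:
  "generates br (block_matrix (replicate CARD('n) 1))
    (\<lambda>x y :: real ^ 'd ^ ('n::{finite, linorder}). 1 / 4 * minus_killing (power_bracket br) x y)"
  (is "generates br ?A ?b")
proof -
  note lin = inner_product_linear[OF inner_product_mk]
  obtain X :: "'d \<Rightarrow> real ^ 'd" where X: "orthonormal_frame mk UNIV X"
    using orthonormal_frame_exists_vec[OF inner_product_mk] by blast
  then have X': "mk (X j) (X j') = (if j = j' then 1 else 0)" for j j'
    unfolding orthonormal_frame_def by simp
  have "inner_product (minus_killing (power_bracket br :: (real ^ 'd ^ ('n::{finite, linorder})) bracket))"
    by (rule inner_product_minus_killing_power[OF inner_product_mk])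
  then have "inner_product ?b"
    unfolding inner_product_def bilinear_def by (auto simp: linear_iff algebra_simps)
  moreover have "?b (\<chi> m. ?A $ i $ m *\<^sub>R X j) (\<chi> m. ?A $ i' $ m *\<^sub>R X j') = (if i = i' \<and> j = j' then 1 else 0)"
    for i i' j j'
  proof -
    have "minus_killing (power_bracket br) (\<chi> m. ?A $ i $ m *\<^sub>R X j) (\<chi> m. ?A $ i' $ m *\<^sub>R X j') =
        (\<Sum>m\<in>UNIV. if m = i then (if i = i' then 4 * mk (X j) (X j') else 0) else 0)"
      unfolding minus_killing_power_bracket
      by (intro sum.cong) (auto simp: block_matrix_replicate[unfolded One_nat_def] linear_scale[OF lin(1)] linear_scale[OF lin(2)]
          linear_0[OF lin(1)] linear_0[OF lin(2)])
    then show ?thesis by (simp add: X')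
  qed
  ultimately show ?thesis unfolding generates_def using X' by blast
qed

end

section \<open>A large family of forests\<close>

text \<open>
  The elements with \<open>d j = 0\<close>, the least one among them, form a chain in increasing order. An
  element with \<open>d i = 1\<close> hangs below the part of the chain above it, one with \<open>d i = 2\<close> below
  the whole chain.
\<close>

definition spine_up :: "('n::{finite, linorder} \<Rightarrow> nat) \<Rightarrow> 'n \<Rightarrow> 'n set" where
  "spine_up d i = insert i {j. d j = 0 \<and> (i < j \<or> d i = 2)}"

text \<open>Larger chain elements lie nearer to the root, so the least index is the bottom of the
  chain, and an element hung from it has the whole chain above it. Otherwise the parent is the next
  larger chain element.\<close>

definition spine_par :: "('n::{finite, linorder} \<Rightarrow> nat) \<Rightarrow> 'n \<Rightarrow> 'n option" where
  "spine_par d i =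
     (if d i = 2 then Some (Min UNIV)
      else if \<exists>j>i. d j = 0 then Some (Min {j. i < j \<and> d j = 0}) else None)"

lemma forest_spine:
  fixes d :: "'n::{finite, linorder} \<Rightarrow> nat"
  assumes d: "d (Min UNIV) = 0"
  shows "forest (spine_par d) (spine_up d)"
proof
  have m: "Min UNIV \<le> i" for i :: 'n by simp
  have next_elem: "i < Min {j. i < j \<and> d j = 0} \<and> d (Min {j. i < j \<and> d j = 0}) = 0 \<and>
      (\<forall>k. i < k \<longrightarrow> d k = 0 \<longrightarrow> Min {j. i < j \<and> d j = 0} \<le> k)" if "\<exists>j>i. d j = 0" for i
  proof -
    have "Min {j. i < j \<and> d j = 0} \<in> {j. i < j \<and> d j = 0}" using that by (intro Min_in) auto
    then show ?thesis by auto
  qed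
  fix i
  show "spine_up d i = insert i (case spine_par d i of None \<Rightarrow> {} | Some j \<Rightarrow> spine_up d j)"
  proof (cases "d i = 2")
    case True
    have "spine_up d (Min UNIV) = {j. d j = 0}"
      using d m by (auto simp: spine_up_def le_less)
    then show ?thesis using True by (auto simp: spine_par_def spine_up_def)
  next
    case False
    show ?thesis
    proof (cases "\<exists>j>i. d j = 0")
      case True
      define k where "k = Min {j. i < j \<and> d j = 0}"
      have k: "i < k" "d k = 0" "\<And>l. i < l \<Longrightarrow> d l = 0 \<Longrightarrow> k \<le> l"
        using next_elem[OF True] by (auto simp: k_def)
      have "insert k {j. d j = 0 \<and> k < j} = {j. d j = 0 \<and> i < j}"
        using k by (auto simp: le_less)
      then show ?thesis using True False k by (simp add: spine_par_def spine_up_def flip: k_def)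
    next
      case no: False
      then show ?thesis using False by (auto simp: spine_par_def spine_up_def)
    qed
  qed
  show "i \<notin> spine_up d j" if "spine_par d i = Some j" for j
  proof (cases "d i = 2")
    case True
    then show ?thesis using that d by (auto simp: spine_par_def spine_up_def)
  next
    case False
    then have ex: "\<exists>j>i. d j = 0" and j: "j = Min {j. i < j \<and> d j = 0}"
      using that by (auto simp: spine_par_def split: if_splits)
    then have "i < j" "d j = 0" using next_elem[OF ex] by simp_all
    then show ?thesis by (auto simp: spine_up_def)
  qed
qed

text \<open>The path of the least index is the chain, so it reveals which labels are 0; label 2
  means that the least index lies on the path of i. Below 3 only the label 1 is left.\<close>

lemma spine_up_inject:
  fixes d e :: "'n::{finite, linorder} \<Rightarrow> nat"
  assumes "d (Min UNIV) = 0" "e (Min UNIV) = 0" "\<And>i. d i < 3" "\<And>i. e i < 3" "spine_up d = spine_up e"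
  shows "d = e"
proof
  fix i
  let ?m = "Min UNIV :: 'n"
  have zero: "f i = 0 \<longleftrightarrow> i \<in> spine_up f ?m" and two: "f i = 2 \<longleftrightarrow> ?m \<in> spine_up f i"
    if "f ?m = 0" "i \<noteq> ?m" for f :: "'n \<Rightarrow> nat"
  proof -
    have "?m \<le> i" by (rule Min_le) simp_all
    then have "?m < i" using that(2) unfolding less_le by blast
    then show "f i = 0 \<longleftrightarrow> i \<in> spine_up f ?m" "f i = 2 \<longleftrightarrow> ?m \<in> spine_up f i"
      using that by (auto simp: spine_up_def)
  qed
  show "d i = e i"
  proof (cases "i = ?m")
    case True
    then show ?thesis using assms(1,2) by simp
  next
    case False
    have "d i = 0 \<longleftrightarrow> e i = 0" "d i = 2 \<longleftrightarrow> e i = 2"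
      using zero[of d, OF assms(1) False] zero[of e, OF assms(2) False] two[of d, OF assms(1) False] two[of e, OF assms(2) False] assms(5)
      by simp_all
    then show ?thesis using assms(3)[of i] assms(4)[of i] by linarith
  qed
qed

text \<open>The label 0 at the least index provides the bottom of the chain that
  \<open>forest_spine\<close> requires.\<close>

definition spine_labels :: "('n::{finite, linorder} \<Rightarrow> nat) set" where
  "spine_labels = (\<Pi>\<^sub>E i\<in>UNIV. if i = Min UNIV then {0} else {..<3})"

lemma card_spine_labels: "card (spine_labels :: ('n::{finite, linorder} \<Rightarrow> nat) set) = 3 ^ (CARD('n) - 1)"
proof -
  have "card (spine_labels :: ('n \<Rightarrow> nat) set) = (\<Prod>i\<in>(UNIV :: 'n set). card (if i = Min UNIV then {0} else {..<3::nat}))"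
    unfolding spine_labels_def by (rule card_PiE) simp
  also have "\<dots> = (\<Prod>i\<in>UNIV - {Min UNIV :: 'n}. 3)"
    by (subst prod.remove[of _ "Min UNIV"]) (auto intro!: prod.cong)
  finally show ?thesis by (simp add: card_Diff_singleton)
qed

lemma spine_labelsD:
  assumes "d \<in> spine_labels"
  shows "d (Min UNIV) = 0" "d i < 3"
proof -
  have "d i \<in> (if i = Min UNIV then {0} else {..<3})" for i
    using assms unfolding spine_labels_def by blast
  from this[of "Min UNIV"] this[of i] show "d (Min UNIV) = 0" "d i < 3" by (auto split: if_splits)
qed

text \<open>Expresses ancestry through the numbers of common ancestors alone, since these are what
  the metric reveals.\<close>

lemma (in forest) mem_up_iff_card: "j \<in> up i \<longleftrightarrow> card (up i \<inter> up j) = card (up j \<inter> up j)"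
proof
  assume "j \<in> up i"
  then have "up i \<inter> up j = up j" using up_trans by blast
  then show "card (up i \<inter> up j) = card (up j \<inter> up j)" by simp
next
  assume "card (up i \<inter> up j) = card (up j \<inter> up j)"
  then have "up i \<inter> up j = up j" by (intro card_subset_eq) auto
  then show "j \<in> up i" using up_self by blast
qed

text \<open>Equal metrics have equal representers in \<open>tm_dual\<close>. Comparing their
  components for a nonzero Y gives equal numbers of common ancestors, and these determine the
  paths.\<close>

lemma tree_metric_inject:
  assumes "forest_lie_chart \<A> U c par up" "forest_lie_chart \<A> U c par' up'"
    and eq: "forest.tree_metric par (minus_killing (lie_bracket (U, c))) =
      forest.tree_metric par' (minus_killing (lie_bracket (U, c)))"
  shows "up = up'"
proof -
  interpret F: forest_lie_chart \<A> U c par up by (rule assms(1))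
  interpret F': forest_lie_chart \<A> U c par' up' by (rule assms(2))
  obtain x y where "F.br x y \<noteq> 0" using F.simple_br unfolding simple_bracket_def by blast
  then obtain Y :: "real ^ 'b" where Y: "Y \<noteq> 0" by blast
  have "(\<Sum>v\<in>up i. F.branch v Y) = (\<Sum>v\<in>up' i. F'.branch v Y)" for i
    by (rule inner_product_ext[OF F.inner_product_tm])
      (simp add: F.tm_dual, simp add: eq F'.tm_dual)
  then have "real (card (up i \<inter> up j)) *\<^sub>R Y = real (card (up' i \<inter> up' j)) *\<^sub>R Y" for i j
    unfolding F.dual_component[symmetric] F'.dual_component[symmetric] by simp
  then have card: "card (up i \<inter> up j) = card (up' i \<inter> up' j)" for i j using Y by simp
  have "j \<in> up i \<longleftrightarrow> j \<in> up' i" for i j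
    unfolding F.mem_up_iff_card F'.mem_up_iff_card card ..
  then show ?thesis by (simp add: fun_eq_iff set_eq_iff)
qed

text \<open>A homothety by r multiplies the relative determinant by a positive power of r, which
  must be 1 between two metrics of volume 1.\<close>

lemma unit_volume_homothety_inject:
  fixes b b' :: "(real ^ 'd ^ 'n) form"
  assumes "b \<in> unit_volume_metrics br" "b' \<in> unit_volume_metrics br"
    "homothety `` {b} = homothety `` {b'}"
  shows "b = b'"
proof -
  have "(b', b') \<in> homothety" unfolding homothety_def by (auto intro!: exI[of _ 1])
  then have "(b, b') \<in> homothety" using assms(3) by blast
  then obtain r where r: "r > 0" "b' = (\<lambda>u v. r * b u v)" unfolding homothety_def by auto
  have pow: "r ^ (CARD('n) * CARD('d)) = 1"
    using assms(1,2) relative_det_scale[of "minus_killing (power_bracket br)" r b]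
    unfolding unit_volume_metrics_def r(2) by simp
  have "r = 1" using power_eq_1_iff[OF pow] r(1) by simp
  then show ?thesis using r(2) by simp
qed

text \<open>The homothety classes are an image of a subset of the critical metrics, so this is the
  comparison of \<open>REM\<close> with \<open>CPS\<close>.\<close>

lemma ecard_image_le: "A \<subseteq> B \<Longrightarrow> ecard (f ` A) \<le> ecard B"
  using card_image_le[of A f] card_mono[of B A] finite_subset[of A B]
  by (auto simp: ecard_def intro: le_trans)

theorem proposition2:
  fixes \<A> :: "('f::{group_add, t2_space, second_countable_topology}, real ^ 'd) chart set"
    and U :: "'f set" and c :: "'f \<Rightarrow> real ^ 'd"
  assumes "lie_group \<A>"
    and "connected (UNIV :: 'f set)"
    and "compact (UNIV :: 'f set)"
    and "(U, c) \<in> \<A>" and "0 \<in> U"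
    and "simple_bracket (lie_bracket (U, c))"
  shows "CPS (lie_bracket (U, c)) TYPE('n::{finite, linorder}) \<ge> REM \<A> (U, c) TYPE('n) \<and>
    ereal_of_enat (REM \<A> (U, c) TYPE('n)) \<ge> ereal ((1 + sqrt 2) ^ (CARD('n) - 1))"
proof -
  let ?br = "lie_bracket (U, c)"
  interpret compact_simple_lie_chart \<A> U c
    using assms by unfold_locales
  define S :: "(real ^ 'd ^ ('n::{finite, linorder})) form set"
    where "S = {b. b \<in> critical_metrics ?br \<and> routine \<A> (U, c) b}"
  have REM: "REM \<A> (U, c) TYPE('n) = ecard (S // homothety)" by (simp add: REM_def S_def)
  have quot: "S // homothety = (\<lambda>b. homothety `` {b}) ` S" unfolding quotient_def by blast
  define b :: "('n \<Rightarrow> nat) \<Rightarrow> (real ^ 'd ^ ('n::{finite, linorder})) form"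
    where "b d = forest.tree_metric (spine_par d) (minus_killing ?br)" for d
  have fl: "forest_lie_chart \<A> U c (spine_par d) (spine_up d)" if "d \<in> spine_labels" for d :: "'n \<Rightarrow> nat"
    using forest_spine[where d = d, OF spine_labelsD(1)[OF that]] compact_simple_lie_chart_axioms
    by (simp add: forest_lie_chart_def)
  have "b d \<in> S" if "d \<in> spine_labels" for d
  proof -
    interpret F: forest_lie_chart \<A> U c "spine_par d" "spine_up d" by (rule fl[OF that])
    \<comment> \<open>Blocks of size 1 generate a quarter of the product metric, so the homothety
      factor in \<open>routine\<close> is 4.\<close>
    let ?b' = "\<lambda>x y. 1 / 4 * minus_killing F.pbr x y"
    have "routine \<A> (U, c) F.tm"
      unfolding routine_def
    proof (intro conjI exI)
      show "einstein F.pbr F.tm" unfolding einstein_def using F.ricci_tm by blast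
      show "\<forall>m\<in>set (replicate CARD('n) (1::nat)). 1 \<le> m" "sum_list (replicate CARD('n) (1::nat)) = CARD('n)"
        by (simp_all add: sum_list_replicate)
      show "generates ?br (block_matrix (replicate CARD('n) 1)) ?b'" by (rule generates_replicate)
      show "isometric \<A> (U, c) F.tm (\<lambda>u v. 4 * ?b' u v)" using F.isometric_tm by simp
    qed (use F.invariant_metric_tm in simp_all)
    then show ?thesis unfolding S_def b_def using F.tm_critical by simp
  qed
  then have sub: "b ` spine_labels \<subseteq> S" by blast
  have crit: "S \<subseteq> critical_metrics ?br" unfolding S_def by blast
  have unit: "critical_metrics ?br \<subseteq> unit_volume_metrics ?br" unfolding critical_metrics_def by blast
  have "inj_on b spine_labels"
  proof (rule inj_onI)
    fix d e :: "'n \<Rightarrow> nat" assume de: "d \<in> spine_labels" "e \<in> spine_labels" "b d = b e"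
    have "spine_up d = spine_up e"
      using tree_metric_inject[OF fl[OF de(1)] fl[OF de(2)]] de(3) unfolding b_def by blast
    then show "d = e"
      by (intro spine_up_inject spine_labelsD(1)[OF de(1)] spine_labelsD(1)[OF de(2)]
          spine_labelsD(2)[OF de(1)] spine_labelsD(2)[OF de(2)])
  qed
  \<comment> \<open>Passing to homothety classes identifies no two metrics here, since all have
    volume 1.\<close>
  moreover have "inj_on (\<lambda>b. homothety `` {b}) S"
  proof (rule inj_onI)
    fix x y assume "x \<in> S" "y \<in> S" "homothety `` {x} = homothety `` {y}"
    then show "x = y" using crit unit by (intro unit_volume_homothety_inject[of x ?br y]) auto
  qed
  ultimately have "inj_on ((\<lambda>b. homothety `` {b}) \<circ> b) spine_labels"
    using sub by (intro comp_inj_on) (auto intro: inj_on_subset)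
  then have card: "card (((\<lambda>b. homothety `` {b}) \<circ> b) ` spine_labels) = 3 ^ (CARD('n) - 1)"
    by (simp only: card_image card_spine_labels)
  have "((\<lambda>b. homothety `` {b}) \<circ> b) ` spine_labels \<subseteq> S // homothety"
    unfolding quot using sub by auto
  then have ge: "3 ^ (CARD('n) - 1) \<le> card (S // homothety)" if "finite (S // homothety)"
    unfolding card[symmetric] by (rule card_mono[OF that])
  \<comment> \<open>This gives 1 + sqrt 2 <= 3, so the labelled forests are numerous enough.\<close>
  have "sqrt 2 \<le> 2" using real_sqrt_le_mono[of 2 4] by simp
  then have "(1 + sqrt 2) ^ (CARD('n) - 1) \<le> (3::real) ^ (CARD('n) - 1)"
    by (intro power_mono) simp_all
  moreover have "(3::real) ^ (CARD('n) - 1) \<le> real (card (S // homothety))" if "finite (S // homothety)"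
    using of_nat_mono[OF ge[OF that], where 'a = real] by simp
  ultimately have "(1 + sqrt 2) ^ (CARD('n) - 1) \<le> real (card (S // homothety))" if "finite (S // homothety)"
    using that order_trans by blast
  \<comment> \<open>With infinitely many classes \<open>ecard\<close> is infinite and the bound is
    immediate.\<close>
  then have "ereal ((1 + sqrt 2) ^ (CARD('n) - 1)) \<le> ereal_of_enat (ecard (S // homothety))"
    by (cases "finite (S // homothety)") (simp_all add: ecard_def)
  moreover have "ecard (S // homothety) \<le> ecard (critical_metrics ?br :: (real ^ 'd ^ ('n::{finite, linorder})) form set)"
    unfolding quot by (rule ecard_image_le[OF crit])
  ultimately show ?thesis unfolding REM CPS_def by simp
qed

end
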